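(* Assume that there are constants $p_0>2$, $p_1>2$, $\rho>0$ and $L>0$ such that, for all $t\in[0,T]$, $x,\bar x\in\mathbb{R}^d$, $\mu,\bar\mu\in\mathcal{P}_2(\mathbb{R}^d)$: (1) $E|X_0|^{p_0}<\infty$; (2) $2\langle x,b_t(x,\mu)\rangle+(p_0-1)|\sigma_t(x,\mu)|^2+(p_0-1)|\sigma^0_t(x,\mu)|^2\le L\{(1+|x|)^2+\mathcal{W}_2^2(\mu,\delta_0)\}$; (3) $2\langle x-\bar x,b_t(x,\mu)-b_t(\bar x,\bar\mu)\rangle+(p_1-1)|\sigma_t(x,\mu)-\sigma_t(\bar x,\bar\mu)|^2+(p_1-1)|\sigma^0_t(x,\mu)-\sigma^0_t(\bar x,\bar\mu)|^2\le L\{|x-\bar x|^2+\mathcal{W}_2^2(\mu,\bar\mu)\}$; (4) $|b_t(x,\mu)-b_t(\bar x,\bar\mu)|\le L\{(1+|x|+|\bar x|)^{\rho/2}|x-\bar x|+\mathcal{W}_2(\mu,\bar\mu)\}$. Let $X^{i,N,n}$ be the tamed Euler scheme defined in the context. Then $$\sup_{i\in\{1,\ldots,N\}}\sup_{t\in[0,T]}E\big(1+|X^{i,N,n}_t|^2\big)^{p_0/2}\le K,$$ where $K>0$ does not depend on $n,N\in\mathbb{N}$. Moreover, for any $q<p_0$, $$\sup_{i\in\{1,\ldots,N\}}E\sup_{t\in[0,T]}\big(1+|X^{i,N,n}_t|^2\big)^{q/2}\le K,$$ where $K>0$ does not depend on $n,N\in\mathbb{N}$ (but may depend on $q$).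
   Context: $T>0$, $d,m,m^0\in\mathbb{N}$ are fixed. $(\Omega^0,\mathcal{F}^0,P^0)$ and $(\Omega^1,\mathcal{F}^1,P^1)$ are complete probability spaces with filtrations satisfying the usual conditions, $(\Omega,\mathcal{F},P)$ is their completed product with the corresponding augmented product filtration, $E$ is expectation under $P$. $W^0$ is an $m^0$-dimensional Wiener process on $\Omega^0$; $W^1,W^2,\ldots$ are independent $m$-dimensional Wiener processes on $\Omega^1$; $X_0^1,X_0^2,\ldots$ are i.i.d. $\mathcal{F}^1_0$-measurable copies of an $\mathbb{R}^d$-valued random variable $X_0$ on $\Omega^1$. $\mathcal{P}_2(\mathbb{R}^d)$ is the set of probability measures with finite second moment, with the $L^2$-Wasserstein metric $\mathcal{W}_2$. $|\cdot|$ is the Euclidean (vectors) or Hilbert–Schmidt (matrices) norm. The coefficients $b,\sigma,\sigma^0:[0,T]\times\mathbb{R}^d\times\mathcal{P}_2(\mathbb{R}^d)\to\mathbb{R}^d,\mathbb{R}^{d\times m},\mathbb{R}^{d\times m^0}$ are measurable. Tamed Euler scheme: with $\kappa_n(t)=\lfloor nt\rfloor/n$ and $$b^n_t(x,\mu)=\frac{b_t(x,\mu)}{1+n^{-1/2}|x|^{\rho/2}},\quad \sigma^n_t(x,\mu)=\frac{\sigma_t(x,\mu)}{1+n^{-1/2}|x|^{\rho/2}},\quad \sigma^{0,n}_t(x,\mu)=\frac{\sigma^0_t(x,\mu)}{1+n^{-1/2}|x|^{\rho/2}},$$ $X_t^{i,N,n}=X_0^i+\int_0^t b^n_{\kappa_n(s)}(X^{i,N,n}_{\kappa_n(s)},\mu^{X,N,n}_{\kappa_n(s)})ds+\int_0^t\sigma^n_{\kappa_n(s)}(X^{i,N,n}_{\kappa_n(s)},\mu^{X,N,n}_{\kappa_n(s)})dW^i_s+\int_0^t\sigma^{0,n}_{\kappa_n(s)}(X^{i,N,n}_{\kappa_n(s)},\mu^{X,N,n}_{\kappa_n(s)})dW^0_s$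 for $i=1,\ldots,N$, where $\mu_t^{X,N,n}=\frac1N\sum_{j=1}^N\delta_{X_t^{j,N,n}}$. *)

theory Defs
  imports "HOL-Probability.Probability"
begin

section \<open>Filtrations and Wiener processes on a time interval\<close>

text \<open>Only the restriction of a filtration or of a process to \<open>[0, T]\<close> is relevant.\<close>

definition usual_filtration :: "real \<Rightarrow> 'w measure \<Rightarrow> (real \<Rightarrow> 'w measure) \<Rightarrow> bool" where
  "usual_filtration T M F \<longleftrightarrow>
     (\<forall>t\<in>{0..T}. subalgebra M (F t)) \<and>
     (\<forall>s\<in>{0..T}. \<forall>t\<in>{s..T}. sets (F s) \<subseteq> sets (F t)) \<and>
     (\<forall>t\<in>{0..<T}. (\<Inter>s\<in>{t<..T}. sets (F s)) = sets (F t)) \<and>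
     null_sets M \<subseteq> sets (F 0)"

text \<open>The increment over \<open>[s, t]\<close> has law \<open>N(0, (t - s) I)\<close>; its density is a product because
  the covariance matrix is diagonal.\<close>

definition wiener_process ::
  "real \<Rightarrow> 'w measure \<Rightarrow> (real \<Rightarrow> 'w measure) \<Rightarrow> (real \<Rightarrow> 'w \<Rightarrow> real ^ 'm) \<Rightarrow> bool" where
  "wiener_process T M F W \<longleftrightarrow>
     (\<forall>t\<in>{0..T}. W t \<in> borel_measurable (F t)) \<and>
     (AE \<omega> in M. W 0 \<omega> = 0) \<and>
     (AE \<omega> in M. continuous_on {0..T} (\<lambda>t. W t \<omega>)) \<and>
     (\<forall>s\<in>{0..T}. \<forall>t\<in>{s<..T}.
        distributed M lborel (\<lambda>\<omega>. W t \<omega> - W s \<omega>)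
          (\<lambda>x. ennreal (\<Prod>k\<in>UNIV. normal_density 0 (sqrt (t - s)) (x $ k))) \<and>
        prob_space.indep_set M (sets (F s))
          (sets (vimage_algebra (space M) (\<lambda>\<omega>. W t \<omega> - W s \<omega>) borel)))"

text \<open>Independence of whole paths, as random elements of the product space \<open>(\<real>\<^sup>m)\<^bsup>[0,T]\<^esup>\<close>.\<close>

definition indep_processes ::
  "real \<Rightarrow> 'w measure \<Rightarrow> (nat \<Rightarrow> real \<Rightarrow> 'w \<Rightarrow> real ^ 'm) \<Rightarrow> nat set \<Rightarrow> bool" where
  "indep_processes T M W I \<longleftrightarrow>
     prob_space.indep_vars M (\<lambda>_. Pi\<^sub>M {0..T} (\<lambda>_. borel)) (\<lambda>i \<omega>. \<lambda>t\<in>{0..T}. W i t \<omega>) I"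


section \<open>The \<open>L\<^sup>2\<close>-Wasserstein space\<close>

definition P2 :: "'a::euclidean_space measure set" where
  "P2 = {\<mu>. prob_space \<mu> \<and> sets \<mu> = sets borel \<and> integrable \<mu> (\<lambda>x. (norm x)\<^sup>2)}"

definition couplings ::
  "'a::euclidean_space measure \<Rightarrow> 'a measure \<Rightarrow> ('a \<times> 'a) measure set" where
  "couplings \<mu> \<nu> = {\<pi>. sets \<pi> = sets (borel \<Otimes>\<^sub>M borel) \<and>
     distr \<pi> borel fst = \<mu> \<and> distr \<pi> borel snd = \<nu>}"

text \<open>On \<open>P2\<close> the infimum is finite (take the product coupling), so \<^const>\<open>enn2real\<close> is harmless
  there.\<close>

definition W2 :: "'a::euclidean_space measure \<Rightarrow> 'a measure \<Rightarrow> real" where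
  "W2 \<mu> \<nu> = sqrt (enn2real
     (\<Sqinter>\<pi>\<in>couplings \<mu> \<nu>. \<integral>\<^sup>+ z. ennreal ((dist (fst z) (snd z))\<^sup>2) \<partial>\<pi>))"

definition borel_P2 :: "'a::euclidean_space measure measure" where
  "borel_P2 = sigma P2 {U. U \<subseteq> P2 \<and> (\<forall>\<mu>\<in>U. \<exists>r>0. \<forall>\<nu>\<in>P2. W2 \<mu> \<nu> < r \<longrightarrow> \<nu> \<in> U)}"

definition measurable_coeff ::
  "real \<Rightarrow> (real \<Rightarrow> 'a::euclidean_space \<Rightarrow> 'a measure \<Rightarrow> 'b::topological_space) \<Rightarrow> bool" where
  "measurable_coeff T f \<longleftrightarrow>
     (\<lambda>(t, x, \<mu>). f t x \<mu>) \<in>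
       borel_measurable (restrict_space borel {0..T} \<Otimes>\<^sub>M (borel \<Otimes>\<^sub>M borel_P2))"

definition empirical_measure :: "nat \<Rightarrow> (nat \<Rightarrow> 'a::euclidean_space) \<Rightarrow> 'a measure" where
  "empirical_measure N x = distr (uniform_count_measure {1..N}) borel x"

lemma emeasure_empirical_measure:
  assumes "N \<ge> 1" "A \<in> sets borel"
  shows "emeasure (empirical_measure N x) A =
    ennreal (1 / real N) * (\<Sum>j=1..N. emeasure (return borel (x j)) A)"
proof -
  have "emeasure (empirical_measure N x) A =
      emeasure (uniform_count_measure {1..N}) (x -` A \<inter> {1..N})"
    unfolding empirical_measure_def using assms(2)
    by (subst emeasure_distr) (auto simp: space_uniform_count_measure)
  also have "\<dots> = ennreal (real (card (x -` A \<inter> {1..N})) / real N)"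
    by (subst emeasure_uniform_count_measure) (use assms(1) in auto)
  also have "\<dots> = ennreal (1 / real N) * ennreal (real (card (x -` A \<inter> {1..N})))"
    by (simp flip: ennreal_mult)
  also have "ennreal (real (card (x -` A \<inter> {1..N}))) =
      (\<Sum>j=1..N. emeasure (return borel (x j)) A)"
  proof -
    have "(\<Sum>j=1..N. emeasure (return borel (x j)) A) = (\<Sum>j=1..N. indicator A (x j))"
      using assms(2) by simp
    also have "\<dots> = (\<Sum>j\<in>{1..N}. indicator (x -` A) j :: ennreal)"
      by (simp add: indicator_def)
    also have "\<dots> = of_nat (card ({1..N} \<inter> x -` A))"
      by (simp add: indicator_def sum.If_cases vimage_def flip: of_nat_sum)
    finally show ?thesis
      by (simp add: Int_commute ennreal_of_nat_eq_real_of_nat)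
  qed
  finally show ?thesis .
qed


section \<open>The tamed Euler scheme\<close>

definition kappa :: "nat \<Rightarrow> real \<Rightarrow> real" where
  "kappa n t = of_int \<lfloor>real n * t\<rfloor> / real n"

definition tamed ::
  "nat \<Rightarrow> real \<Rightarrow> (real \<Rightarrow> 'a \<Rightarrow> 'a measure \<Rightarrow> 'b) \<Rightarrow>
   real \<Rightarrow> 'a::euclidean_space \<Rightarrow> 'a measure \<Rightarrow> 'b::real_vector" where
  "tamed n \<rho> f t x \<mu> =
     f t x \<mu> /\<^sub>R (1 + real n powr (- 1 / 2) * norm x powr (\<rho> / 2))"

text \<open>The elementary Ito integral: for an integrand \<open>H\<close> that is constant on each cell
  \<open>[k/n, (k+1)/n)\<close>, the integral \<open>\<integral>\<^sub>0\<^sup>t H\<^sub>s dW\<^sub>s\<close> is by definition the finite sum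
  of the terms \<open>H\<^bsub>k/n\<^esub> (W\<^bsub>t \<and> (k+1)/n\<^esub> - W\<^bsub>t \<and> k/n\<^esub>)\<close>; the terms with \<open>k/n \<ge> t\<close>
  vanish and are omitted.\<close>

definition step_ito_integral ::
  "nat \<Rightarrow> (real \<Rightarrow> real ^ 'm ^ 'd) \<Rightarrow> (real \<Rightarrow> real ^ 'm) \<Rightarrow> real \<Rightarrow> real ^ 'd" where
  "step_ito_integral n H W t =
     (\<Sum>k<nat \<lceil>real n * t\<rceil>.
        H (real k / real n) *v
          (W (min t (real (Suc k) / real n)) - W (min t (real k / real n))))"

text \<open>The completed product space.\<close>

definition prod_space :: "'v measure \<Rightarrow> 'w measure \<Rightarrow> ('v \<times> 'w) measure" where
  "prod_space M0 M1 = completion (M0 \<Otimes>\<^sub>M M1)"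

text \<open>\<open>X i t\<close> is the \<open>i\<close>-th particle at time \<open>t\<close>. Processes given on one of the factors are extended
  to the product space by composition with the projections.\<close>

definition tamed_euler_scheme ::
  "real \<Rightarrow> 'v measure \<Rightarrow> 'w measure \<Rightarrow> real \<Rightarrow>
   (real \<Rightarrow> real ^ 'd \<Rightarrow> (real ^ 'd) measure \<Rightarrow> real ^ 'd) \<Rightarrow>
   (real \<Rightarrow> real ^ 'd \<Rightarrow> (real ^ 'd) measure \<Rightarrow> real ^ 'm ^ 'd) \<Rightarrow>
   (real \<Rightarrow> real ^ 'd \<Rightarrow> (real ^ 'd) measure \<Rightarrow> real ^ 'm0 ^ 'd) \<Rightarrow>
   (real \<Rightarrow> 'v \<Rightarrow> real ^ 'm0) \<Rightarrow> (nat \<Rightarrow> real \<Rightarrow> 'w \<Rightarrow> real ^ 'm) \<Rightarrow>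
   (nat \<Rightarrow> 'w \<Rightarrow> real ^ 'd) \<Rightarrow> nat \<Rightarrow> nat \<Rightarrow>
   (nat \<Rightarrow> real \<Rightarrow> 'v \<times> 'w \<Rightarrow> real ^ 'd) \<Rightarrow> bool" where
  "tamed_euler_scheme T M0 M1 \<rho> b \<sigma> \<sigma>0 W0 W \<xi> N n X \<longleftrightarrow>
     (AE \<omega> in prod_space M0 M1. \<forall>i\<in>{1..N}. \<forall>t\<in>{0..T}.
        (let x = (\<lambda>s. X i (kappa n s) \<omega>);
             \<mu> = (\<lambda>s. empirical_measure N (\<lambda>j. X j (kappa n s) \<omega>))
         in X i t \<omega> =
              \<xi> i (snd \<omega>)
              + (LINT s:{0..t}|lborel. tamed n \<rho> b (kappa n s) (x s) (\<mu> s))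
              + step_ito_integral n (\<lambda>s. tamed n \<rho> \<sigma> (kappa n s) (x s) (\<mu> s))
                  (\<lambda>s. W i s (snd \<omega>)) t
              + step_ito_integral n (\<lambda>s. tamed n \<rho> \<sigma>0 (kappa n s) (x s) (\<mu> s))
                  (\<lambda>s. W0 s (fst \<omega>)) t))"

end

theory Submission
  imports Defs
begin

text \<open>
  No Ito formula is needed. Put \<open>A = 1 + |x|\<^sup>2\<close> and expand
  \<open>A\<^bsup>r\<^esup> (1 + z)\<^bsup>r\<^esup>\<close>, \<open>r = p0 / 2\<close>, to fourth order in the relative increment \<open>z\<close>
  of \<open>A\<close> over one Euler step. The noise is symmetric, so odd terms cancel; the first- and second-order
  terms combine to the left-hand side of the coercivity condition; and the taming makes the drift
  \<open>O(n\<^bsup>1/2\<^esup>)\<close> and the diffusion \<open>O(n\<^bsup>1/4\<^esup>)\<close> relative to \<open>|x|\<close>, which leaves a remainder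
  \<open>O(1/n)\<close>. A discrete Gronwall argument, uniform over the particles since
  \<open>W\<^sub>2\<^sup>2(\<mu>, \<delta>\<^sub>0)\<close> is the mean of the \<open>|X\<^sup>j|\<^sup>2\<close>, gives the first bound.
  The same estimate makes \<open>(1 + |X|\<^sup>2)\<^bsup>r\<^esup>\<close> an almost-supermartingale on the grid, whence a
  weak-type maximal inequality and all moments of the maximum of order \<open>q < p0\<close>; between grid points
  the Wiener oscillations are controlled by Doob's inequality.
\<close>

section \<open>Expansion of the moment function\<close>

text \<open>Let v = |beta| / sqrt A and u = |G| / sqrt A be the relative drift and noise of one
  step. Taming makes v of order n^(-1/2) and u of order n^(-1/4), so v^2, v u^2 and u^4 are of order
  1/n but u^3 is not. Hence the fourth order of the expansion, and hence the cubic term must cancel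
  by symmetry instead of being estimated. The obstacle is the measure argument: the mean s of the
  squared norms of all particles is not controlled by A for the particle that moves. If s <= n A,
  the relative drift stays bounded and the expansion applies. If s > n A, it is abandoned:
  everything is then of size s / n, and r > 1 gives (s / n)^r <= s^r / n. Either way the error is (K
  / n) (A^r + s^r), and Jensen's inequality bounds the expectation of s^r by the largest particle
  moment. Conditional expectations are replaced by freezing: integrals over past events in which the
  increment is replaced by an integral over its law. Turning the weak-type tail of the maximum into
  a moment costs a little of the exponent, which is why the second bound stops short of p0.\<close>

lemma power_le_sum_powers:
  fixes u :: real
  assumes "0 \<le> u" "a \<le> i" "i \<le> b"
  shows "u ^ i \<le> u ^ a + u ^ b"
proof (cases "u \<le> 1")
  case True
  then have "u ^ i \<le> u ^ a" using assms by (intro power_decreasing) auto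
  then show ?thesis using assms by (simp add: add_increasing2)
next
  case False
  then have "u ^ i \<le> u ^ b" using assms by (intro power_increasing) auto
  then show ?thesis using assms by (simp add: add_increasing)
qed

text \<open>Taylor's formula with Lagrange remainder. The restriction on z keeps 1 + t in
  [1/2, 3/2], so \<open>2 powr \<bar>r - 4\<bar>\<close> bounds the power in the fourth derivative
  for either sign of r - 4. The factor 1/24 is given away.\<close>

lemma powr_binomial_bound_near:
  fixes r z :: real
  assumes r: "r > 1" and z: "\<bar>z\<bar> \<le> 1 / 2"
  shows "(1 + z) powr r \<le> 1 + r * z + r * (r - 1) / 2 * z ^ 2 + r * (r - 1) * (r - 2) / 6 * z ^ 3
    + \<bar>r * (r - 1) * (r - 2) * (r - 3)\<bar> * 2 powr \<bar>r - 4\<bar> * z ^ 4"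
proof (cases "z = 0")
  case True then show ?thesis by simp
next
  case False
  \<comment> \<open>The m-th derivative of \<open>(1 + t) powr r\<close>: a falling factorial times
    a power, in the shape that \<open>Taylor\<close> expects.\<close>
  define dif where "dif m t = (\<Prod>i<m. r - real i) * (1 + t) powr (r - real m)" for m t
  have D: "DERIV (dif m) t :> dif (Suc m) t" if "m < 4" "-1/2 \<le> t \<and> t \<le> 1/2" for m t
  proof -
    have "DERIV (\<lambda>t. (1 + t) powr (r - real m)) t :> (r - real m) * (1 + t) powr (r - real m - of_nat 1) * 1"
      using that by (intro DERIV_fun_powr) (auto intro!: derivative_eq_intros)
    from DERIV_cmult[OF this, of "\<Prod>i<m. r - real i"] show ?thesis
      by (simp add: dif_def[abs_def] algebra_simps)
  qed
  obtain t where t: "if z < 0 then z < t \<and> t < 0 else 0 < t \<and> t < z"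
    and eq: "(1 + z) powr r = (\<Sum>m<4. dif m 0 / fact m * (z - 0) ^ m) + dif 4 t / fact 4 * (z - 0) ^ 4"
  proof -
    have "dif 0 = (\<lambda>z. (1 + z) powr r)" by (simp add: dif_def fun_eq_iff)
    then have "\<exists>t. (if z < 0 then z < t \<and> t < 0 else 0 < t \<and> t < z) \<and>
        (1 + z) powr r = (\<Sum>m<4. dif m 0 / fact m * (z - 0) ^ m) + dif 4 t / fact 4 * (z - 0) ^ 4"
      using Taylor[of 4 dif "\<lambda>z. (1 + z) powr r" "-1/2" "1/2" 0 z] D z False by (auto simp: abs_le_iff)
    then show ?thesis using that by blast
  qed
  have t2: "\<bar>t\<bar> \<le> 1/2" using t z by (auto split: if_splits)
  have P: "(1 + t) powr (r - 4) \<le> 2 powr \<bar>r - 4\<bar>"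
  proof (cases "r \<ge> 4")
    case True then show ?thesis using t2 by (auto intro!: powr_mono2)
  next
    case False
    have "(1 + t) powr (r - 4) = (1 / (1 + t)) powr (4 - r)"
      using t2 powr_minus_divide[of "1 + t" "4 - r"] by (simp add: powr_divide)
    also have "\<dots> \<le> 2 powr (4 - r)"
      using t2 False by (intro powr_mono2) (auto simp: field_simps)
    finally show ?thesis using False by simp
  qed
  have "dif 4 t / fact 4 * z ^ 4 \<le> \<bar>r * (r - 1) * (r - 2) * (r - 3)\<bar> * 2 powr \<bar>r - 4\<bar> * z ^ 4"
  proof (rule mult_right_mono)
    have "dif 4 t / fact 4 \<le> \<bar>dif 4 t\<bar> / fact 4" by (intro divide_right_mono) auto
    also have "\<dots> \<le> \<bar>dif 4 t\<bar> / 1" by (intro divide_left_mono) auto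
    also have "\<bar>dif 4 t\<bar> / 1 \<le> \<bar>r * (r - 1) * (r - 2) * (r - 3)\<bar> * 2 powr \<bar>r - 4\<bar>"
      unfolding dif_def using P by (auto simp: eval_nat_numeral abs_mult intro!: mult_left_mono)
    finally show "dif 4 t / fact 4 \<le> \<bar>r * (r - 1) * (r - 2) * (r - 3)\<bar> * 2 powr \<bar>r - 4\<bar>" .
  qed auto
  moreover have "(\<Sum>m<4. dif m 0 / fact m * (z - 0) ^ m)
      = 1 + r * z + r * (r - 1) / 2 * z ^ 2 + r * (r - 1) * (r - 2) / 6 * z ^ 3"
    by (simp add: dif_def eval_nat_numeral fact_numeral)
  ultimately show ?thesis using eq by simp
qed

text \<open>Away from 0 the Taylor polynomial carries no information: all its terms, and the left
  side too as long as z stays bounded, are multiples of z^4. The power z^(2m) takes over the growth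
  at infinity, because r <= 2m. Even exponents keep the remainder nonnegative for both signs of
  z.\<close>

lemma powr_binomial_bound:
  fixes r :: real
  assumes r: "r > 1" and m: "m \<ge> 2" "r \<le> 2 * real m"
  obtains C where "C \<ge> 0"
    "\<And>z. z \<ge> -1 \<Longrightarrow> (1 + z) powr r \<le> 1 + r * z + r * (r - 1) / 2 * z ^ 2
      + r * (r - 1) * (r - 2) / 6 * z ^ 3 + C * (z ^ 4 + z ^ (2 * m))"
proof -
  \<comment> \<open>The sum of the absolute coefficients of the cubic Taylor polynomial. The factor
    16 = 2^4 turns every |z|^j with j <= 4 into a multiple of z^4 when |z| > 1/2.\<close>
  define c3 where "c3 = 1 + r + r * (r - 1) / 2 + \<bar>r * (r - 1) * (r - 2) / 6\<bar>"
  define C where "C = \<bar>r * (r - 1) * (r - 2) * (r - 3)\<bar> * 2 powr \<bar>r - 4\<bar> + 16 * c3 + 16 * 3 powr r"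
  have c3: "c3 \<ge> 0" using r by (simp add: c3_def)
  have C: "C \<ge> 0" using c3 by (simp add: C_def)
  show ?thesis
  proof (rule that[OF C])
    fix z :: real assume z: "z \<ge> -1"
    have e: "z ^ (2 * m) \<ge> 0" "z ^ 4 \<ge> 0" by auto
    show "(1 + z) powr r \<le> 1 + r * z + r * (r - 1) / 2 * z ^ 2
      + r * (r - 1) * (r - 2) / 6 * z ^ 3 + C * (z ^ 4 + z ^ (2 * m))"
    proof (cases "\<bar>z\<bar> \<le> 1 / 2")
      case True
      have "\<bar>r * (r - 1) * (r - 2) * (r - 3)\<bar> * 2 powr \<bar>r - 4\<bar> * z ^ 4 \<le> C * z ^ 4"
        using c3 by (intro mult_right_mono) (auto simp: C_def)
      also have "\<dots> \<le> C * (z ^ 4 + z ^ (2 * m))" using C e by (intro mult_left_mono) auto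
      finally show ?thesis using powr_binomial_bound_near[OF r True] by simp
    next
      case False
      have p: "\<bar>z\<bar> ^ j \<le> 16 * z ^ 4" if "j \<le> 4" for j
      proof -
        have "(1/2) ^ (4 - j) \<le> \<bar>z\<bar> ^ (4 - j)" using False by (intro power_mono) auto
        moreover have "(1/2::real) ^ 4 \<le> (1/2) ^ (4 - j)" by (intro power_decreasing) auto
        ultimately have "1 \<le> 16 * \<bar>z\<bar> ^ (4 - j)" by (simp add: power4_eq_xxxx)
        then have "\<bar>z\<bar> ^ j * 1 \<le> \<bar>z\<bar> ^ j * (16 * \<bar>z\<bar> ^ (4 - j))" by (intro mult_left_mono) auto
        also have "\<dots> = 16 * \<bar>z\<bar> ^ 4" using that by (simp flip: power_add)
        finally show ?thesis by simp
      qed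
      have "- (1 + r * z + r * (r - 1) / 2 * z ^ 2 + r * (r - 1) * (r - 2) / 6 * z ^ 3)
          \<le> \<bar>z\<bar> ^ 0 + r * \<bar>z\<bar> ^ 1 + r * (r - 1) / 2 * \<bar>z\<bar> ^ 2 + \<bar>r * (r - 1) * (r - 2) / 6\<bar> * \<bar>z\<bar> ^ 3"
      proof -
        have "- (r * z) \<le> r * \<bar>z\<bar>" using r by (auto simp: abs_if)
        moreover have "- (r * (r - 1) / 2 * z ^ 2) \<le> r * (r - 1) / 2 * \<bar>z\<bar> ^ 2"
          using r by (auto simp: mult_nonneg_nonneg)
        moreover have "- (r * (r - 1) * (r - 2) / 6 * z ^ 3) \<le> \<bar>r * (r - 1) * (r - 2) / 6\<bar> * \<bar>z\<bar> ^ 3"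
          by (metis abs_ge_minus_self abs_mult power_abs)
        ultimately show ?thesis by simp
      qed
      also have "\<dots> \<le> 16 * z ^ 4 + r * (16 * z ^ 4) + r * (r - 1) / 2 * (16 * z ^ 4)
          + \<bar>r * (r - 1) * (r - 2) / 6\<bar> * (16 * z ^ 4)"
        using r by (intro add_mono mult_left_mono p) auto
      also have "\<dots> = 16 * c3 * z ^ 4" by (simp add: c3_def algebra_simps)
      finally have T: "- (1 + r * z + r * (r - 1) / 2 * z ^ 2 + r * (r - 1) * (r - 2) / 6 * z ^ 3)
          \<le> 16 * c3 * z ^ 4" .
      have "(1 + z) powr r \<le> 16 * 3 powr r * (z ^ 4 + z ^ (2 * m))"
      proof (cases "z \<ge> 1")
        case True
        have "(1 + z) powr r \<le> (3 * z) powr r" using True r by (intro powr_mono2) auto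
        also have "\<dots> = 3 powr r * z powr r" using True by (simp add: powr_mult)
        also have "\<dots> \<le> 3 powr r * z powr (2 * real m)" using True m by (intro mult_left_mono powr_mono) auto
        also have "z powr (2 * real m) = z ^ (2 * m)" using True powr_realpow[of z "2*m"] by simp
        also have "3 powr r * z ^ (2 * m) \<le> 16 * 3 powr r * (z ^ 4 + z ^ (2 * m))"
          using e by (intro mult_mono) auto
        finally show ?thesis .
      next
        case F: False
        have "(1 + z) powr r \<le> 3 powr r" using F z r by (intro powr_mono2) auto
        also have "\<dots> \<le> 3 powr r * (16 * z ^ 4)" using p[of 0] by simp
        also have "\<dots> \<le> 16 * 3 powr r * (z ^ 4 + z ^ (2 * m))" using e by (simp add: algebra_simps)
        finally show ?thesis .
      qed
      moreover have "16 * c3 * z ^ 4 \<le> 16 * c3 * (z ^ 4 + z ^ (2 * m))"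
        using c3 e by (intro mult_left_mono) auto
      moreover have "(16 * c3 + 16 * 3 powr r) * (z ^ 4 + z ^ (2 * m)) \<le> C * (z ^ 4 + z ^ (2 * m))"
        using e by (intro mult_right_mono) (auto simp: C_def)
      ultimately show ?thesis using T by (simp add: algebra_simps)
    qed
  qed
qed

lemma power_add3_le:
  fixes a b c :: real
  assumes "0 \<le> a" "0 \<le> b" "0 \<le> c"
  shows "(a + b + c) ^ j \<le> 3 ^ j * (a ^ j + b ^ j + c ^ j)"
proof -
  define M where "M = max a (max b c)"
  have M: "a \<le> M" "b \<le> M" "c \<le> M" "M = a \<or> M = b \<or> M = c" by (auto simp: M_def max_def)
  have "(a + b + c) ^ j \<le> (3 * M) ^ j" using assms M by (intro power_mono) auto
  also have "\<dots> = 3 ^ j * M ^ j" by (simp add: power_mult_distrib)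
  also have "\<dots> \<le> 3 ^ j * (a ^ j + b ^ j + c ^ j)" using M(4) assms by (intro mult_left_mono) auto
  finally show ?thesis .
qed

lemma powr_add3_le:
  fixes a b c r :: real
  assumes "0 \<le> a" "0 \<le> b" "0 \<le> c" "0 \<le> r"
  shows "(a + b + c) powr r \<le> 3 powr r * (a powr r + b powr r + c powr r)"
proof -
  define M where "M = max a (max b c)"
  have M: "a \<le> M" "b \<le> M" "c \<le> M" "M = a \<or> M = b \<or> M = c" by (auto simp: M_def max_def)
  have "(a + b + c) powr r \<le> (3 * M) powr r" using assms M by (intro powr_mono2) auto
  also have "\<dots> = 3 powr r * M powr r" using assms M by (simp add: powr_mult)
  also have "\<dots> \<le> 3 powr r * (a powr r + b powr r + c powr r)"
    using M(4) assms by (intro mult_left_mono) auto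
  finally show ?thesis .
qed

text \<open>The parts that are odd in \<open>G\<close> cancel, which is what makes the third-order term of the expansion small.\<close>

lemma symmetric_powr_expansion:
  fixes r c :: real
  assumes r: "r > 1" and c: "c \<ge> 0" and m: "m \<ge> 2" "r \<le> 2 * real m"
  obtains C where "C \<ge> 0"
    "\<And>x \<beta> G :: 'a::real_inner. norm \<beta> / sqrt (1 + (norm x)\<^sup>2) \<le> c \<Longrightarrow>
      (1 + (norm (x + \<beta> + G))\<^sup>2) powr r + (1 + (norm (x + \<beta> - G))\<^sup>2) powr r
      \<le> 2 * (1 + (norm x)\<^sup>2) powr r * (1 + r * (2 * (x \<bullet> \<beta>) + (norm G)\<^sup>2) / (1 + (norm x)\<^sup>2)
         + 2 * r * (r - 1) * (x \<bullet> G)\<^sup>2 / (1 + (norm x)\<^sup>2)\<^sup>2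
         + C * ((norm \<beta> / sqrt (1 + (norm x)\<^sup>2))\<^sup>2 + (norm G / sqrt (1 + (norm x)\<^sup>2)) ^ 4
              + (norm G / sqrt (1 + (norm x)\<^sup>2)) ^ (4 * m)))"
proof -
  obtain C0 where C0: "C0 \<ge> 0" and tay: "\<And>z. z \<ge> -1 \<Longrightarrow> (1 + z) powr r \<le> 1 + r * z + r * (r - 1) / 2 * z ^ 2
      + r * (r - 1) * (r - 2) / 6 * z ^ 3 + C0 * (z ^ 4 + z ^ (2 * m))"
    using powr_binomial_bound[OF r m] by metis
  \<comment> \<open>The constant of the bounds |e| <= k v + u^2 and |d| <= 2 k u below; c enters
    through v^2 <= c v.\<close>
  define k where "k = 2 + c"
  have k: "k \<ge> 2" using c by (simp add: k_def)
  \<comment> \<open>Chosen so that (k v + u^2 + 2 k u)^j <= Kp j * Q for 4 <= j <= 2m: surplus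
    powers of v are bounded by c^(j - 2), and all powers of u lie between u^4 and u^(4m).
    \<open>Kp 3\<close> serves only for e, where u enters as u^6.\<close>
  define Kp where "Kp j = 3 ^ j * (k ^ j * c ^ (j - 2) + 1 + (2 * k) ^ j)" for j :: nat
  have Kp: "Kp j \<ge> 0" for j using k c by (auto simp: Kp_def)
  define a2 where "a2 = r * (r - 1) / 2"
  define a3 where "a3 = r * (r - 1) * (r - 2) / 6"
  have a2: "a2 \<ge> 0" using r by (simp add: a2_def)
  define C where "C = r + a2 * (2 * k\<^sup>2 + 2 + 4 * k) + \<bar>a3\<bar> * (Kp 3 + 3 * (8 * k ^ 3)) + C0 * (Kp 4 + Kp (2 * m))"
  have C: "C \<ge> 0" unfolding C_def using r a2 k C0 Kp by (intro add_nonneg_nonneg mult_nonneg_nonneg) auto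
  show ?thesis
  proof (rule that[OF C])
    fix x \<beta> G :: 'a
    define A where "A = 1 + (norm x)\<^sup>2"
    have A: "A \<ge> 1" by (simp add: A_def)
    define v where "v = norm \<beta> / sqrt A"
    define u where "u = norm G / sqrt A"
    define Q where "Q = v\<^sup>2 + u ^ 4 + u ^ (4 * m)"
    assume "norm \<beta> / sqrt (1 + (norm x)\<^sup>2) \<le> c"
    then have vc: "v \<le> c" by (simp add: v_def A_def)
    have v0: "v \<ge> 0" and u0: "u \<ge> 0" using A by (auto simp: v_def u_def)
    have nb: "norm \<beta> = v * sqrt A" and nG: "norm G = u * sqrt A" using A by (auto simp: v_def u_def)
    have sq: "sqrt A * sqrt A = A" using A by simp
    have nx: "norm x \<le> sqrt A" unfolding A_def by (rule real_le_rsqrt) simp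
    \<comment> \<open>The relative increment of A is e + d or e - d according to the sign of G: e
      collects what is even in G, d what is odd.\<close>
    define e where "e = (2 * (x \<bullet> \<beta>) + (norm \<beta>)\<^sup>2 + (norm G)\<^sup>2) / A"
    define d where "d = (2 * (x \<bullet> G) + 2 * (\<beta> \<bullet> G)) / A"
    have xb: "\<bar>x \<bullet> \<beta>\<bar> \<le> v * A"
    proof -
      have "\<bar>x \<bullet> \<beta>\<bar> \<le> norm x * norm \<beta>" by (rule Cauchy_Schwarz_ineq2)
      also have "\<dots> \<le> sqrt A * (v * sqrt A)" using nx nb v0 A by (intro mult_mono) auto
      finally show ?thesis using sq by (simp add: algebra_simps)
    qed
    have xG: "\<bar>x \<bullet> G\<bar> \<le> u * A"
    proof -
      have "\<bar>x \<bullet> G\<bar> \<le> norm x * norm G" by (rule Cauchy_Schwarz_ineq2)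
      also have "\<dots> \<le> sqrt A * (u * sqrt A)" using nx nG u0 A by (intro mult_mono) auto
      finally show ?thesis using sq by (simp add: algebra_simps)
    qed
    have bG: "\<bar>\<beta> \<bullet> G\<bar> \<le> u * v * A"
    proof -
      have "\<bar>\<beta> \<bullet> G\<bar> \<le> norm \<beta> * norm G" by (rule Cauchy_Schwarz_ineq2)
      also have "\<dots> = u * v * A" using nG nb sq by (simp add: algebra_simps)
      finally show ?thesis .
    qed
    have b2: "(norm \<beta>)\<^sup>2 = v\<^sup>2 * A" and G2: "(norm G)\<^sup>2 = u\<^sup>2 * A"
      using nb nG A by (auto simp: power_mult_distrib)
    have vv: "v\<^sup>2 \<le> c * v" using vc v0 by (simp add: power2_eq_square mult_right_mono)
    have e_le: "\<bar>e\<bar> \<le> k * v + u\<^sup>2"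
    proof -
      have "\<bar>2 * (x \<bullet> \<beta>) + (norm \<beta>)\<^sup>2 + (norm G)\<^sup>2\<bar> \<le> (2 * v + v\<^sup>2 + u\<^sup>2) * A"
        using xb b2 G2 zero_le_power2[of "norm \<beta>"] zero_le_power2[of "norm G"] by (simp add: algebra_simps)
      also have "\<dots> \<le> (k * v + u\<^sup>2) * A" using vv A by (intro mult_right_mono) (auto simp: k_def algebra_simps)
      finally show ?thesis using A by (simp add: e_def field_simps)
    qed
    have d_le: "\<bar>d\<bar> \<le> 2 * k * u"
    proof -
      have "u * v \<le> u * c" using vc u0 by (rule mult_left_mono)
      have "\<bar>2 * (x \<bullet> G) + 2 * (\<beta> \<bullet> G)\<bar> \<le> (2 * u + 2 * (u * v)) * A"
        using xG bG by (simp add: algebra_simps)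
      also have "\<dots> \<le> (2 * k * u) * A" using \<open>u * v \<le> u * c\<close> A u0
        by (intro mult_right_mono) (auto simp: k_def algebra_simps)
      finally show ?thesis using A by (simp add: d_def field_simps)
    qed
    \<comment> \<open>Arithmetic-geometric mean: the cross terms of drift and noise have size v u^2,
      which is the common scale of v^2 and u^4.\<close>
    have vu: "v * u\<^sup>2 \<le> Q"
    proof -
      have "0 \<le> (v - u\<^sup>2)\<^sup>2" by simp
      then have "2 * (v * u\<^sup>2) \<le> v\<^sup>2 + u ^ 4" by (simp add: power2_diff algebra_simps flip: power_mult)
      moreover have "0 \<le> v * u\<^sup>2" "0 \<le> u ^ (4 * m)" using v0 u0 by auto
      ultimately show ?thesis by (simp add: Q_def)
    qed
    have Q0: "Q \<ge> 0" "v\<^sup>2 \<le> Q" "u ^ 4 \<le> Q" using u0 by (auto simp: Q_def)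
    have ui: "u ^ i \<le> Q" if "4 \<le> i" "i \<le> 4 * m" for i
      using power_le_sum_powers[OF u0 that] zero_le_power2[of v] unfolding Q_def by linarith
    have vj: "v ^ j \<le> c ^ (j - 2) * Q" if "j \<ge> 2" for j
    proof -
      have "v ^ j = v ^ (j - 2) * v\<^sup>2" using that by (metis le_add_diff_inverse2 power_add)
      also have "\<dots> \<le> c ^ (j - 2) * Q" using vc v0 Q0 c by (intro mult_mono power_mono) auto
      finally show ?thesis .
    qed
    have pj: "(k * v + u\<^sup>2 + 2 * k * u) ^ j \<le> Kp j * Q" if "4 \<le> j" "j \<le> 2 * m" for j
    proof -
      have "(k * v + u\<^sup>2 + 2 * k * u) ^ j \<le> 3 ^ j * ((k * v) ^ j + (u\<^sup>2) ^ j + (2 * k * u) ^ j)"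
        using k v0 u0 by (intro power_add3_le) auto
      also have "\<dots> = 3 ^ j * (k ^ j * v ^ j + u ^ (2 * j) + (2 * k) ^ j * u ^ j)"
        by (simp add: power_mult_distrib flip: power_mult)
      also have "\<dots> \<le> 3 ^ j * (k ^ j * (c ^ (j - 2) * Q) + Q + (2 * k) ^ j * Q)"
        using that k by (intro mult_left_mono add_mono vj ui) auto
      also have "\<dots> = Kp j * Q" by (simp add: Kp_def algebra_simps)
      finally show ?thesis .
    qed
    have zj: "z ^ j \<le> Kp j * Q" if "4 \<le> j" "j \<le> 2 * m" "even j" "\<bar>z\<bar> \<le> \<bar>e\<bar> + \<bar>d\<bar>" for j z
    proof -
      have "z ^ j = \<bar>z\<bar> ^ j" using that(3) by (simp add: power_even_abs)
      also have "\<dots> \<le> (k * v + u\<^sup>2 + 2 * k * u) ^ j" using that(4) e_le d_le by (intro power_mono) auto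
      also have "\<dots> \<le> Kp j * Q" using pj that by simp
      finally show ?thesis .
    qed
    have e3: "\<bar>e\<bar> ^ 3 \<le> Kp 3 * Q"
    proof -
      have "\<bar>e\<bar> ^ 3 \<le> (k * v + u\<^sup>2 + 0) ^ 3" using e_le by (intro power_mono) auto
      also have "\<dots> \<le> 3 ^ 3 * ((k * v) ^ 3 + (u\<^sup>2) ^ 3 + 0 ^ 3)" using k v0 by (intro power_add3_le) auto
      also have "\<dots> = 3 ^ 3 * (k ^ 3 * v ^ 3 + u ^ 6)" by (simp add: power_mult_distrib flip: power_mult)
      also have "\<dots> \<le> 3 ^ 3 * (k ^ 3 * (c ^ (3 - 2) * Q) + Q + (2 * k) ^ 3 * Q)"
      proof -
        have "0 \<le> (2 * k) ^ 3 * Q" using k Q0 by simp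
        moreover have "k ^ 3 * v ^ 3 \<le> k ^ 3 * (c ^ (3 - 2) * Q)" using k by (intro mult_left_mono vj) auto
        moreover have "u ^ 6 \<le> Q" using m by (intro ui) auto
        ultimately have "k ^ 3 * v ^ 3 + u ^ 6 \<le> k ^ 3 * (c ^ (3 - 2) * Q) + Q + (2 * k) ^ 3 * Q" by linarith
        then show ?thesis by (rule mult_left_mono) simp
      qed
      also have "\<dots> = Kp 3 * Q" by (simp add: Kp_def algebra_simps)
      finally show ?thesis .
    qed
    have e2: "e\<^sup>2 \<le> (2 * k\<^sup>2 + 2) * Q"
    proof -
      have "e\<^sup>2 = \<bar>e\<bar>\<^sup>2" by simp
      also have "\<dots> \<le> (k * v + u\<^sup>2)\<^sup>2" using e_le by (intro power_mono) auto
      also have "\<dots> \<le> 2 * k\<^sup>2 * v\<^sup>2 + 2 * u ^ 4"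
        using sum_squares_bound[of "k * v" "u\<^sup>2"] by (simp add: power2_sum power_mult_distrib algebra_simps flip: power_mult)
      also have "\<dots> \<le> 2 * k\<^sup>2 * Q + 2 * Q" using Q0 by (intro add_mono mult_left_mono) auto
      finally show ?thesis by (simp add: algebra_simps)
    qed
    \<comment> \<open>The part of d^2 that contains (x . G)^2 has size u^2 and is too large for the
      remainder. It is kept exact and later joins the first-order term; only what involves beta goes
      into Q.\<close>
    have d2: "d\<^sup>2 \<le> 4 * (x \<bullet> G)\<^sup>2 / A\<^sup>2 + 4 * k * Q"
    proof -
      have uv: "0 \<le> u * v * A" using u0 v0 A by simp
      have "(2 * (x \<bullet> G) + 2 * (\<beta> \<bullet> G))\<^sup>2 = 4 * (x \<bullet> G)\<^sup>2 + 8 * ((x \<bullet> G) * (\<beta> \<bullet> G)) + 4 * (\<beta> \<bullet> G)\<^sup>2"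
        by (simp add: power2_eq_square algebra_simps)
      also have "\<dots> \<le> 4 * (x \<bullet> G)\<^sup>2 + 8 * ((u * A) * (u * v * A)) + 4 * (u * v * A)\<^sup>2"
      proof -
        have "(x \<bullet> G) * (\<beta> \<bullet> G) \<le> \<bar>x \<bullet> G\<bar> * \<bar>\<beta> \<bullet> G\<bar>" by (simp flip: abs_mult)
        also have "\<dots> \<le> (u * A) * (u * v * A)" using xG bG uv u0 A by (intro mult_mono) auto
        finally have "(x \<bullet> G) * (\<beta> \<bullet> G) \<le> (u * A) * (u * v * A)" .
        moreover have "(\<beta> \<bullet> G)\<^sup>2 \<le> (u * v * A)\<^sup>2" using bG uv by (simp add: abs_le_square_iff[symmetric])
        ultimately show ?thesis by linarith
      qed
      also have "\<dots> = 4 * (x \<bullet> G)\<^sup>2 + (8 * v + 4 * v\<^sup>2) * u\<^sup>2 * A\<^sup>2"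
        by (simp add: power2_eq_square algebra_simps)
      also have "\<dots> \<le> 4 * (x \<bullet> G)\<^sup>2 + (4 * k * Q) * A\<^sup>2"
      proof -
        have "(8 * v + 4 * v\<^sup>2) * u\<^sup>2 \<le> (4 * k * v) * u\<^sup>2" using vv by (intro mult_right_mono) (auto simp: k_def algebra_simps)
        also have "\<dots> = 4 * k * (v * u\<^sup>2)" by simp
        also have "\<dots> \<le> 4 * k * Q" using vu k by (intro mult_left_mono) auto
        finally have "(8 * v + 4 * v\<^sup>2) * u\<^sup>2 * A\<^sup>2 \<le> (4 * k * Q) * A\<^sup>2" by (intro mult_right_mono) auto
        then show ?thesis by simp
      qed
      finally show ?thesis using A by (simp add: d_def power_divide field_simps)
    qed
    have ed: "\<bar>e\<bar> * d\<^sup>2 \<le> 8 * k ^ 3 * Q"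
    proof -
      have "d\<^sup>2 \<le> (2 * k * u)\<^sup>2" using d_le by (metis abs_ge_zero power2_abs power_mono)
      then have "\<bar>e\<bar> * d\<^sup>2 \<le> (k * v + u\<^sup>2) * (2 * k * u)\<^sup>2" using e_le k v0 by (intro mult_mono) auto
      also have "\<dots> = 4 * k ^ 3 * (v * u\<^sup>2) + 4 * k\<^sup>2 * u ^ 4"
        by (simp add: power_mult_distrib algebra_simps power2_eq_square power3_eq_cube power4_eq_xxxx)
      also have "\<dots> \<le> 4 * k ^ 3 * Q + 4 * k\<^sup>2 * Q" using vu Q0 k by (intro add_mono mult_left_mono) auto
      also have "\<dots> \<le> 8 * k ^ 3 * Q"
      proof -
        have "k\<^sup>2 \<le> k ^ 3" using k by (intro power_increasing) auto
        then have "k\<^sup>2 * Q \<le> k ^ 3 * Q" using Q0 by (intro mult_right_mono) auto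
        then show ?thesis by (simp add: mult_ac)
      qed
      finally show ?thesis .
    qed
    have Aed: "A * e = 2 * (x \<bullet> \<beta>) + (norm \<beta>)\<^sup>2 + (norm G)\<^sup>2" "A * d = 2 * (x \<bullet> G) + 2 * (\<beta> \<bullet> G)"
      using A by (simp_all add: e_def d_def)
    have z: "1 + (norm (x + \<beta> + G))\<^sup>2 = A * (1 + (e + d))" "1 + (norm (x + \<beta> - G))\<^sup>2 = A * (1 + (e - d))"
      unfolding distrib_left right_diff_distrib Aed
      by (simp_all add: A_def power2_norm_eq_inner inner_add_left inner_add_right inner_diff_left inner_diff_right inner_commute)
    have z1: "e + d \<ge> -1" "e - d \<ge> -1"
    proof -
      have "0 \<le> A * (1 + (e + d))" "0 \<le> A * (1 + (e - d))" by (simp_all flip: z)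
      then show "e + d \<ge> -1" "e - d \<ge> -1" using A by (auto simp: zero_le_mult_iff)
    qed
    have "(1 + (e + d)) powr r + (1 + (e - d)) powr r \<le>
        (1 + r * (e + d) + a2 * (e + d) ^ 2 + a3 * (e + d) ^ 3 + C0 * ((e + d) ^ 4 + (e + d) ^ (2 * m)))
      + (1 + r * (e - d) + a2 * (e - d) ^ 2 + a3 * (e - d) ^ 3 + C0 * ((e - d) ^ 4 + (e - d) ^ (2 * m)))"
      unfolding a2_def a3_def using z1 by (intro add_mono tay)
    also have "\<dots> \<le>
        (1 + r * (e + d) + a2 * (e + d) ^ 2 + a3 * (e + d) ^ 3 + C0 * (Kp 4 * Q + Kp (2 * m) * Q))
      + (1 + r * (e - d) + a2 * (e - d) ^ 2 + a3 * (e - d) ^ 3 + C0 * (Kp 4 * Q + Kp (2 * m) * Q))"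
      using C0 m by (intro add_mono mult_left_mono zj order_refl) auto
    \<comment> \<open>Adding the two signs removes everything odd in d, among it terms of size u and
      u^3 that Q does not dominate.\<close>
    also have "\<dots> = 2 * (1 + r * e + a2 * (e\<^sup>2 + d\<^sup>2) + a3 * (e ^ 3 + 3 * (e * d\<^sup>2)) + C0 * (Kp 4 + Kp (2 * m)) * Q)"
      by (simp add: power2_eq_square power3_eq_cube algebra_simps)
    also have "\<dots> \<le> 2 * (1 + (r * ((2 * (x \<bullet> \<beta>) + (norm G)\<^sup>2) / A) + r * Q)
        + a2 * ((2 * k\<^sup>2 + 2) * Q + (4 * (x \<bullet> G)\<^sup>2 / A\<^sup>2 + 4 * k * Q))
        + \<bar>a3\<bar> * (Kp 3 * Q + 3 * (8 * k ^ 3 * Q)) + C0 * (Kp 4 + Kp (2 * m)) * Q)"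
    proof -
      \<comment> \<open>Only |beta|^2 / A = v^2 is moved to the remainder. The rest of e stays
        exact, since coercivity controls it only together with the term in (x . G)^2.\<close>
      have "e = (2 * (x \<bullet> \<beta>) + (norm G)\<^sup>2) / A + v\<^sup>2" using A by (simp add: e_def b2 field_simps)
      then have "r * e \<le> r * ((2 * (x \<bullet> \<beta>) + (norm G)\<^sup>2) / A) + r * Q"
        using Q0 r by (simp add: distrib_left)
      moreover have "a2 * (e\<^sup>2 + d\<^sup>2) \<le> a2 * ((2 * k\<^sup>2 + 2) * Q + (4 * (x \<bullet> G)\<^sup>2 / A\<^sup>2 + 4 * k * Q))"
        using a2 e2 d2 by (intro mult_left_mono add_mono)
      moreover have "a3 * (e ^ 3 + 3 * (e * d\<^sup>2)) \<le> \<bar>a3\<bar> * (Kp 3 * Q + 3 * (8 * k ^ 3 * Q))"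
      proof -
        have "a3 * (e ^ 3 + 3 * (e * d\<^sup>2)) \<le> \<bar>a3\<bar> * \<bar>e ^ 3 + 3 * (e * d\<^sup>2)\<bar>" by (simp flip: abs_mult)
        also have "\<dots> \<le> \<bar>a3\<bar> * (\<bar>e\<bar> ^ 3 + 3 * (\<bar>e\<bar> * d\<^sup>2))"
          by (intro mult_left_mono order_trans[OF abs_triangle_ineq]) (auto simp: abs_mult power_abs)
        also have "\<dots> \<le> \<bar>a3\<bar> * (Kp 3 * Q + 3 * (8 * k ^ 3 * Q))"
          using e3 ed by (intro mult_left_mono add_mono) auto
        finally show ?thesis .
      qed
      ultimately show ?thesis by simp
    qed
    also have "\<dots> = 2 * (1 + r * (2 * (x \<bullet> \<beta>) + (norm G)\<^sup>2) / A + 2 * r * (r - 1) * (x \<bullet> G)\<^sup>2 / A\<^sup>2 + C * Q)"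
    proof -
      have "a2 * (4 * (x \<bullet> G)\<^sup>2 / A\<^sup>2) = 2 * r * (r - 1) * (x \<bullet> G)\<^sup>2 / A\<^sup>2"
        using A by (simp add: a2_def field_simps)
      moreover have "r * ((2 * (x \<bullet> \<beta>) + (norm G)\<^sup>2) / A) = r * (2 * (x \<bullet> \<beta>) + (norm G)\<^sup>2) / A" by simp
      ultimately show ?thesis unfolding C_def distrib_left distrib_right by linarith
    qed
    finally have main: "(1 + (e + d)) powr r + (1 + (e - d)) powr r \<le> \<dots>" .
    have "(1 + (norm (x + \<beta> + G))\<^sup>2) powr r + (1 + (norm (x + \<beta> - G))\<^sup>2) powr r
        = A powr r * ((1 + (e + d)) powr r + (1 + (e - d)) powr r)"
      unfolding z powr_mult by (simp only: distrib_left)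
    also have "\<dots> \<le> A powr r * (2 * (1 + r * (2 * (x \<bullet> \<beta>) + (norm G)\<^sup>2) / A
        + 2 * r * (r - 1) * (x \<bullet> G)\<^sup>2 / A\<^sup>2 + C * Q))"
      using main by (intro mult_left_mono) auto
    finally show "(1 + (norm (x + \<beta> + G))\<^sup>2) powr r + (1 + (norm (x + \<beta> - G))\<^sup>2) powr r
      \<le> 2 * (1 + (norm x)\<^sup>2) powr r * (1 + r * (2 * (x \<bullet> \<beta>) + (norm G)\<^sup>2) / (1 + (norm x)\<^sup>2)
         + 2 * r * (r - 1) * (x \<bullet> G)\<^sup>2 / (1 + (norm x)\<^sup>2)\<^sup>2
         + C * ((norm \<beta> / sqrt (1 + (norm x)\<^sup>2))\<^sup>2 + (norm G / sqrt (1 + (norm x)\<^sup>2)) ^ 4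
              + (norm G / sqrt (1 + (norm x)\<^sup>2)) ^ (4 * m)))"
      unfolding A_def[symmetric] v_def[symmetric] u_def[symmetric] Q_def[symmetric] by (simp only: mult_ac)
  qed
qed

lemma powr_sum_bound:
  fixes x \<beta> G :: "'a::real_inner"
  assumes "r \<ge> 0"
  shows "(1 + (norm (x + \<beta> + G))\<^sup>2) powr r
    \<le> 9 powr r * ((1 + (norm x)\<^sup>2) powr r + ((norm \<beta>)\<^sup>2) powr r + ((norm G)\<^sup>2) powr r)"
proof -
  have "norm (x + \<beta> + G) \<le> norm x + norm \<beta> + norm G"
    by (meson add_right_mono norm_triangle_ineq order_trans)
  then have "(norm (x + \<beta> + G))\<^sup>2 \<le> (norm x + norm \<beta> + norm G)\<^sup>2" by (intro power_mono) auto
  also have "\<dots> \<le> 3 * ((norm x)\<^sup>2 + (norm \<beta>)\<^sup>2 + (norm G)\<^sup>2)"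
    using sum_squares_bound[of "norm x" "norm \<beta>"] sum_squares_bound[of "norm x" "norm G"]
      sum_squares_bound[of "norm \<beta>" "norm G"] by (simp add: power2_eq_square algebra_simps)
  finally have "1 + (norm (x + \<beta> + G))\<^sup>2 \<le> 3 * ((1 + (norm x)\<^sup>2) + (norm \<beta>)\<^sup>2 + (norm G)\<^sup>2)"
    by simp
  then have "(1 + (norm (x + \<beta> + G))\<^sup>2) powr r \<le> (3 * ((1 + (norm x)\<^sup>2) + (norm \<beta>)\<^sup>2 + (norm G)\<^sup>2)) powr r"
    using assms by (intro powr_mono2) auto
  also have "\<dots> = 3 powr r * ((1 + (norm x)\<^sup>2) + (norm \<beta>)\<^sup>2 + (norm G)\<^sup>2) powr r"
    by (rule powr_mult)
  also have "\<dots> \<le> 3 powr r * (3 powr r * ((1 + (norm x)\<^sup>2) powr r + ((norm \<beta>)\<^sup>2) powr r + ((norm G)\<^sup>2) powr r))"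
    using assms by (intro mult_left_mono powr_add3_le) auto
  also have "\<dots> = 9 powr r * ((1 + (norm x)\<^sup>2) powr r + ((norm \<beta>)\<^sup>2) powr r + ((norm G)\<^sup>2) powr r)"
    by (simp add: powr_mult[symmetric] flip: mult.assoc)
  finally show ?thesis .
qed

section \<open>One Euler step\<close>

text \<open>The constant a may be negative, so the nonnegative integral of the sum cannot be split.
  The sum passes through the Bochner integral, where the bound on R supplies integrability.\<close>

lemma (in prob_space) nn_integral_add_const_le:
  fixes R :: "'a \<Rightarrow> real"
  assumes [measurable]: "R \<in> borel_measurable M" and R: "\<And>x. R x \<ge> 0" and le: "(\<integral>\<^sup>+x. ennreal (R x) \<partial>M) \<le> ennreal \<rho>"
    and nn: "\<And>x. a + R x \<ge> 0" and \<rho>: "\<rho> \<ge> 0"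
  shows "(\<integral>\<^sup>+x. ennreal (a + R x) \<partial>M) \<le> ennreal (a + \<rho>)"
proof -
  have I: "integrable M R"
    using R le by (intro integrableI_bounded) (auto simp: less_top[symmetric] top_unique)
  have "ennreal (\<integral>x. R x \<partial>M) \<le> ennreal \<rho>"
    using le nn_integral_eq_integral[OF I] R by simp
  then have "(\<integral>x. R x \<partial>M) \<le> \<rho>" using \<rho> by simp
  moreover have "(\<integral>\<^sup>+x. ennreal (a + R x) \<partial>M) = ennreal (\<integral>x. a + R x \<partial>M)"
    using I nn by (intro nn_integral_eq_integral) auto
  ultimately show ?thesis using I by (simp add: prob_space ennreal_leI)
qed

text \<open>Collects what the moment estimate uses of a Gaussian step. All dependence on the step
  size and on the diffusion coefficients sits in the variance \<open>g2\<close>; the sequence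
  \<open>c\<close> scales out and can be fixed once for all steps. The clause
  \<open>second_inner\<close> treats (x . G)^2 separately, because this term is needed with its
  sharp constant.\<close>

locale symmetric_noise = prob_space Q for Q :: "'q measure" +
  fixes G :: "'q \<Rightarrow> 'a::euclidean_space" and g2 :: real and c :: "nat \<Rightarrow> real"
  assumes G [measurable]: "G \<in> borel_measurable Q"
    and g2: "g2 \<ge> 0" and c: "\<And>k. c k \<ge> 0"
    and sym: "\<And>f::'a \<Rightarrow> ennreal. f \<in> borel_measurable borel \<Longrightarrow> (\<integral>\<^sup>+z. f (G z) \<partial>Q) = (\<integral>\<^sup>+z. f (- G z) \<partial>Q)"
    and second: "(\<integral>\<^sup>+z. ennreal ((norm (G z))\<^sup>2) \<partial>Q) \<le> ennreal g2"
    and second_inner: "\<And>x. (\<integral>\<^sup>+z. ennreal ((x \<bullet> G z)\<^sup>2) \<partial>Q) \<le> ennreal ((norm x)\<^sup>2 * g2)"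
    and moments: "\<And>k. (\<integral>\<^sup>+z. ennreal (norm (G z) ^ (2 * k)) \<partial>Q) \<le> ennreal (c k * g2 ^ k)"
begin

text \<open>A real exponent r is reached from the integer moment m >= r after normalising by D. A
  scale D > 0 above \<open>g2\<close> avoids dividing by a variance that may vanish.\<close>

lemma powr_moment:
  assumes D: "D > 0" "g2 \<le> D" and m: "0 \<le> r" "r \<le> real m"
  shows "(\<integral>\<^sup>+z. ennreal (((norm (G z))\<^sup>2) powr r) \<partial>Q) \<le> ennreal (D powr r * (1 + c m))"
proof -
  have pw: "y powr r \<le> D powr r * (1 + y ^ m / D ^ m)" if "y \<ge> 0" for y
  proof -
    have "(y / D) powr r \<le> 1 + (y / D) ^ m"
    proof (cases "y / D \<le> 1")
      case True
      have "(y / D) powr r \<le> 1" using True that D m by (intro powr_le1) auto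
      moreover have "0 \<le> (y / D) ^ m" using that D by simp
      ultimately show ?thesis by linarith
    next
      case False
      then have "(y / D) powr r \<le> (y / D) powr real m" using m by (intro powr_mono) auto
      also have "\<dots> = (y / D) ^ m" using False by (intro powr_realpow) auto
      finally show ?thesis by linarith
    qed
    then have "D powr r * (y / D) powr r \<le> D powr r * (1 + (y / D) ^ m)" by (intro mult_left_mono) auto
    then show ?thesis using that D by (simp add: powr_divide power_divide)
  qed
  have "(\<integral>\<^sup>+z. ennreal (((norm (G z))\<^sup>2) powr r) \<partial>Q)
      \<le> (\<integral>\<^sup>+z. ennreal (D powr r) * (1 + ennreal (1 / D ^ m) * ennreal (norm (G z) ^ (2 * m))) \<partial>Q)"
  proof (rule nn_integral_mono)
    fix z
    have "((norm (G z))\<^sup>2) powr r \<le> D powr r * (1 + 1 / D ^ m * norm (G z) ^ (2 * m))"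
      using pw[of "(norm (G z))\<^sup>2"] by (simp add: power_mult)
    then have "ennreal (((norm (G z))\<^sup>2) powr r) \<le> ennreal (D powr r * (1 + 1 / D ^ m * norm (G z) ^ (2 * m)))"
      by (rule ennreal_leI)
    also have "\<dots> = ennreal (D powr r) * (1 + ennreal (1 / D ^ m) * ennreal (norm (G z) ^ (2 * m)))"
      using D by (simp add: ennreal_mult[symmetric] ennreal_plus[symmetric] ennreal_1[symmetric] del: ennreal_plus ennreal_1)
    finally show "ennreal (((norm (G z))\<^sup>2) powr r) \<le> \<dots>" .
  qed
  also have "\<dots> = ennreal (D powr r) * (1 + ennreal (1 / D ^ m) * (\<integral>\<^sup>+z. ennreal (norm (G z) ^ (2 * m)) \<partial>Q))"
    by (simp add: nn_integral_cmult nn_integral_add emeasure_space_1)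
  also have "\<dots> \<le> ennreal (D powr r) * (1 + ennreal (1 / D ^ m) * ennreal (c m * g2 ^ m))"
    by (intro mult_left_mono add_left_mono moments) auto
  also have "\<dots> = ennreal (D powr r * (1 + 1 / D ^ m * (c m * g2 ^ m)))"
    using D c g2 by (simp add: ennreal_mult[symmetric] ennreal_plus[symmetric] ennreal_1[symmetric] del: ennreal_plus ennreal_1)
  also have "\<dots> \<le> ennreal (D powr r * (1 + c m))"
  proof (intro ennreal_leI mult_left_mono add_left_mono)
    have "g2 ^ m \<le> D ^ m" using D g2 by (intro power_mono) auto
    then have "c m * g2 ^ m \<le> c m * D ^ m" using c by (intro mult_left_mono) auto
    then show "1 / D ^ m * (c m * g2 ^ m) \<le> c m" using D by (simp add: field_simps)
  qed auto
  finally show ?thesis .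
qed

lemma crude_moment_bound:
  assumes D: "1 + (norm x)\<^sup>2 \<le> D" "(norm \<beta>)\<^sup>2 \<le> D" "g2 \<le> D" and m: "0 \<le> r" "r \<le> real m"
  shows "(\<integral>\<^sup>+z. ennreal ((1 + (norm (x + \<beta> + G z))\<^sup>2) powr r) \<partial>Q) \<le> ennreal (9 powr r * (3 + c m) * D powr r)"
proof -
  have D0: "D > 0" using D(1) by (smt (verit) zero_le_power2)
  have "(\<integral>\<^sup>+z. ennreal ((1 + (norm (x + \<beta> + G z))\<^sup>2) powr r) \<partial>Q)
     \<le> (\<integral>\<^sup>+z. ennreal (9 powr r) * (ennreal (2 * D powr r) + ennreal (((norm (G z))\<^sup>2) powr r)) \<partial>Q)"
  proof (rule nn_integral_mono)
    fix z
    have "(1 + (norm (x + \<beta> + G z))\<^sup>2) powr r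
        \<le> 9 powr r * ((1 + (norm x)\<^sup>2) powr r + ((norm \<beta>)\<^sup>2) powr r + ((norm (G z))\<^sup>2) powr r)"
      by (rule powr_sum_bound) (rule m)
    also have "\<dots> \<le> 9 powr r * (D powr r + D powr r + ((norm (G z))\<^sup>2) powr r)"
      using D m by (intro mult_left_mono add_mono powr_mono2) auto
    finally have "ennreal ((1 + (norm (x + \<beta> + G z))\<^sup>2) powr r) \<le> ennreal (9 powr r * (2 * D powr r + ((norm (G z))\<^sup>2) powr r))"
      by (intro ennreal_leI) simp
    also have "\<dots> = ennreal (9 powr r) * (ennreal (2 * D powr r) + ennreal (((norm (G z))\<^sup>2) powr r))"
      by (simp add: ennreal_mult[symmetric] ennreal_plus[symmetric] del: ennreal_plus)
    finally show "ennreal ((1 + (norm (x + \<beta> + G z))\<^sup>2) powr r) \<le> \<dots>" .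
  qed
  also have "\<dots> = ennreal (9 powr r) * (ennreal (2 * D powr r) + (\<integral>\<^sup>+z. ennreal (((norm (G z))\<^sup>2) powr r) \<partial>Q))"
    by (simp add: nn_integral_cmult nn_integral_add emeasure_space_1)
  also have "\<dots> \<le> ennreal (9 powr r) * (ennreal (2 * D powr r) + ennreal (D powr r * (1 + c m)))"
    using D D0 m by (intro mult_left_mono add_left_mono powr_moment) auto
  also have "\<dots> = ennreal (9 powr r * (3 + c m) * D powr r)"
    using c[of m] by (simp add: ennreal_mult[symmetric] ennreal_plus[symmetric] algebra_simps del: ennreal_plus)
  finally show ?thesis .
qed

text \<open>By symmetry of the noise, twice the integral is the integral of the symmetrised
  expression, to which the expansion applies pointwise. The hypothesis \<open>exp\<close> is stated
  for the values of G only, so that the restriction on the drift is settled before this lemma is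
  used.\<close>

lemma symmetric_moment_bound:
  assumes C: "C \<ge> 0" and r: "r > 1" and A: "A = 1 + (norm x)\<^sup>2"
    and exp: "\<And>z. (1 + (norm (x + \<beta> + G z))\<^sup>2) powr r + (1 + (norm (x + \<beta> - G z))\<^sup>2) powr r
      \<le> 2 * A powr r * (1 + r * (2 * (x \<bullet> \<beta>) + (norm (G z))\<^sup>2) / A
         + 2 * r * (r - 1) * (x \<bullet> G z)\<^sup>2 / A\<^sup>2
         + C * (v2 + (norm (G z) / sqrt A) ^ 4 + (norm (G z) / sqrt A) ^ (4 * m)))"
  shows "(\<integral>\<^sup>+z. ennreal ((1 + (norm (x + \<beta> + G z))\<^sup>2) powr r) \<partial>Q)
    \<le> ennreal (A powr r * (1 + r * (2 * (x \<bullet> \<beta>) + (2 * r - 1) * g2) / A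
        + C * (v2 + c 2 * (g2 / A)\<^sup>2 + c (2 * m) * (g2 / A) ^ (2 * m))))"
proof -
  have A1: "A \<ge> 1" by (simp add: A)
  define Af where "Af = A powr r"
  have Af: "Af > 0" using A1 by (simp add: Af_def)
  \<comment> \<open>The deterministic part, possibly negative because of x . beta. The random part
    \<open>R\<close> is nonnegative.\<close>
  define a where "a = 1 + r * (2 * (x \<bullet> \<beta>)) / A + C * v2"
  define R where "R z = r / A * (norm (G z))\<^sup>2 + 2 * r * (r - 1) / A\<^sup>2 * (x \<bullet> G z)\<^sup>2
     + C / A\<^sup>2 * norm (G z) ^ (2 * 2) + C / A ^ (2 * m) * norm (G z) ^ (2 * (2 * m))" for z
  define rho where "rho = r / A * g2 + 2 * r * (r - 1) / A\<^sup>2 * ((norm x)\<^sup>2 * g2)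
     + C / A\<^sup>2 * (c 2 * g2 ^ 2) + C / A ^ (2 * m) * (c (2 * m) * g2 ^ (2 * m))"
  have [measurable]: "R \<in> borel_measurable Q" unfolding R_def by measurable
  have R0: "R z \<ge> 0" for z using C r A1 by (auto simp: R_def zero_le_even_power intro!: add_nonneg_nonneg mult_nonneg_nonneg divide_nonneg_nonneg)
  have rho0: "rho \<ge> 0" unfolding rho_def using C r A1 g2 c by (intro add_nonneg_nonneg mult_nonneg_nonneg divide_nonneg_nonneg) auto
  have sA: "sqrt A ^ (2 * k) = A ^ k" for k using A1 by (simp add: power_mult)
  have eq: "1 + r * (2 * (x \<bullet> \<beta>) + (norm (G z))\<^sup>2) / A + 2 * r * (r - 1) * (x \<bullet> G z)\<^sup>2 / A\<^sup>2
         + C * (v2 + (norm (G z) / sqrt A) ^ 4 + (norm (G z) / sqrt A) ^ (4 * m)) = a + R z" for z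
    using sA[of 2] sA[of "2 * m"] by (simp add: a_def R_def power_divide distrib_left add_divide_distrib)
  have e2: "(1 + (norm (x + \<beta> + G z))\<^sup>2) powr r + (1 + (norm (x + \<beta> - G z))\<^sup>2) powr r \<le> 2 * Af * (a + R z)" for z
    using exp[of z] unfolding eq Af_def .
  \<comment> \<open>The signs of the summands do not show this. It holds because 2 Af (a + R z)
    dominates a sum of powers.\<close>
  have aR: "a + R z \<ge> 0" for z
  proof -
    have "0 \<le> 2 * Af * (a + R z)" using e2[of z] by (smt (verit) powr_ge_zero)
    then show ?thesis using Af by (simp add: zero_le_mult_iff)
  qed
  have IR: "(\<integral>\<^sup>+z. ennreal (R z) \<partial>Q) \<le> ennreal rho"
  proof -
    have "(\<integral>\<^sup>+z. ennreal (R z) \<partial>Q) = (\<integral>\<^sup>+z. ennreal (r / A) * ennreal ((norm (G z))\<^sup>2)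
       + ennreal (2 * r * (r - 1) / A\<^sup>2) * ennreal ((x \<bullet> G z)\<^sup>2)
       + ennreal (C / A\<^sup>2) * ennreal (norm (G z) ^ (2 * 2))
       + ennreal (C / A ^ (2 * m)) * ennreal (norm (G z) ^ (2 * (2 * m))) \<partial>Q)"
      using r C A1 unfolding R_def
      by (intro nn_integral_cong) (simp add: ennreal_mult[symmetric] ennreal_plus[symmetric] zero_le_even_power del: ennreal_plus)
    also have "\<dots> = ennreal (r / A) * (\<integral>\<^sup>+z. ennreal ((norm (G z))\<^sup>2) \<partial>Q)
       + ennreal (2 * r * (r - 1) / A\<^sup>2) * (\<integral>\<^sup>+z. ennreal ((x \<bullet> G z)\<^sup>2) \<partial>Q)
       + ennreal (C / A\<^sup>2) * (\<integral>\<^sup>+z. ennreal (norm (G z) ^ (2 * 2)) \<partial>Q)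
       + ennreal (C / A ^ (2 * m)) * (\<integral>\<^sup>+z. ennreal (norm (G z) ^ (2 * (2 * m))) \<partial>Q)"
      by (simp add: nn_integral_add nn_integral_cmult)
    also have "\<dots> \<le> ennreal (r / A) * ennreal g2
       + ennreal (2 * r * (r - 1) / A\<^sup>2) * ennreal ((norm x)\<^sup>2 * g2)
       + ennreal (C / A\<^sup>2) * ennreal (c 2 * g2 ^ 2)
       + ennreal (C / A ^ (2 * m)) * ennreal (c (2 * m) * g2 ^ (2 * m))"
      by (intro add_mono mult_left_mono second second_inner moments) auto
    also have "\<dots> = ennreal rho"
      using r C A1 g2 c unfolding rho_def
      by (simp add: ennreal_mult[symmetric] ennreal_plus[symmetric] del: ennreal_plus)
    finally show ?thesis .
  qed
  have "2 * (\<integral>\<^sup>+z. ennreal ((1 + (norm (x + \<beta> + G z))\<^sup>2) powr r) \<partial>Q)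
      = (\<integral>\<^sup>+z. ennreal ((1 + (norm (x + \<beta> + G z))\<^sup>2) powr r) \<partial>Q)
      + (\<integral>\<^sup>+z. ennreal ((1 + (norm (x + \<beta> + - G z))\<^sup>2) powr r) \<partial>Q)"
    using sym[of "\<lambda>g. ennreal ((1 + (norm (x + \<beta> + g))\<^sup>2) powr r)"] by (simp add: mult_2)
  also have "\<dots> = (\<integral>\<^sup>+z. ennreal ((1 + (norm (x + \<beta> + G z))\<^sup>2) powr r + (1 + (norm (x + \<beta> - G z))\<^sup>2) powr r) \<partial>Q)"
    by (subst nn_integral_add[symmetric]) auto
  also have "\<dots> \<le> (\<integral>\<^sup>+z. ennreal (2 * Af) * ennreal (a + R z) \<partial>Q)"
    using e2 Af aR by (intro nn_integral_mono) (auto simp: ennreal_mult[symmetric] simp del: ennreal_plus intro!: ennreal_leI)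
  also have "\<dots> = ennreal (2 * Af) * (\<integral>\<^sup>+z. ennreal (a + R z) \<partial>Q)"
    by (simp add: nn_integral_cmult)
  also have "\<dots> \<le> ennreal (2 * Af) * ennreal (a + rho)"
    by (intro mult_left_mono nn_integral_add_const_le R0 IR aR rho0) auto
  also have "\<dots> = 2 * ennreal (Af * (a + rho))"
    using Af by (simp add: ennreal_mult' mult.assoc)
  finally have "2 * (\<integral>\<^sup>+z. ennreal ((1 + (norm (x + \<beta> + G z))\<^sup>2) powr r) \<partial>Q) \<le> 2 * ennreal (Af * (a + rho))" .
  then have "(\<integral>\<^sup>+z. ennreal ((1 + (norm (x + \<beta> + G z))\<^sup>2) powr r) \<partial>Q) \<le> ennreal (Af * (a + rho))"
    by (subst (asm) ennreal_mult_le_mult_iff) auto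
  also have "\<dots> \<le> ennreal (Af * (1 + r * (2 * (x \<bullet> \<beta>) + (2 * r - 1) * g2) / A
        + C * (v2 + c 2 * (g2 / A)\<^sup>2 + c (2 * m) * (g2 / A) ^ (2 * m))))"
  proof (intro ennreal_leI mult_left_mono)
    \<comment> \<open>The two second-order contributions add up to r g2 + 2 r (r - 1) g2 = r (2 r -
      1) g2. For r = p0 / 2 the factor 2 r - 1 is exactly the p0 - 1 of the coercivity
      condition.\<close>
    have "(norm x)\<^sup>2 * g2 \<le> A * g2" using g2 by (intro mult_right_mono) (auto simp: A)
    then have "2 * r * (r - 1) / A\<^sup>2 * ((norm x)\<^sup>2 * g2) \<le> 2 * r * (r - 1) / A\<^sup>2 * (A * g2)"
      using r by (intro mult_left_mono) auto
    also have "\<dots> = 2 * r * (r - 1) * g2 / A" using A1 by (simp add: power2_eq_square)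
    finally have "rho \<le> r / A * g2 + 2 * r * (r - 1) * g2 / A
      + C / A\<^sup>2 * (c 2 * g2 ^ 2) + C / A ^ (2 * m) * (c (2 * m) * g2 ^ (2 * m))" by (simp add: rho_def)
    also have "a + \<dots> = 1 + r * (2 * (x \<bullet> \<beta>) + (2 * r - 1) * g2) / A
        + C * (v2 + c 2 * (g2 / A)\<^sup>2 + c (2 * m) * (g2 / A) ^ (2 * m))"
      by (simp add: a_def power_divide algebra_simps add_divide_distrib diff_divide_distrib)
    finally show "a + rho \<le> 1 + r * (2 * (x \<bullet> \<beta>) + (2 * r - 1) * g2) / A
        + C * (v2 + c 2 * (g2 / A)\<^sup>2 + c (2 * m) * (g2 / A) ^ (2 * m))" by simp
  qed (use Af in auto)
  finally show ?thesis by (simp add: Af_def)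
qed

end


text \<open>Two regimes of y = q / A. For y <= n the relative drift is bounded, so the symmetric
  expansion applies and each remainder is of order (1 + y) / n. For y > n the crude bound on the
  scale q / n suffices. K depends only on r, C1, L1 and c, hence serves all particles, steps and
  n.\<close>

lemma one_step_moment_bound:
  fixes c :: "nat \<Rightarrow> real"
  assumes r: "r > 1" and C1: "C1 \<ge> 0" and L1: "L1 \<ge> 0" and c0: "\<And>k. c k \<ge> 0"
  obtains K where "K > 0"
    "\<And>(Q :: 'q measure) (G :: 'q \<Rightarrow> 'a::euclidean_space) n x \<beta> S q.
      n \<ge> 1 \<Longrightarrow> q \<ge> 0 \<Longrightarrow> S \<ge> 0 \<Longrightarrow> symmetric_noise Q G (S / real n) c \<Longrightarrow>
      2 * (x \<bullet> \<beta>) + (2 * r - 1) * S \<le> L1 * (1 + (norm x)\<^sup>2 + q) \<Longrightarrow>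
      (norm \<beta>)\<^sup>2 \<le> C1 * (real n * (1 + (norm x)\<^sup>2) + q) \<Longrightarrow>
      S \<le> C1 * (sqrt (real n) * (1 + (norm x)\<^sup>2) + q) \<Longrightarrow>
      (\<integral>\<^sup>+z. ennreal ((1 + (norm (x + \<beta> /\<^sub>R real n + G z))\<^sup>2) powr r) \<partial>Q)
        \<le> ennreal ((1 + (norm x)\<^sup>2) powr r + K / real n * ((1 + (norm x)\<^sup>2) powr r + q powr r))"
proof -
  \<comment> \<open>At least 2 for the expansion, and at least r so that the moment of order 2m
    controls the crude bound.\<close>
  define m where "m = max 2 (nat \<lceil>r\<rceil>)"
  have rm: "r \<le> real m" unfolding m_def by linarith
  have m: "m \<ge> 2" "r \<le> 2 * real m" using rm r by (auto simp: m_def)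
  obtain C where C: "C \<ge> 0" and exp:
    "\<And>x \<beta> G :: 'a. norm \<beta> / sqrt (1 + (norm x)\<^sup>2) \<le> sqrt (2 * C1) \<Longrightarrow>
      (1 + (norm (x + \<beta> + G))\<^sup>2) powr r + (1 + (norm (x + \<beta> - G))\<^sup>2) powr r
      \<le> 2 * (1 + (norm x)\<^sup>2) powr r * (1 + r * (2 * (x \<bullet> \<beta>) + (norm G)\<^sup>2) / (1 + (norm x)\<^sup>2)
         + 2 * r * (r - 1) * (x \<bullet> G)\<^sup>2 / (1 + (norm x)\<^sup>2)\<^sup>2
         + C * ((norm \<beta> / sqrt (1 + (norm x)\<^sup>2))\<^sup>2 + (norm G / sqrt (1 + (norm x)\<^sup>2)) ^ 4
              + (norm G / sqrt (1 + (norm x)\<^sup>2)) ^ (4 * m)))"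
    using symmetric_powr_expansion[OF r _ m, of "sqrt (2 * C1)", where 'a='a] C1 by auto
  \<comment> \<open>The highest noise moment is reduced to the second power of g: below, g <= 2 C1
    gives g^(2m) <= (2 C1)^(2m - 2) g^2.\<close>
  define C2 where "C2 = c 2 + c (2 * m) * (2 * C1) ^ (2 * m - 2)"
  have C2: "C2 \<ge> 0" using c0 C1 by (simp add: C2_def)
  define K1 where "K1 = r * L1 + C * (C1 + C2 * (2 * C1\<^sup>2))"
  have K1: "K1 \<ge> 0" using r L1 C C1 C2 by (simp add: K1_def)
  define K2 where "K2 = 9 powr r * (3 + c m) * (1 + 2 * C1) powr r"
  have K2: "K2 \<ge> 0" using c0[of m] by (simp add: K2_def)
  show ?thesis
  proof (rule that[of "2 * K1 + K2 + 1"])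
    show "2 * K1 + K2 + 1 > 0" using K1 K2 by simp
    fix Q :: "'q measure" and G :: "'q \<Rightarrow> 'a" and n :: nat and x \<beta> :: 'a and S q :: real
    assume n: "n \<ge> 1" and q: "q \<ge> 0" and S: "S \<ge> 0" and noise: "symmetric_noise Q G (S / real n) c"
    define A where "A = 1 + (norm x)\<^sup>2"
    have A: "A \<ge> 1" by (simp add: A_def)
    assume "2 * (x \<bullet> \<beta>) + (2 * r - 1) * S \<le> L1 * (1 + (norm x)\<^sup>2 + q)"
      and "(norm \<beta>)\<^sup>2 \<le> C1 * (real n * (1 + (norm x)\<^sup>2) + q)"
      and "S \<le> C1 * (sqrt (real n) * (1 + (norm x)\<^sup>2) + q)"
    then have drift: "2 * (x \<bullet> \<beta>) + (2 * r - 1) * S \<le> L1 * (A + q)"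
      and b2: "(norm \<beta>)\<^sup>2 \<le> C1 * (real n * A + q)"
      and S2: "S \<le> C1 * (sqrt (real n) * A + q)" by (simp_all add: A_def)
    interpret symmetric_noise Q G "S / real n" c by (rule noise)
    have n0: "real n > 0" "real n \<ge> 1" using n by auto
    have sn: "sqrt (real n) \<ge> 1" "sqrt (real n) * sqrt (real n) = real n" using n0 by auto
    have An: "A powr r \<ge> 0" "q powr r \<ge> 0" by auto
    define y where "y = q / A"
    have y0: "y \<ge> 0" and qy: "q = y * A" using q A by (auto simp: y_def)
    show "(\<integral>\<^sup>+z. ennreal ((1 + (norm (x + \<beta> /\<^sub>R real n + G z))\<^sup>2) powr r) \<partial>Q)
        \<le> ennreal ((1 + (norm x)\<^sup>2) powr r + (2 * K1 + K2 + 1) / real n * ((1 + (norm x)\<^sup>2) powr r + q powr r))"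
    proof (cases "y \<le> real n")
      case True
      have yn: "y / real n \<le> 1" using True n0 by simp
      have yy: "(y / real n)\<^sup>2 \<le> y / real n"
        using mult_left_mono[OF yn, of "y / real n"] y0 n0 by (simp add: power2_eq_square)
      have nb: "(norm (\<beta> /\<^sub>R real n))\<^sup>2 = (norm \<beta>)\<^sup>2 / (real n)\<^sup>2" by (simp add: power_divide divide_inverse power_mult_distrib power_inverse)
      have v2: "(norm (\<beta> /\<^sub>R real n) / sqrt A)\<^sup>2 \<le> C1 * (1 + y) / real n"
      proof -
        have "(norm (\<beta> /\<^sub>R real n) / sqrt A)\<^sup>2 = (norm \<beta>)\<^sup>2 / ((real n)\<^sup>2 * A)"
          unfolding power_divide nb using A by simp
        also have "\<dots> \<le> (C1 * (real n * A + y * A)) / ((real n)\<^sup>2 * A)"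
          using b2 A n0 qy by (intro divide_right_mono) auto
        also have "\<dots> = C1 * (1 + y / real n) / real n" using A n0 by (simp add: field_simps power2_eq_square)
        also have "\<dots> \<le> C1 * (1 + y) / real n"
          using C1 y0 n0 by (intro divide_right_mono mult_left_mono add_left_mono) (auto simp: divide_le_eq mult_le_cancel_left1)
        finally show ?thesis .
      qed
      \<comment> \<open>The bound sqrt (2 C1) under which the expansion was obtained: y <= n and n
        >= 1 give 1 + y <= 2 n.\<close>
      have vc: "norm (\<beta> /\<^sub>R real n) / sqrt A \<le> sqrt (2 * C1)"
      proof (rule real_le_rsqrt)
        have "(norm (\<beta> /\<^sub>R real n) / sqrt A)\<^sup>2 \<le> C1 * (1 + y) / real n" by (rule v2)
        also have "\<dots> \<le> C1 * (2 * real n) / real n"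
          using C1 True n0 by (intro divide_right_mono mult_left_mono) auto
        finally show "(norm (\<beta> /\<^sub>R real n) / sqrt A)\<^sup>2 \<le> 2 * C1" using n0 by simp
      qed
      define g where "g = S / real n / A"
      have g0: "g \<ge> 0" using S A by (simp add: g_def)
      have g_le: "g \<le> C1 * (1 / sqrt (real n) + y / real n)"
      proof -
        have "g \<le> (C1 * (sqrt (real n) * A + y * A)) / real n / A"
          unfolding g_def using S2 A n0 qy by (intro divide_right_mono) auto
        also have "\<dots> = C1 * (sqrt (real n) / real n + y / real n)"
          using A n0 by (simp add: field_simps)
        also have "sqrt (real n) / real n = 1 / sqrt (real n)" using sn n0 by (simp add: field_simps)
        finally show ?thesis .
      qed
      have g2C: "g \<le> 2 * C1"
      proof -
        have "1 / sqrt (real n) + y / real n \<le> 2" using yn sn by (smt (verit) divide_le_eq_1)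
        then show ?thesis using g_le mult_left_mono[of _ 2 C1] C1 by fastforce
      qed
      \<comment> \<open>The regime enters as (y / n)^2 <= y / n, so that both parts of the square
        are of order (1 + y) / n.\<close>
      have gg: "g\<^sup>2 \<le> 2 * C1\<^sup>2 * (1 + y) / real n"
      proof -
        have "g\<^sup>2 \<le> (C1 * (1 / sqrt (real n) + y / real n))\<^sup>2" using g_le g0 by (rule power_mono)
        also have "\<dots> \<le> C1\<^sup>2 * (2 * ((1 / sqrt (real n))\<^sup>2 + (y / real n)\<^sup>2))"
          unfolding power_mult_distrib
          using sum_squares_bound[of "1 / sqrt (real n)" "y / real n"]
          by (intro mult_left_mono) (auto simp: power2_sum)
        also have "\<dots> \<le> C1\<^sup>2 * (2 * (1 / real n + y / real n))"
          using yy n0 by (intro mult_left_mono add_mono) (auto simp: power_divide)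
        also have "\<dots> = 2 * C1\<^sup>2 * (1 + y) / real n" using n0 by (simp add: field_simps)
        finally show ?thesis .
      qed
      have gm: "g ^ (2 * m) \<le> (2 * C1) ^ (2 * m - 2) * g\<^sup>2"
      proof -
        have "g ^ (2 * m) = g ^ (2 * m - 2) * g\<^sup>2" 
        proof -
          have "2 * m = (2 * m - 2) + 2" using m(1) by simp
          then show ?thesis by (metis power_add)
        qed
        also have "\<dots> \<le> (2 * C1) ^ (2 * m - 2) * g\<^sup>2" using g2C g0 by (intro mult_right_mono power_mono) auto
        finally show ?thesis .
      qed
      have "(\<integral>\<^sup>+z. ennreal ((1 + (norm (x + \<beta> /\<^sub>R real n + G z))\<^sup>2) powr r) \<partial>Q)
        \<le> ennreal (A powr r * (1 + r * (2 * (x \<bullet> (\<beta> /\<^sub>R real n)) + (2 * r - 1) * (S / real n)) / A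
        + C * ((norm (\<beta> /\<^sub>R real n) / sqrt A)\<^sup>2 + c 2 * (S / real n / A)\<^sup>2 + c (2 * m) * (S / real n / A) ^ (2 * m))))"
        using exp[of "\<beta> /\<^sub>R real n" x] vc
        by (intro symmetric_moment_bound C r) (auto simp: A_def)
      also have "\<dots> \<le> ennreal (A powr r * (1 + K1 * (1 + y) / real n))"
      proof (intro ennreal_leI mult_left_mono An(1))
        have "r * (2 * (x \<bullet> (\<beta> /\<^sub>R real n)) + (2 * r - 1) * (S / real n)) / A
            = r / (real n * A) * (2 * (x \<bullet> \<beta>) + (2 * r - 1) * S)"
          using n0 A by (simp add: field_simps)
        also have "\<dots> \<le> r / (real n * A) * (L1 * (A + y * A))"
          using drift r n0 A qy by (intro mult_left_mono) auto
        also have "\<dots> = r * L1 * (1 + y) / real n" using n0 A by (simp add: field_simps)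
        finally have d: "r * (2 * (x \<bullet> (\<beta> /\<^sub>R real n)) + (2 * r - 1) * (S / real n)) / A \<le> r * L1 * (1 + y) / real n" .
        have "c 2 * g\<^sup>2 + c (2 * m) * g ^ (2 * m) \<le> c 2 * g\<^sup>2 + c (2 * m) * ((2 * C1) ^ (2 * m - 2) * g\<^sup>2)"
          using gm c0 by (intro add_left_mono mult_left_mono) auto
        also have "\<dots> = C2 * g\<^sup>2" by (simp add: C2_def algebra_simps)
        also have "\<dots> \<le> C2 * (2 * C1\<^sup>2 * (1 + y) / real n)" using gg C2 by (rule mult_left_mono)
        finally have "C * ((norm (\<beta> /\<^sub>R real n) / sqrt A)\<^sup>2 + c 2 * g\<^sup>2 + c (2 * m) * g ^ (2 * m))
            \<le> C * (C1 * (1 + y) / real n + C2 * (2 * C1\<^sup>2 * (1 + y) / real n))"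
          using v2 C by (intro mult_left_mono) auto
        then have "1 + r * (2 * (x \<bullet> (\<beta> /\<^sub>R real n)) + (2 * r - 1) * (S / real n)) / A
            + C * ((norm (\<beta> /\<^sub>R real n) / sqrt A)\<^sup>2 + c 2 * g\<^sup>2 + c (2 * m) * g ^ (2 * m))
            \<le> 1 + r * L1 * (1 + y) / real n + C * (C1 * (1 + y) / real n + C2 * (2 * C1\<^sup>2 * (1 + y) / real n))"
          using d by linarith
        also have "\<dots> = 1 + K1 * (1 + y) / real n"
          by (simp add: K1_def add_divide_distrib distrib_left distrib_right)
        finally show "1 + r * (2 * (x \<bullet> (\<beta> /\<^sub>R real n)) + (2 * r - 1) * (S / real n)) / A
            + C * ((norm (\<beta> /\<^sub>R real n) / sqrt A)\<^sup>2 + c 2 * (S / real n / A)\<^sup>2 + c (2 * m) * (S / real n / A) ^ (2 * m))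
            \<le> 1 + K1 * (1 + y) / real n" unfolding g_def .
      qed
      also have "\<dots> \<le> ennreal (A powr r + (2 * K1 + K2 + 1) / real n * (A powr r + q powr r))"
      proof (rule ennreal_leI)
        \<comment> \<open>Young's inequality in homogeneous form: for y <= 1 the first summand is
          enough; for y > 1 one has y <= y^r and A^r y^r = q^r.\<close>
        have "A powr r * y \<le> A powr r + q powr r"
        proof (cases "y \<le> 1")
          case True
          then show ?thesis using mult_left_mono[of y 1 "A powr r"] An by linarith
        next
          case False
          have "y \<le> y powr r" using False r powr_mono[of 1 r y] by simp
          then have "A powr r * y \<le> A powr r * y powr r" by (intro mult_left_mono) auto
          also have "\<dots> = q powr r" by (simp add: qy powr_mult mult.commute)
          finally show ?thesis using An by linarith
        qed
        then have "A powr r + A powr r * y \<le> 2 * (A powr r + q powr r)"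
          using An by (simp add: algebra_simps) (smt (verit) An)
        then have "K1 * (A powr r + A powr r * y) \<le> K1 * (2 * (A powr r + q powr r))"
          using K1 by (rule mult_left_mono)
        also have "\<dots> \<le> (2 * K1 + K2 + 1) * (A powr r + q powr r)"
          using An K2 by (simp add: algebra_simps)
        finally have "K1 * (A powr r + A powr r * y) / real n \<le> (2 * K1 + K2 + 1) * (A powr r + q powr r) / real n"
          using n0 by (intro divide_right_mono) auto
        then show "A powr r * (1 + K1 * (1 + y) / real n) \<le> A powr r + (2 * K1 + K2 + 1) / real n * (A powr r + q powr r)"
          by (simp add: algebra_simps)
      qed
      finally show ?thesis by (simp add: A_def)
    next
      case False
      then have nA: "real n * A \<le> q" using A by (simp add: qy mult_right_mono)
      \<comment> \<open>The scale of the crude regime: n A <= q bounds A, |beta / n|^2 and S / n by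
        multiples of q / n.\<close>
      define D where "D = (1 + 2 * C1) * (q / real n)"
      have qn: "q / real n \<ge> 0" using q by simp
      have D_eq: "D = q / real n + 2 * C1 * (q / real n)" by (simp only: D_def distrib_right mult_1)
      have D1: "A \<le> D"
      proof -
        have "A \<le> q / real n" using nA n0 by (simp add: field_simps)
        also have "\<dots> \<le> D" using D_eq mult_nonneg_nonneg[OF _ qn, of "2 * C1"] C1 by linarith
        finally show ?thesis .
      qed
      have q2: "2 * C1 * (q / real n) \<le> D" using qn D_eq by linarith
      have "C1 * (real n * A + q) \<le> C1 * (2 * q)" using nA C1 by (intro mult_left_mono) auto
      then have "(norm \<beta>)\<^sup>2 \<le> 2 * C1 * q" using b2 by simp
      then have "(norm \<beta>)\<^sup>2 / (real n)\<^sup>2 \<le> 2 * C1 * q / (real n)\<^sup>2" by (intro divide_right_mono) auto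
      also have "\<dots> \<le> 2 * C1 * q / real n"
        using n0 C1 q by (intro divide_left_mono) (auto simp: power2_eq_square)
      finally have D2: "(norm (\<beta> /\<^sub>R real n))\<^sup>2 \<le> D" using q2
        by (simp add: power_divide divide_inverse power_mult_distrib power_inverse mult.commute mult.left_commute)
      have "sqrt (real n) \<le> real n" using mult_left_mono[OF sn(1), of "sqrt (real n)"] sn by simp
      then have "sqrt (real n) * A \<le> real n * A" using A by (intro mult_right_mono) auto
      then have "C1 * (sqrt (real n) * A + q) \<le> C1 * (2 * q)" using nA C1 by (intro mult_left_mono) auto
      then have "S \<le> 2 * C1 * q" using S2 by simp
      then have D3: "S / real n \<le> D" using q2 n0 divide_right_mono[of S "2 * C1 * q" "real n"] by simp
      have "(\<integral>\<^sup>+z. ennreal ((1 + (norm (x + \<beta> /\<^sub>R real n + G z))\<^sup>2) powr r) \<partial>Q)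
          \<le> ennreal (9 powr r * (3 + c m) * D powr r)"
        using D1 D2 D3 r rm by (intro crude_moment_bound) (auto simp: A_def)
      also have "\<dots> \<le> ennreal (A powr r + (2 * K1 + K2 + 1) / real n * (A powr r + q powr r))"
      proof (rule ennreal_leI)
        \<comment> \<open>Here r > 1 is used: n^(-r) <= 1 / n, and 1 / n is all that a single step
          may cost.\<close>
        have "real n powr 1 \<le> real n powr r" using n0 r by (intro powr_mono) auto
        then have nr: "real n \<le> real n powr r" using n0 by simp
        have "D powr r = (1 + 2 * C1) powr r * (q powr r / real n powr r)"
          using C1 q n0 by (simp add: D_def powr_mult powr_divide)
        also have "\<dots> \<le> (1 + 2 * C1) powr r * (q powr r / real n)"
          using nr n0 by (intro mult_left_mono divide_left_mono) auto
        finally have "9 powr r * (3 + c m) * D powr r \<le> 9 powr r * (3 + c m) * ((1 + 2 * C1) powr r * (q powr r / real n))"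
          using c0[of m] by (intro mult_left_mono) auto
        also have "\<dots> = K2 / real n * q powr r" by (simp add: K2_def)
        also have "\<dots> \<le> (2 * K1 + K2 + 1) / real n * (A powr r + q powr r)"
          using K1 K2 n0 An by (intro mult_mono divide_right_mono) auto
        finally show "9 powr r * (3 + c m) * D powr r \<le> A powr r + (2 * K1 + K2 + 1) / real n * (A powr r + q powr r)"
          using An by linarith
      qed
      finally show ?thesis by (simp add: A_def)
    qed
  qed
qed

section \<open>Gaussian increments\<close>

text \<open>The normal law N(0, h I), with the density written exactly as in
  \<open>wiener_process\<close>, so that the law of an increment unfolds to it.\<close>

definition gaussian :: "real \<Rightarrow> (real ^ 'm) measure" where
  "gaussian h = density lborel (\<lambda>x. ennreal (\<Prod>k\<in>UNIV. normal_density 0 (sqrt h) (x $ k)))"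

lemma sets_gaussian [simp, measurable_cong]: "sets (gaussian h) = sets borel"
  and space_gaussian [simp]: "space (gaussian h) = UNIV"
  by (auto simp: gaussian_def)

lemma measurable_gaussian_density [measurable]:
  "(\<lambda>x::real ^ 'm. ennreal (\<Prod>k\<in>UNIV. normal_density 0 (sqrt h) (x $ k))) \<in> borel_measurable borel"
  by measurable

text \<open>The product formula for Lebesgue measure is indexed by \<open>Basis\<close>, which here
  consists of the vectors \<open>axis k 1\<close>. Inverting k |-> \<open>axis k 1\<close> turns it
  into a product over coordinates.\<close>

lemma nn_integral_lborel_vec_prod:
  fixes f :: "'m::finite \<Rightarrow> real \<Rightarrow> ennreal"
  assumes [measurable]: "\<And>k. f k \<in> borel_measurable borel"
  shows "(\<integral>\<^sup>+x. (\<Prod>k\<in>UNIV. f k (x $ k)) \<partial>(lborel :: (real ^ 'm) measure)) = (\<Prod>k\<in>UNIV. \<integral>\<^sup>+x. f k x \<partial>lborel)"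
proof -
  have inj: "inj (\<lambda>k::'m. axis k (1::real))" by (auto simp: inj_def axis_eq_axis)
  have B: "(Basis :: (real ^ 'm) set) = range (\<lambda>k. axis k 1)" by (auto simp: Basis_vec_def)
  define g where "g b = f (the_inv (\<lambda>k::'m. axis k (1::real)) b)" for b
  have g: "g (axis k 1) = f k" for k by (simp add: g_def the_inv_f_f[OF inj])
  have "(\<integral>\<^sup>+x. (\<Prod>b\<in>Basis. g b (x \<bullet> b)) \<partial>(lborel :: (real ^ 'm) measure)) = (\<Prod>b\<in>Basis. \<integral>\<^sup>+x. g b x \<partial>lborel)"
    by (rule nn_integral_lborel_prod) (auto simp: g_def)
  then show ?thesis
    by (simp add: B prod.reindex[OF inj] o_def g inner_axis)
qed

lemma nn_integral_gaussian_prod: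
  fixes f :: "'m::finite \<Rightarrow> real \<Rightarrow> ennreal"
  assumes [measurable]: "\<And>k. f k \<in> borel_measurable borel"
  shows "(\<integral>\<^sup>+x. (\<Prod>k\<in>UNIV. f k (x $ k)) \<partial>(gaussian h :: (real ^ 'm) measure))
    = (\<Prod>k\<in>UNIV. \<integral>\<^sup>+x. ennreal (normal_density 0 (sqrt h) x) * f k x \<partial>lborel)"
proof -
  have "(\<integral>\<^sup>+x. (\<Prod>k\<in>UNIV. f k (x $ k)) \<partial>(gaussian h :: (real ^ 'm) measure))
    = (\<integral>\<^sup>+x. ennreal (\<Prod>k\<in>UNIV. normal_density 0 (sqrt h) (x $ k)) * (\<Prod>k\<in>UNIV. f k (x $ k)) \<partial>(lborel :: (real ^ 'm) measure))"
    unfolding gaussian_def by (rule nn_integral_density) measurable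
  also have "\<dots> = (\<integral>\<^sup>+x. (\<Prod>k\<in>UNIV. ennreal (normal_density 0 (sqrt h) (x $ k)) * f k (x $ k)) \<partial>(lborel :: (real ^ 'm) measure))"
    by (simp add: prod.distrib prod_ennreal)
  also have "\<dots> = (\<Prod>k\<in>UNIV. \<integral>\<^sup>+x. ennreal (normal_density 0 (sqrt h) x) * f k x \<partial>lborel)"
    by (rule nn_integral_lborel_vec_prod) measurable
  finally show ?thesis .
qed

lemma nn_integral_normal_density: "h > 0 \<Longrightarrow> (\<integral>\<^sup>+x. ennreal (normal_density 0 (sqrt h) x) \<partial>lborel) = 1"
  by (subst nn_integral_eq_integral) auto

lemma prob_space_gaussian:
  assumes "h > 0"
  shows "prob_space (gaussian h :: (real ^ 'm) measure)"
proof
  show "emeasure (gaussian h) (space (gaussian h :: (real ^ 'm) measure)) = 1"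
    using nn_integral_gaussian_prod[where f="\<lambda>_::'m. \<lambda>_. 1" and h=h] assms
    by (simp add: nn_integral_normal_density)
qed

lemma nn_integral_gaussian_coord:
  fixes f :: "real \<Rightarrow> ennreal" and i :: "'m::finite"
  assumes "h > 0" and [measurable]: "f \<in> borel_measurable borel"
  shows "(\<integral>\<^sup>+x. f (x $ i) \<partial>(gaussian h :: (real ^ 'm) measure))
    = (\<integral>\<^sup>+x. ennreal (normal_density 0 (sqrt h) x) * f x \<partial>lborel)"
proof -
  have "(\<integral>\<^sup>+x. f (x $ i) \<partial>(gaussian h :: (real ^ 'm) measure)) =
     (\<integral>\<^sup>+x. (\<Prod>k\<in>UNIV. (if k = i then f else (\<lambda>_. 1)) (x $ k)) \<partial>(gaussian h :: (real ^ 'm) measure))"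
    by (intro nn_integral_cong) (simp add: if_distrib[of "\<lambda>g. g _"] prod.delta cong: if_cong)
  also have "\<dots> = (\<Prod>k\<in>UNIV. \<integral>\<^sup>+x. ennreal (normal_density 0 (sqrt h) x) * (if k = i then f else (\<lambda>_. 1)) x \<partial>lborel)"
    by (rule nn_integral_gaussian_prod) auto
  also have "\<dots> = (\<Prod>k\<in>UNIV. if k = i then \<integral>\<^sup>+x. ennreal (normal_density 0 (sqrt h) x) * f x \<partial>lborel else 1)"
    using assms(1) by (intro prod.cong) (auto simp: nn_integral_normal_density)
  also have "\<dots> = (\<integral>\<^sup>+x. ennreal (normal_density 0 (sqrt h) x) * f x \<partial>lborel)"
    by (simp add: prod.delta)
  finally show ?thesis .
qed

lemma gaussian_coord_moment:
  fixes i :: "'m::finite"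
  assumes "h > 0"
  shows "(\<integral>\<^sup>+x. ennreal ((x $ i) ^ (2 * k)) \<partial>(gaussian h :: (real ^ 'm) measure))
    = ennreal (fact (2 * k) / (2 ^ k * fact k) * h ^ k)"
proof -
  have "has_bochner_integral lborel (\<lambda>x. normal_density 0 (sqrt h) x * x ^ (2 * k)) (fact (2 * k) / ((2 / (sqrt h)\<^sup>2)^k * fact k))"
    using normal_moment_even[of "sqrt h" 0 k] assms by simp
  then have H: "has_bochner_integral lborel (\<lambda>x. normal_density 0 (sqrt h) x * x ^ (2 * k)) (fact (2 * k) / (2 ^ k * fact k) * h ^ k)"
    using assms by (simp add: power_divide)
  have "(\<integral>\<^sup>+x. ennreal ((x $ i) ^ (2 * k)) \<partial>(gaussian h :: (real ^ 'm) measure))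
      = (\<integral>\<^sup>+x. ennreal (normal_density 0 (sqrt h) x * x ^ (2 * k)) \<partial>lborel)"
    by (subst nn_integral_gaussian_coord[OF assms, where f="\<lambda>x. ennreal (x ^ (2 * k))"])
      (auto simp: ennreal_mult)
  also have "\<dots> = ennreal (fact (2 * k) / (2 ^ k * fact k) * h ^ k)"
    using H by (intro nn_integral_has_integral_lebesgue[OF _ _] nn_integral_eq_integral[THEN trans])
      (auto simp: has_bochner_integral_iff)
  finally show ?thesis .
qed

text \<open>The density is even in each coordinate, and the diagonal map has determinant of modulus
  1. Flipping all signs gives the symmetry of the noise; flipping a single one makes the mixed
  second moments vanish.\<close>

lemma gaussian_sign_flip:
  fixes f :: "real ^ 'm \<Rightarrow> ennreal" and s :: "'m \<Rightarrow> real"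
  assumes [measurable]: "f \<in> borel_measurable borel" and s: "\<And>k. \<bar>s k\<bar> = 1"
  shows "(\<integral>\<^sup>+x. f (\<chi> k. s k * x $ k) \<partial>gaussian h) = (\<integral>\<^sup>+x. f x \<partial>gaussian h)"
proof -
  have inj: "inj (\<lambda>k::'m. axis k (1::real))" by (auto simp: inj_def axis_eq_axis)
  have B: "(Basis :: (real ^ 'm) set) = range (\<lambda>k. axis k 1)" by (auto simp: Basis_vec_def)
  define c where "c b = s (the_inv (\<lambda>k::'m. axis k (1::real)) b)" for b
  have c: "c (axis k 1) = s k" for k by (simp add: c_def the_inv_f_f[OF inj])
  define T where "T x = (0 :: real ^ 'm) + (\<Sum>j\<in>Basis. (c j * (x \<bullet> j)) *\<^sub>R j)" for x
  have T: "T x = (\<chi> k. s k * x $ k)" for x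
  proof -
    have "T x = (\<Sum>k\<in>UNIV. (s k * x $ k) *\<^sub>R axis k 1)"
      by (simp add: T_def B sum.reindex[OF inj] o_def c inner_axis)
    then show ?thesis
      by (simp add: vec_eq_iff axis_def if_distrib[of "\<lambda>y. _ * y"] sum.delta' cong: if_cong)
  qed
  have [measurable]: "T \<in> borel_measurable borel"
    unfolding T_def[abs_def] by measurable
  have s0: "s k \<noteq> 0" for k using s[of k] by auto
  have "(lborel :: (real ^ 'm) measure) = density (distr lborel borel T) (\<lambda>_. ennreal (\<Prod>j\<in>Basis. \<bar>c j\<bar>))"
    unfolding T_def[abs_def] by (rule lborel_affine_euclidean) (auto simp: c_def s0)
  also have "(\<Prod>j\<in>(Basis :: (real ^ 'm) set). \<bar>c j\<bar>) = 1" by (simp add: c_def s)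
  finally have L: "(lborel :: (real ^ 'm) measure) = distr lborel borel T" by (simp add: density_1)
  have nd: "normal_density 0 (sqrt h) (s k * y) = normal_density 0 (sqrt h) y" for k y
  proof -
    have "(s k * y)\<^sup>2 = y\<^sup>2" using s[of k] by (metis abs_mult mult_1 power2_abs)
    then show ?thesis by (simp add: normal_density_def)
  qed
  have "(\<integral>\<^sup>+x. f x \<partial>gaussian h) = (\<integral>\<^sup>+x. ennreal (\<Prod>k\<in>UNIV. normal_density 0 (sqrt h) (x $ k)) * f x \<partial>lborel)"
    unfolding gaussian_def by (rule nn_integral_density) measurable
  also have "\<dots> = (\<integral>\<^sup>+x. ennreal (\<Prod>k\<in>UNIV. normal_density 0 (sqrt h) (T x $ k)) * f (T x) \<partial>lborel)"
    by (subst L) (simp add: nn_integral_distr)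
  also have "\<dots> = (\<integral>\<^sup>+x. ennreal (\<Prod>k\<in>UNIV. normal_density 0 (sqrt h) (x $ k)) * f (T x) \<partial>lborel)"
    by (simp add: T nd)
  also have "\<dots> = (\<integral>\<^sup>+x. f (T x) \<partial>gaussian h)"
    unfolding gaussian_def by (rule nn_integral_density[symmetric]) measurable
  finally show ?thesis by (simp add: T)
qed

lemma gaussian_uminus:
  fixes f :: "real ^ 'm \<Rightarrow> ennreal"
  assumes "f \<in> borel_measurable borel"
  shows "(\<integral>\<^sup>+x. f (- x) \<partial>gaussian h) = (\<integral>\<^sup>+x. f x \<partial>gaussian h)"
proof -
  have "(\<chi> k. - 1 * x $ k) = - x" for x :: "real ^ 'm" by (simp add: vec_eq_iff)
  then show ?thesis using gaussian_sign_flip[OF assms, of "\<lambda>_. -1" h] by simp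
qed

text \<open>The largest coordinate M satisfies |x|^2 <= d M^2, which reduces the claim to
  one-dimensional moments. The point is the exact scaling h^k with one constant for all h.\<close>

lemma gaussian_norm_moment_exists:
  "\<exists>C\<ge>1. \<forall>h>0. (\<integral>\<^sup>+x. ennreal (norm x ^ (2 * k)) \<partial>(gaussian h :: (real ^ 'm) measure)) \<le> ennreal (C * h ^ k)"
proof -
  define c where "c = (fact (2 * k) / (2 ^ k * fact k) :: real)"
  define d where "d = real CARD('m)"
  have d: "d \<ge> 1" by (simp add: d_def Suc_le_eq)
  have c: "c \<ge> 0" by (simp add: c_def)
  have pw: "norm x ^ (2 * k) \<le> d ^ k * (\<Sum>i\<in>UNIV. (x $ i) ^ (2 * k))" for x :: "real ^ 'm"
  proof -
    define M where "M = Max (range (\<lambda>i. \<bar>x $ i\<bar>))"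
    have M: "\<bar>x $ i\<bar> \<le> M" for i by (simp add: M_def)
    have "M \<in> range (\<lambda>i. \<bar>x $ i\<bar>)" unfolding M_def by (rule Max_in) auto
    then obtain j where j: "M = \<bar>x $ j\<bar>" by blast
    have "(norm x)\<^sup>2 = (\<Sum>i\<in>UNIV. (x $ i)\<^sup>2)" by (simp add: norm_vec_def L2_set_def sum_nonneg)
    also have "\<dots> \<le> (\<Sum>i\<in>(UNIV::'m set). M\<^sup>2)"
      by (intro sum_mono) (metis M abs_ge_zero power2_abs power_mono)
    finally have "(norm x)\<^sup>2 \<le> d * M\<^sup>2" by (simp add: d_def)
    then have "((norm x)\<^sup>2) ^ k \<le> (d * M\<^sup>2) ^ k" by (intro power_mono) auto
    also have "\<dots> = d ^ k * (x $ j) ^ (2 * k)" by (simp add: power_mult_distrib j flip: power_mult)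
    also have "\<dots> \<le> d ^ k * (\<Sum>i\<in>UNIV. (x $ i) ^ (2 * k))"
      using d by (intro mult_left_mono member_le_sum) (auto simp: zero_le_even_power)
    finally show ?thesis by (simp add: power_mult)
  qed
  have "(\<integral>\<^sup>+x. ennreal (norm x ^ (2 * k)) \<partial>(gaussian h :: (real ^ 'm) measure)) \<le> ennreal ((d ^ k * (d * c) + 1) * h ^ k)"
    if h: "h > 0" for h
  proof -
    have "(\<integral>\<^sup>+x. ennreal (norm x ^ (2 * k)) \<partial>(gaussian h :: (real ^ 'm) measure))
        \<le> (\<integral>\<^sup>+x. ennreal (d ^ k) * (\<Sum>i\<in>UNIV. ennreal ((x $ i) ^ (2 * k))) \<partial>(gaussian h :: (real ^ 'm) measure))"
      by (intro nn_integral_mono) (use d pw in \<open>auto simp: sum_ennreal zero_le_even_power ennreal_mult[symmetric] sum_nonneg intro!: ennreal_leI\<close>)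
    also have "\<dots> = ennreal (d ^ k) * (\<Sum>i\<in>(UNIV::'m set). ennreal (c * h ^ k))"
      by (simp add: nn_integral_cmult nn_integral_sum gaussian_coord_moment[OF h] c_def del: sum_ennreal)
    also have "\<dots> = ennreal (d ^ k * (d * (c * h ^ k)))"
      using d c h by (simp add: ennreal_mult d_def ennreal_of_nat_eq_real_of_nat)
    also have "\<dots> \<le> ennreal ((d ^ k * (d * c) + 1) * h ^ k)"
      using h by (intro ennreal_leI) (simp add: algebra_simps)
    finally show ?thesis .
  qed
  then show ?thesis using d c by (intro exI[of _ "d ^ k * (d * c) + 1"]) auto
qed

lemma integrable_gaussian_norm_power:
  assumes h: "h > 0"
  shows "integrable (gaussian h :: (real ^ 'm) measure) (\<lambda>x. norm x ^ k)"
proof -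
  interpret prob_space "gaussian h :: (real ^ 'm) measure" by (rule prob_space_gaussian[OF h])
  obtain C where "(\<integral>\<^sup>+x. ennreal (norm x ^ (2 * k)) \<partial>(gaussian h :: (real ^ 'm) measure)) \<le> ennreal (C * h ^ k)"
    using gaussian_norm_moment_exists[of k] h by blast
  then have I: "integrable (gaussian h :: (real ^ 'm) measure) (\<lambda>x. norm x ^ (2 * k))"
    by (intro integrableI_bounded) (auto simp: less_top[symmetric] top_unique)
  have "norm y ^ k \<le> 1 + norm y ^ (2 * k)" for y :: "real ^ 'm"
  proof (cases "norm y \<le> 1")
    case True then show ?thesis using power_le_one[of "norm y" k] by (simp add: add_increasing2)
  next
    case False
    then have "norm y ^ k \<le> norm y ^ (2 * k)" by (intro power_increasing) auto
    then show ?thesis by simp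
  qed
  then show ?thesis
    by (intro Bochner_Integration.integrable_bound[OF Bochner_Integration.integrable_add[OF integrable_const[of 1] I]]) (auto intro!: AE_I2)
qed

lemma gaussian_second_moments:
  fixes i j :: "'m::finite"
  assumes h: "h > 0"
  shows "integrable (gaussian h) (\<lambda>x :: real ^ 'm. x $ i * x $ j)"
    and "(\<integral>x. x $ i * x $ j \<partial>(gaussian h :: (real ^ 'm) measure)) = (if i = j then h else 0)"
proof -
  show int: "integrable (gaussian h) (\<lambda>x :: real ^ 'm. x $ i * x $ j)" for i j
  proof (rule Bochner_Integration.integrable_bound[OF integrable_gaussian_norm_power[OF h, of 2]])
    have "\<bar>x $ i * x $ j\<bar> \<le> norm x * norm x" for x :: "real ^ 'm"
      unfolding abs_mult by (intro mult_mono component_le_norm_cart) auto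
    then show "AE x in gaussian h :: (real ^ 'm) measure. norm (x $ i * x $ j) \<le> norm (norm x ^ 2)"
      by (auto simp: power2_eq_square)
  qed measurable
  show "(\<integral>x. x $ i * x $ j \<partial>(gaussian h :: (real ^ 'm) measure)) = (if i = j then h else 0)"
  proof (cases "i = j")
    case True
    have "(\<integral>x. x $ i * x $ j \<partial>(gaussian h :: (real ^ 'm) measure)) = h"
    proof (rule nn_integral_eq_integrable[THEN iffD1, THEN conjunct2])
      show "(\<integral>\<^sup>+x. ennreal (x $ i * x $ j) \<partial>(gaussian h :: (real ^ 'm) measure)) = ennreal h"
        using gaussian_coord_moment[OF h, of i 1] by (simp add: True power2_eq_square eval_nat_numeral)
    qed (use h True in auto)
    then show ?thesis using True by simp
  next
    case False
    \<comment> \<open>Flipping coordinate i preserves the law and changes the sign of x_i x_j, so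
      the mixed moment equals its own negative.\<close>
    define s where "s k = (if k = i then -1 else 1 :: real)" for k :: 'm
    define F where "F x = (\<chi> k. s k * x $ k)" for x :: "real ^ 'm"
    have [measurable]: "F \<in> borel_measurable borel"
      unfolding F_def by (intro borel_measurable_continuous_onI continuous_intros)
    have "distr (gaussian h) borel F = (gaussian h :: (real ^ 'm) measure)"
    proof (rule measure_eqI)
      fix A assume A: "A \<in> sets (distr (gaussian h) borel F)"
      then have [measurable]: "A \<in> sets borel" by simp
      have "emeasure (distr (gaussian h) borel F) A = (\<integral>\<^sup>+x. indicator A (F x) \<partial>gaussian h)"
        using A by (simp add: nn_integral_distr flip: nn_integral_indicator)
      also have "\<dots> = (\<integral>\<^sup>+x. indicator A x \<partial>gaussian h)"
        unfolding F_def by (rule gaussian_sign_flip) (auto simp: s_def)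
      finally show "emeasure (distr (gaussian h) borel F) A = emeasure (gaussian h) A" using A by simp
    qed simp
    then have "(\<integral>x. x $ i * x $ j \<partial>(gaussian h :: (real ^ 'm) measure)) = (\<integral>x. x $ i * x $ j \<partial>distr (gaussian h) borel F)"
      by simp
    also have "\<dots> = (\<integral>x. F x $ i * F x $ j \<partial>gaussian h)" by (rule integral_distr) measurable
    also have "\<dots> = - (\<integral>x. x $ i * x $ j \<partial>(gaussian h :: (real ^ 'm) measure))"
      using False by (simp add: F_def s_def)
    finally show ?thesis using False by simp
  qed
qed

lemma gaussian_linear_square:
  fixes a :: "real ^ 'm"
  assumes h: "h > 0"
  shows "integrable (gaussian h) (\<lambda>x. (a \<bullet> x)\<^sup>2)"
    and "(\<integral>x. (a \<bullet> x)\<^sup>2 \<partial>gaussian h) = h * (norm a)\<^sup>2"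
proof -
  have eq: "(a \<bullet> x)\<^sup>2 = (\<Sum>i\<in>UNIV. \<Sum>j\<in>UNIV. (a $ i * a $ j) * (x $ i * x $ j))" for x :: "real ^ 'm"
    by (simp add: inner_vec_def power2_eq_square sum_product algebra_simps)
  show "integrable (gaussian h) (\<lambda>x. (a \<bullet> x)\<^sup>2)"
    unfolding eq by (intro Bochner_Integration.integrable_sum integrable_mult_right gaussian_second_moments h)
  have "(\<integral>x. (a \<bullet> x)\<^sup>2 \<partial>gaussian h) = (\<Sum>i\<in>UNIV. \<Sum>j\<in>UNIV. (a $ i * a $ j) * (if i = j then h else 0))"
    unfolding eq by (simp add: Bochner_Integration.integral_sum Bochner_Integration.integrable_sum gaussian_second_moments h)
  also have "\<dots> = (\<Sum>i\<in>UNIV. h * (a $ i)\<^sup>2)"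
    by (intro sum.cong) (simp_all add: if_distrib[of "\<lambda>y. _ * y"] sum.delta power2_eq_square cong: if_cong)
  also have "\<dots> = h * (norm a)\<^sup>2"
    unfolding power2_norm_eq_inner inner_vec_def by (simp add: sum_distrib_left power2_eq_square)
  finally show "(\<integral>x. (a \<bullet> x)\<^sup>2 \<partial>gaussian h) = h * (norm a)\<^sup>2" .
qed

section \<open>Freezing and maximal inequalities\<close>

lemma measurable_ident_subalgebra: "subalgebra M F \<Longrightarrow> (\<lambda>x. x) \<in> measurable M F"
  by (auto simp: subalgebra_def measurable_def)

text \<open>The integrated form of conditioning on F: an argument that is F-measurable is held fixed
  while Z is integrated against its law. It replaces conditional expectations everywhere
  below.\<close>

lemma (in prob_space) nn_integral_indep_freeze:
  fixes Z :: "'a \<Rightarrow> 'b::{second_countable_topology}"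
  assumes F: "subalgebra M F" and Z [measurable]: "Z \<in> borel_measurable M"
    and ind: "indep_set (sets F) (sets (vimage_algebra (space M) Z borel))"
    and f [measurable]: "f \<in> borel_measurable (F \<Otimes>\<^sub>M borel)"
  shows "(\<integral>\<^sup>+\<omega>. f (\<omega>, Z \<omega>) \<partial>M) = (\<integral>\<^sup>+\<omega>. (\<integral>\<^sup>+z. f (\<omega>, z) \<partial>distr M borel Z) \<partial>M)"
proof -
  note id = measurable_ident_subalgebra[OF F]
  have sp: "space F = space M" and sb: "sets F \<subseteq> sets M" using F by (auto simp: subalgebra_def)
  interpret Z: prob_space "distr M borel Z" by (rule prob_space_distr) simp
  have [measurable]: "(\<lambda>x. (x, Z x)) \<in> M \<rightarrow>\<^sub>M (F \<Otimes>\<^sub>M borel)" using id by measurable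
  interpret F: prob_space "distr M F (\<lambda>x. x)" by (rule prob_space_distr) (rule id)
  \<comment> \<open>The image of M under the identity into F is the restriction of M to F.
    Independence says that the joint law of the identity and Z agrees with the product measure on
    rectangles, which determines it.\<close>
  have eq: "distr M F (\<lambda>x. x) \<Otimes>\<^sub>M distr M borel Z = distr M (F \<Otimes>\<^sub>M borel) (\<lambda>x. (x, Z x))"
  proof (rule pair_measure_eqI)
    fix A B assume A: "A \<in> sets (distr M F (\<lambda>x. x))" and B: "B \<in> sets (distr M borel Z)"
    then have A': "A \<in> sets F" "A \<in> sets M" and B': "B \<in> sets borel" using sb by auto
    have AM: "A \<inter> space M = A" using A' sets.sets_into_space by blast
    have ZB: "Z -` B \<inter> space M \<in> sets (vimage_algebra (space M) Z borel)"
      using B' by (rule in_vimage_algebra)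
    have "emeasure (distr M F (\<lambda>x. x)) A * emeasure (distr M borel Z) B
        = ennreal (prob A * prob (Z -` B \<inter> space M))"
      using A A' B' id AM by (simp add: emeasure_distr emeasure_eq_measure ennreal_mult)
    also have "prob A * prob (Z -` B \<inter> space M) = prob (A \<inter> (Z -` B \<inter> space M))"
      using indep_setD[OF ind A'(1) ZB] by simp
    also have "A \<inter> (Z -` B \<inter> space M) = (\<lambda>x. (x, Z x)) -` (A \<times> B) \<inter> space M" using AM by auto
    also have "ennreal (prob \<dots>) = emeasure (distr M (F \<Otimes>\<^sub>M borel) (\<lambda>x. (x, Z x))) (A \<times> B)"
      using A' B' by (subst emeasure_distr) (auto simp: emeasure_eq_measure)
    finally show "emeasure (distr M F (\<lambda>x. x)) A * emeasure (distr M borel Z) B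
      = emeasure (distr M (F \<Otimes>\<^sub>M borel) (\<lambda>x. (x, Z x))) (A \<times> B)" .
  next
    have "sets (distr M F (\<lambda>x. x) \<Otimes>\<^sub>M distr M borel Z) = sets (F \<Otimes>\<^sub>M borel)"
      by (rule sets_pair_measure_cong) simp_all
    then show "sets (distr M F (\<lambda>x. x) \<Otimes>\<^sub>M distr M borel Z) = sets (distr M (F \<Otimes>\<^sub>M borel) (\<lambda>x. (x, Z x)))" by simp
  qed (rule F.sigma_finite_measure_axioms, rule Z.sigma_finite_measure_axioms)
  have "(\<integral>\<^sup>+\<omega>. f (\<omega>, Z \<omega>) \<partial>M) = (\<integral>\<^sup>+y. f y \<partial>distr M (F \<Otimes>\<^sub>M borel) (\<lambda>x. (x, Z x)))"
    by (simp add: nn_integral_distr)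
  also have "\<dots> = (\<integral>\<^sup>+\<omega>. (\<integral>\<^sup>+z. f (\<omega>, z) \<partial>distr M borel Z) \<partial>distr M F (\<lambda>x. x))"
    unfolding eq[symmetric] by (rule Z.nn_integral_fst[symmetric]) simp
  also have "\<dots> = (\<integral>\<^sup>+\<omega>. (\<integral>\<^sup>+z. f (\<omega>, z) \<partial>distr M borel Z) \<partial>M)"
    using id by (intro nn_integral_distr) measurable
  finally show ?thesis .
qed

lemma nn_integral_indep_freeze_prod:
  fixes Z0 :: "'v \<Rightarrow> 'b::{second_countable_topology}" and Z1 :: "'w \<Rightarrow> 'c::{second_countable_topology}"
  assumes M0: "prob_space M0" and M1: "prob_space M1"
    and F0: "subalgebra M0 F0" and F1: "subalgebra M1 F1"
    and Z0 [measurable]: "Z0 \<in> borel_measurable M0" and Z1 [measurable]: "Z1 \<in> borel_measurable M1"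
    and ind0: "prob_space.indep_set M0 (sets F0) (sets (vimage_algebra (space M0) Z0 borel))"
    and ind1: "prob_space.indep_set M1 (sets F1) (sets (vimage_algebra (space M1) Z1 borel))"
    and f [measurable]: "f \<in> borel_measurable ((F0 \<Otimes>\<^sub>M F1) \<Otimes>\<^sub>M (borel \<Otimes>\<^sub>M borel))"
  shows "(\<integral>\<^sup>+\<omega>. f (\<omega>, (Z1 (snd \<omega>), Z0 (fst \<omega>))) \<partial>(M0 \<Otimes>\<^sub>M M1))
    = (\<integral>\<^sup>+\<omega>. (\<integral>\<^sup>+\<zeta>. f (\<omega>, \<zeta>) \<partial>(distr M1 borel Z1 \<Otimes>\<^sub>M distr M0 borel Z0)) \<partial>(M0 \<Otimes>\<^sub>M M1))"
proof -
  interpret M0: prob_space M0 by fact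
  interpret M1: prob_space M1 by fact
  interpret P: pair_prob_space M0 M1 ..
  define G0 where "G0 = distr M0 borel Z0"
  define G1 where "G1 = distr M1 borel Z1"
  have [measurable_cong]: "sets G0 = sets borel" "sets G1 = sets borel" by (auto simp: G0_def G1_def)
  interpret G0: prob_space G0 unfolding G0_def by (rule M0.prob_space_distr) simp
  interpret G1: prob_space G1 unfolding G1_def by (rule M1.prob_space_distr) simp
  interpret MG1: pair_prob_space M1 G1 ..
  interpret GG: pair_prob_space G1 G0 ..
  interpret MM: pair_sigma_finite M0 "M1 \<Otimes>\<^sub>M G1" ..
  note id0 = measurable_ident_subalgebra[OF F0] and id1 = measurable_ident_subalgebra[OF F1]
  have sp0: "space F0 = space M0" and sp1: "space F1 = space M1" using F0 F1 by (auto simp: subalgebra_def)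
  have idp: "(\<lambda>x. x) \<in> (M0 \<Otimes>\<^sub>M M1) \<Otimes>\<^sub>M (borel \<Otimes>\<^sub>M borel) \<rightarrow>\<^sub>M (F0 \<Otimes>\<^sub>M F1) \<Otimes>\<^sub>M (borel \<Otimes>\<^sub>M borel)"
  proof -
    have "(\<lambda>x. ((fst (fst x), snd (fst x)), snd x)) \<in> (M0 \<Otimes>\<^sub>M M1) \<Otimes>\<^sub>M (borel \<Otimes>\<^sub>M borel) \<rightarrow>\<^sub>M (F0 \<Otimes>\<^sub>M F1) \<Otimes>\<^sub>M (borel \<Otimes>\<^sub>M borel)"
      by (intro measurable_Pair measurable_compose[OF _ id0] measurable_compose[OF _ id1]) measurable
    then show ?thesis by simp
  qed
  have fM [measurable]: "f \<in> borel_measurable ((M0 \<Otimes>\<^sub>M M1) \<Otimes>\<^sub>M (borel \<Otimes>\<^sub>M borel))"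
    using measurable_compose[OF idp f] by simp
  have "(\<integral>\<^sup>+\<omega>. f (\<omega>, (Z1 (snd \<omega>), Z0 (fst \<omega>))) \<partial>(M0 \<Otimes>\<^sub>M M1))
      = (\<integral>\<^sup>+\<omega>0. (\<integral>\<^sup>+\<omega>1. f ((\<omega>0, \<omega>1), (Z1 \<omega>1, Z0 \<omega>0)) \<partial>M1) \<partial>M0)"
    by (subst M1.nn_integral_fst[symmetric]) auto
  also have "\<dots> = (\<integral>\<^sup>+\<omega>0. (\<integral>\<^sup>+\<omega>1. (\<integral>\<^sup>+z1. f ((\<omega>0, \<omega>1), (z1, Z0 \<omega>0)) \<partial>G1) \<partial>M1) \<partial>M0)"
  proof (rule nn_integral_cong)
    fix \<omega>0 assume "\<omega>0 \<in> space M0"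
    then have w: "\<omega>0 \<in> space F0" by (simp add: sp0)
    then have [measurable]: "(\<lambda>(\<omega>1, z1). f ((\<omega>0, \<omega>1), (z1, Z0 \<omega>0))) \<in> borel_measurable (F1 \<Otimes>\<^sub>M borel)"
      by measurable
    show "(\<integral>\<^sup>+\<omega>1. f ((\<omega>0, \<omega>1), (Z1 \<omega>1, Z0 \<omega>0)) \<partial>M1) = (\<integral>\<^sup>+\<omega>1. (\<integral>\<^sup>+z1. f ((\<omega>0, \<omega>1), (z1, Z0 \<omega>0)) \<partial>G1) \<partial>M1)"
      using M1.nn_integral_indep_freeze[OF F1 Z1 ind1, of "\<lambda>(\<omega>1, z1). f ((\<omega>0, \<omega>1), (z1, Z0 \<omega>0))"]
      by (simp add: G1_def)
  qed
  also have "\<dots> = (\<integral>\<^sup>+\<omega>0. (\<integral>\<^sup>+y. f ((\<omega>0, fst y), (snd y, Z0 \<omega>0)) \<partial>(M1 \<Otimes>\<^sub>M G1)) \<partial>M0)"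
    by (intro nn_integral_cong) (subst G1.nn_integral_fst[symmetric]; simp)
  \<comment> \<open>The integral over M0 is moved inside, so that Z0 can be frozen with the pair y
    held fixed.\<close>
  also have "\<dots> = (\<integral>\<^sup>+y. (\<integral>\<^sup>+\<omega>0. f ((\<omega>0, fst y), (snd y, Z0 \<omega>0)) \<partial>M0) \<partial>(M1 \<Otimes>\<^sub>M G1))"
    by (subst MM.Fubini') auto
  also have "\<dots> = (\<integral>\<^sup>+y. (\<integral>\<^sup>+\<omega>0. (\<integral>\<^sup>+z0. f ((\<omega>0, fst y), (snd y, z0)) \<partial>G0) \<partial>M0) \<partial>(M1 \<Otimes>\<^sub>M G1))"
  proof (rule nn_integral_cong)
    fix y assume "y \<in> space (M1 \<Otimes>\<^sub>M G1)"
    then have y: "fst y \<in> space F1" by (auto simp: space_pair_measure sp1)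
    then have [measurable]: "(\<lambda>(\<omega>0, z0). f ((\<omega>0, fst y), (snd y, z0))) \<in> borel_measurable (F0 \<Otimes>\<^sub>M borel)"
      by measurable
    show "(\<integral>\<^sup>+\<omega>0. f ((\<omega>0, fst y), (snd y, Z0 \<omega>0)) \<partial>M0) = (\<integral>\<^sup>+\<omega>0. (\<integral>\<^sup>+z0. f ((\<omega>0, fst y), (snd y, z0)) \<partial>G0) \<partial>M0)"
      using M0.nn_integral_indep_freeze[OF F0 Z0 ind0, of "\<lambda>(\<omega>0, z0). f ((\<omega>0, fst y), (snd y, z0))"]
      by (simp add: G0_def)
  qed
  also have "\<dots> = (\<integral>\<^sup>+\<omega>0. (\<integral>\<^sup>+y. (\<integral>\<^sup>+z0. f ((\<omega>0, fst y), (snd y, z0)) \<partial>G0) \<partial>(M1 \<Otimes>\<^sub>M G1)) \<partial>M0)"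
    by (subst MM.Fubini') auto
  also have "\<dots> = (\<integral>\<^sup>+\<omega>0. (\<integral>\<^sup>+\<omega>1. (\<integral>\<^sup>+z1. (\<integral>\<^sup>+z0. f ((\<omega>0, \<omega>1), (z1, z0)) \<partial>G0) \<partial>G1) \<partial>M1) \<partial>M0)"
    by (intro nn_integral_cong) (subst G1.nn_integral_fst[symmetric]; simp)
  also have "\<dots> = (\<integral>\<^sup>+\<omega>0. (\<integral>\<^sup>+\<omega>1. (\<integral>\<^sup>+\<zeta>. f ((\<omega>0, \<omega>1), \<zeta>) \<partial>(G1 \<Otimes>\<^sub>M G0)) \<partial>M1) \<partial>M0)"
    by (intro nn_integral_cong) (subst G0.nn_integral_fst[symmetric]; simp)
  also have "\<dots> = (\<integral>\<^sup>+\<omega>. (\<integral>\<^sup>+\<zeta>. f (\<omega>, \<zeta>) \<partial>(G1 \<Otimes>\<^sub>M G0)) \<partial>(M0 \<Otimes>\<^sub>M M1))"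
  proof -
    have "(\<lambda>\<omega>. \<integral>\<^sup>+\<zeta>. f (\<omega>, \<zeta>) \<partial>(G1 \<Otimes>\<^sub>M G0)) \<in> borel_measurable (M0 \<Otimes>\<^sub>M M1)"
      by (rule sigma_finite_measure.borel_measurable_nn_integral_fst[OF GG.P.sigma_finite_measure_axioms]) measurable
    then show ?thesis by (subst M1.nn_integral_fst[symmetric]) auto
  qed
  finally show ?thesis by (simp add: G0_def G1_def)
qed

text \<open>Doob's stopping argument without stopping times: the process that follows V until it
  reaches l and then stays at l has an expectation that grows by at most \<epsilon> per step. Before
  step k it is described by the event B k that l has not been reached, and this event depends only
  on V 0, ..., V k; so the step hypothesis concerns past events only.\<close>

lemma maximal_almost_supermartingale:
  fixes V :: "nat \<Rightarrow> 'a \<Rightarrow> ennreal"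
  assumes [measurable]: "\<And>k. V k \<in> borel_measurable M"
    and step: "\<And>k. k < K \<Longrightarrow> (\<integral>\<^sup>+\<omega>. V (Suc k) \<omega> * indicator {\<omega>\<in>space M. \<forall>j\<le>k. V j \<omega> < l} \<omega> \<partial>M)
      \<le> (\<integral>\<^sup>+\<omega>. V k \<omega> * indicator {\<omega>\<in>space M. \<forall>j\<le>k. V j \<omega> < l} \<omega> \<partial>M) + \<epsilon>"
  shows "l * emeasure M {\<omega>\<in>space M. \<exists>j\<le>K. l \<le> V j \<omega>} \<le> (\<integral>\<^sup>+\<omega>. V 0 \<omega> \<partial>M) + of_nat K * \<epsilon>"
proof -
  define B where "B k = {\<omega>\<in>space M. \<forall>j\<le>k. V j \<omega> < l}" for k
  define E where "E k = {\<omega>\<in>space M. \<exists>j\<le>k. l \<le> V j \<omega>}" for k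
  have [measurable]: "B k \<in> sets M" "E k \<in> sets M" for k unfolding B_def E_def by measurable
  have "(\<integral>\<^sup>+\<omega>. l * indicator (E k) \<omega> + V k \<omega> * indicator (B k) \<omega> \<partial>M) \<le> (\<integral>\<^sup>+\<omega>. V 0 \<omega> \<partial>M) + of_nat k * \<epsilon>"
    if "k \<le> K" for k
    using that
  proof (induction k)
    case 0
    show ?case by (simp, intro nn_integral_mono) (auto simp: E_def B_def indicator_def)
  next
    case (Suc k)
    have "(\<integral>\<^sup>+\<omega>. l * indicator (E (Suc k)) \<omega> + V (Suc k) \<omega> * indicator (B (Suc k)) \<omega> \<partial>M)
        \<le> (\<integral>\<^sup>+\<omega>. l * indicator (E k) \<omega> + V (Suc k) \<omega> * indicator (B k) \<omega> \<partial>M)"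
    proof (intro nn_integral_mono)
      fix \<omega> assume \<omega>: "\<omega> \<in> space M"
      show "l * indicator (E (Suc k)) \<omega> + V (Suc k) \<omega> * indicator (B (Suc k)) \<omega>
        \<le> l * indicator (E k) \<omega> + V (Suc k) \<omega> * indicator (B k) \<omega>"
      proof (cases "\<omega> \<in> E k")
        case True
        then have "\<omega> \<in> E (Suc k)" "\<omega> \<notin> B (Suc k)" by (auto simp: E_def B_def not_less intro: le_SucI)
        then show ?thesis using True by simp
      next
        case False
        then have nl: "\<forall>j\<le>k. V j \<omega> < l" by (intro allI impI ccontr[of "_ < l"]) (use \<omega> False in \<open>auto simp: E_def not_less\<close>)
        then have b: "\<omega> \<in> B k" using \<omega> by (simp add: B_def)
        show ?thesis
        proof (cases "l \<le> V (Suc k) \<omega>")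
          case True
          then have "\<omega> \<in> E (Suc k)" "\<omega> \<notin> B (Suc k)" using \<omega> by (auto simp: E_def B_def not_less)
          then show ?thesis using True False b by simp
        next
          case F: False
          then have "\<forall>j\<le>Suc k. V j \<omega> < l" using nl by (auto simp: le_Suc_eq)
          then have "\<omega> \<notin> E (Suc k)" "\<omega> \<in> B (Suc k)" using \<omega> by (auto simp: E_def B_def dest: leD)
          then show ?thesis using b by simp
        qed
      qed
    qed
    also have "\<dots> = (\<integral>\<^sup>+\<omega>. l * indicator (E k) \<omega> \<partial>M) + (\<integral>\<^sup>+\<omega>. V (Suc k) \<omega> * indicator (B k) \<omega> \<partial>M)"
      by (rule nn_integral_add) auto
    also have "\<dots> \<le> (\<integral>\<^sup>+\<omega>. l * indicator (E k) \<omega> \<partial>M) + ((\<integral>\<^sup>+\<omega>. V k \<omega> * indicator (B k) \<omega> \<partial>M) + \<epsilon>)"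
      using step[of k] Suc.prems unfolding B_def by (intro add_left_mono) simp
    also have "\<dots> = (\<integral>\<^sup>+\<omega>. l * indicator (E k) \<omega> + V k \<omega> * indicator (B k) \<omega> \<partial>M) + \<epsilon>"
      by (subst nn_integral_add) (auto simp: add.assoc)
    also have "\<dots> \<le> ((\<integral>\<^sup>+\<omega>. V 0 \<omega> \<partial>M) + of_nat k * \<epsilon>) + \<epsilon>"
      using Suc by (intro add_right_mono) simp
    finally show ?case by (simp add: algebra_simps)
  qed
  note main = this[OF order_refl]
  have "l * emeasure M (E K) = (\<integral>\<^sup>+\<omega>. l * indicator (E K) \<omega> \<partial>M)"
    by (simp add: nn_integral_cmult)
  also have "\<dots> \<le> (\<integral>\<^sup>+\<omega>. l * indicator (E K) \<omega> + V K \<omega> * indicator (B K) \<omega> \<partial>M)"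
    by (intro nn_integral_mono) simp
  finally show ?thesis using main unfolding E_def by (rule order_trans)
qed

text \<open>Decomposition by the first index at which l is reached. The terminal variable Y is
  separate from the sequence V, so that it can absorb the factor 2 of the Wiener estimate.\<close>

lemma maximal_submartingale:
  fixes V :: "nat \<Rightarrow> 'a \<Rightarrow> ennreal"
  assumes [measurable]: "\<And>k. V k \<in> borel_measurable M" "Y \<in> borel_measurable M"
    and sub: "\<And>k. k \<le> K \<Longrightarrow> (\<integral>\<^sup>+\<omega>. V k \<omega> * indicator {\<omega>\<in>space M. l \<le> V k \<omega> \<and> (\<forall>j<k. V j \<omega> < l)} \<omega> \<partial>M)
      \<le> (\<integral>\<^sup>+\<omega>. Y \<omega> * indicator {\<omega>\<in>space M. l \<le> V k \<omega> \<and> (\<forall>j<k. V j \<omega> < l)} \<omega> \<partial>M)"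
  shows "l * emeasure M {\<omega>\<in>space M. \<exists>j\<le>K. l \<le> V j \<omega>} \<le> (\<integral>\<^sup>+\<omega>. Y \<omega> \<partial>M)"
proof -
  define A where "A k = {\<omega>\<in>space M. l \<le> V k \<omega> \<and> (\<forall>j<k. V j \<omega> < l)}" for k
  define E where "E = {\<omega>\<in>space M. \<exists>j\<le>K. l \<le> V j \<omega>}"
  have [measurable]: "A k \<in> sets M" "E \<in> sets M" for k unfolding A_def E_def by measurable
  have E: "E = (\<Union>k\<in>{..K}. A k)"
  proof (intro equalityI subsetI)
    fix \<omega> assume "\<omega> \<in> E"
    then obtain j where j: "j \<le> K" "l \<le> V j \<omega>" and sp: "\<omega> \<in> space M" by (auto simp: E_def)
    define i where "i = (LEAST i. l \<le> V i \<omega>)"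
    have "l \<le> V i \<omega>" unfolding i_def using j(2) by (rule LeastI)
    moreover have "i \<le> j" unfolding i_def using j(2) by (rule Least_le)
    moreover have "V i' \<omega> < l" if "i' < i" for i' using not_less_Least[OF that[unfolded i_def]] by (simp add: not_le)
    ultimately show "\<omega> \<in> (\<Union>k\<in>{..K}. A k)" using j sp by (auto simp: A_def)
  qed (auto simp: A_def E_def)
  have disj: "disjoint_family_on A {..K}"
    unfolding disjoint_family_on_def A_def by (auto simp: not_less) (metis linorder_neqE_nat not_le)
  have ind: "indicator E \<omega> = (\<Sum>k\<le>K. indicator (A k) \<omega> :: ennreal)" for \<omega>
    unfolding E by (rule indicator_UN_disjoint[OF _ disj]) simp
  have "l * emeasure M E = (\<Sum>k\<le>K. \<integral>\<^sup>+\<omega>. l * indicator (A k) \<omega> \<partial>M)"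
    by (subst nn_integral_sum[symmetric]) (auto simp: sum_distrib_left[symmetric] ind[symmetric] nn_integral_cmult)
  also have "\<dots> \<le> (\<Sum>k\<le>K. \<integral>\<^sup>+\<omega>. V k \<omega> * indicator (A k) \<omega> \<partial>M)"
    by (intro sum_mono nn_integral_mono) (auto simp: A_def indicator_def)
  also have "\<dots> \<le> (\<Sum>k\<le>K. \<integral>\<^sup>+\<omega>. Y \<omega> * indicator (A k) \<omega> \<partial>M)"
    unfolding A_def by (intro sum_mono sub) simp
  also have "\<dots> = (\<integral>\<^sup>+\<omega>. Y \<omega> * indicator E \<omega> \<partial>M)"
    by (subst nn_integral_sum[symmetric]) (auto simp: sum_distrib_left[symmetric] ind[symmetric])
  also have "\<dots> \<le> (\<integral>\<^sup>+\<omega>. Y \<omega> \<partial>M)"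
    by (intro nn_integral_mono) (auto simp: indicator_def)
  finally show ?thesis by (simp add: E_def)
qed

text \<open>Summation over dyadic levels: a weak-type bound K / l makes level j contribute a
  multiple of 2^(\<delta> j) 2^(-j). The series converges because \<delta> < 1, and at \<delta> = 1
  it would diverge; this is where the exponent p0 itself is lost for the supremum inside the
  expectation.\<close>

lemma nn_integral_powr_le_of_tail:
  fixes Y :: "'a \<Rightarrow> real"
  assumes M: "prob_space M" and [measurable]: "Y \<in> borel_measurable M" and Y: "\<And>\<omega>. Y \<omega> \<ge> 0"
    and tail: "\<And>l. l > 0 \<Longrightarrow> ennreal l * emeasure M {\<omega>\<in>space M. l \<le> Y \<omega>} \<le> ennreal K"
    and d: "0 < \<delta>" "\<delta> < 1" and K: "K \<ge> 0"
  shows "(\<integral>\<^sup>+\<omega>. ennreal (Y \<omega> powr \<delta>) \<partial>M) \<le> ennreal (1 + K * (2 powr \<delta> / (1 - 2 powr (\<delta> - 1))))"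
proof -
  interpret prob_space M by fact
  define E where "E j = {\<omega>\<in>space M. 2 ^ j \<le> Y \<omega>}" for j :: nat
  have [measurable]: "E j \<in> sets M" for j unfolding E_def by measurable
  define q where "q = 2 powr (\<delta> - 1 :: real)"
  have q: "0 < q" "q < 1" using d powr_less_mono[of "\<delta> - 1" 0 2] by (auto simp: q_def)
  have pw: "ennreal (Y \<omega> powr \<delta>) \<le> 1 + (\<Sum>j. ennreal (2 powr \<delta> * 2 powr (\<delta> * real j)) * indicator (E j) \<omega>)"
    if "\<omega> \<in> space M" for \<omega>
  proof (cases "Y \<omega> < 1")
    case True
    then have "Y \<omega> powr \<delta> \<le> 1" using Y[of \<omega>] d by (intro powr_le1) auto
    then have "ennreal (Y \<omega> powr \<delta>) \<le> 1" by (simp add: ennreal_le_1)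
    then show ?thesis by (simp add: add_increasing2)
  next
    case False
    \<comment> \<open>The dyadic level of Y, with 2^j <= Y <= 2^(j + 1), so that a single term of
      the series already dominates Y^\<delta>.\<close>
    define j where "j = nat \<lfloor>log 2 (Y \<omega>)\<rfloor>"
    have lg: "log 2 (Y \<omega>) \<ge> 0" using False by simp
    have j: "real j \<le> log 2 (Y \<omega>)" "log 2 (Y \<omega>) \<le> real j + 1" unfolding j_def using lg by linarith+
    have "2 powr real j \<le> 2 powr log 2 (Y \<omega>)" using j by (intro powr_mono) auto
    then have j1: "2 ^ j \<le> Y \<omega>" using False by (simp add: powr_realpow)
    have "2 powr log 2 (Y \<omega>) \<le> 2 powr (real j + 1)" using j by (intro powr_mono) auto
    then have "Y \<omega> \<le> 2 powr (real j + 1)" using False by simp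
    then have "Y \<omega> powr \<delta> \<le> (2 powr (real j + 1)) powr \<delta>" using Y d by (intro powr_mono2) auto
    also have "\<dots> = 2 powr \<delta> * 2 powr (\<delta> * real j)" by (simp add: powr_powr powr_add[symmetric] algebra_simps)
    finally have "ennreal (Y \<omega> powr \<delta>) \<le> ennreal (2 powr \<delta> * 2 powr (\<delta> * real j)) * indicator (E j) \<omega>"
      using j1 that by (simp add: E_def ennreal_leI)
    also have "\<dots> \<le> (\<Sum>j. ennreal (2 powr \<delta> * 2 powr (\<delta> * real j)) * indicator (E j) \<omega>)"
    proof -
      define h where "h i = ennreal (2 powr \<delta> * 2 powr (\<delta> * real i)) * indicator (E i) \<omega>" for i
      have "h j \<le> suminf h" using sum_le_suminf[of h "{j}"] by simp
      then show ?thesis unfolding h_def .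
    qed
    finally show ?thesis by (simp add: add_increasing)
  qed
  have "(\<integral>\<^sup>+\<omega>. ennreal (Y \<omega> powr \<delta>) \<partial>M)
      \<le> (\<integral>\<^sup>+\<omega>. 1 + (\<Sum>j. ennreal (2 powr \<delta> * 2 powr (\<delta> * real j)) * indicator (E j) \<omega>) \<partial>M)"
    using pw by (rule nn_integral_mono)
  also have "\<dots> = 1 + (\<Sum>j. ennreal (2 powr \<delta> * 2 powr (\<delta> * real j)) * emeasure M (E j))"
    by (subst nn_integral_add) (auto simp: nn_integral_suminf nn_integral_cmult emeasure_space_1)
  also have "\<dots> \<le> 1 + (\<Sum>j. ennreal (K * 2 powr \<delta> * q ^ j))"
  proof (intro add_left_mono suminf_le)
    fix j
    \<comment> \<open>A factor 2^j is set aside for the tail hypothesis at l = 2^j; what remains is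
      geometric with ratio q < 1.\<close>
    have "2 powr (\<delta> * real j) = q ^ j * 2 ^ j"
      by (simp add: q_def powr_powr powr_realpow[symmetric] powr_add[symmetric] algebra_simps powr_power)
    then have "ennreal (2 powr \<delta> * 2 powr (\<delta> * real j)) * emeasure M (E j)
        = ennreal (2 powr \<delta> * q ^ j) * (ennreal (2 ^ j) * emeasure M (E j))"
      using q by (simp add: ennreal_mult[symmetric] mult.assoc[symmetric])
    also have "\<dots> \<le> ennreal (2 powr \<delta> * q ^ j) * ennreal K"
      unfolding E_def by (intro mult_left_mono tail) auto
    also have "\<dots> = ennreal (K * 2 powr \<delta> * q ^ j)"
      using q K by (simp add: ennreal_mult[symmetric] mult_ac)
    finally show "ennreal (2 powr \<delta> * 2 powr (\<delta> * real j)) * emeasure M (E j) \<le> ennreal (K * 2 powr \<delta> * q ^ j)" .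
  qed auto
  also have "(\<Sum>j. ennreal (K * 2 powr \<delta> * q ^ j)) = ennreal (K * 2 powr \<delta> * (1 / (1 - q)))"
  proof (rule suminf_ennreal_eq)
    show "(\<lambda>j. K * 2 powr \<delta> * q ^ j) sums (K * 2 powr \<delta> * (1 / (1 - q)))"
      using q by (intro sums_mult geometric_sums) simp
  qed (use K q in auto)
  finally show ?thesis using K q by (simp add: q_def ennreal_plus[symmetric] ennreal_1[symmetric] mult.assoc del: ennreal_plus ennreal_1)
qed

section \<open>Hilbert-Schmidt norms and the joint Gaussian noise of one step\<close>

lemma norm_vec_sq: "(norm (x :: 'a::real_inner ^ 'n))\<^sup>2 = (\<Sum>i\<in>UNIV. (norm (x $ i))\<^sup>2)"
  unfolding norm_vec_def L2_set_def by (simp add: sum_nonneg)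

lemma matrix_vector_inner: "(s *v z) $ i = s $ i \<bullet> (z :: real ^ 'm)"
  by (simp add: matrix_vector_mult_def inner_vec_def mult.commute)

lemma axis_vector_matrix_mult: "axis i 1 v* t = (t :: real ^ 'm ^ 'd) $ i"
  by (simp add: vec_eq_iff vector_matrix_mult_def axis_def if_distrib[of "\<lambda>y. y * _"] cong: if_cong)

lemma matrix_vector_mult_uminus: "s *v (- z) = - (s *v (z :: real ^ 'm))"
  by (simp add: matrix_vector_mult_def vec_eq_iff sum_negf)

text \<open>Cauchy-Schwarz row by row. By \<open>norm_vec_sq\<close> the norm of a nested vector is
  the Hilbert-Schmidt norm of the matrix.\<close>

lemma norm_matrix_vector_le: "norm (s *v z) \<le> norm s * norm (z :: real ^ 'm)"
  for s :: "real ^ 'm ^ 'd"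
proof (rule power2_le_imp_le)
  have "(norm (s *v z))\<^sup>2 = (\<Sum>i\<in>UNIV. (s $ i \<bullet> z)\<^sup>2)" by (simp add: norm_vec_sq matrix_vector_inner)
  also have "\<dots> \<le> (\<Sum>i\<in>UNIV. (norm (s $ i))\<^sup>2 * (norm z)\<^sup>2)"
    by (intro sum_mono) (metis Cauchy_Schwarz_ineq power2_norm_eq_inner)
  also have "\<dots> = (norm s * norm z)\<^sup>2" by (simp add: norm_vec_sq[of s] sum_distrib_right power_mult_distrib)
  finally show "(norm (s *v z))\<^sup>2 \<le> (norm s * norm z)\<^sup>2" .
qed simp

lemma norm_vector_matrix_le: "norm (a v* s) \<le> norm a * norm s"
  for s :: "real ^ 'm ^ 'd" and a :: "real ^ 'd"
proof (rule power2_le_imp_le)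
  have "(norm (a v* s))\<^sup>2 = (\<Sum>j\<in>UNIV. (a \<bullet> column j s)\<^sup>2)"
    by (simp add: norm_vec_sq vector_matrix_mult_def column_def inner_vec_def mult.commute)
  also have "\<dots> \<le> (\<Sum>j\<in>UNIV. (norm a)\<^sup>2 * (norm (column j s))\<^sup>2)"
    by (intro sum_mono) (metis Cauchy_Schwarz_ineq power2_norm_eq_inner)
  also have "\<dots> = (norm a)\<^sup>2 * (\<Sum>j\<in>UNIV. \<Sum>i\<in>UNIV. (s $ i $ j)\<^sup>2)"
    by (simp add: norm_vec_sq column_def sum_distrib_left)
  also have "(\<Sum>j\<in>UNIV. \<Sum>i\<in>UNIV. (s $ i $ j)\<^sup>2) = (norm s)\<^sup>2"
    by (subst sum.swap) (simp add: norm_vec_sq[of s] norm_vec_sq[of "s $ _"])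
  finally show "(norm (a v* s))\<^sup>2 \<le> (norm a * norm s)\<^sup>2" by (simp add: power_mult_distrib)
qed simp

text \<open>Flipping the sign of one factor removes the cross term.\<close>

lemma gaussian_pair_linear_square:
  fixes a :: "real ^ 'm" and a0 :: "real ^ 'm0"
  assumes h: "h > 0"
  shows "(\<integral>\<^sup>+z. ennreal ((a \<bullet> fst z + a0 \<bullet> snd z)\<^sup>2) \<partial>(gaussian h \<Otimes>\<^sub>M gaussian h))
    = ennreal (h * ((norm a)\<^sup>2 + (norm a0)\<^sup>2))"
proof -
  interpret G: prob_space "gaussian h :: (real ^ 'm) measure" by (rule prob_space_gaussian[OF h])
  interpret G0: prob_space "gaussian h :: (real ^ 'm0) measure" by (rule prob_space_gaussian[OF h])
  have n: "(\<integral>\<^sup>+z. ennreal ((a \<bullet> z)\<^sup>2) \<partial>gaussian h) = ennreal (h * (norm a)\<^sup>2)"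
    by (subst nn_integral_eq_integral) (auto simp: gaussian_linear_square[OF h])
  have n0: "(\<integral>\<^sup>+z. ennreal ((a0 \<bullet> z)\<^sup>2) \<partial>gaussian h) = ennreal (h * (norm a0)\<^sup>2)"
    by (subst nn_integral_eq_integral) (auto simp: gaussian_linear_square[OF h])
  have inner: "2 * (\<integral>\<^sup>+z0. ennreal ((u + a0 \<bullet> z0)\<^sup>2) \<partial>gaussian h) = 2 * (ennreal (u\<^sup>2) + ennreal (h * (norm a0)\<^sup>2))" for u
  proof -
    have "2 * (\<integral>\<^sup>+z0. ennreal ((u + a0 \<bullet> z0)\<^sup>2) \<partial>gaussian h)
        = (\<integral>\<^sup>+z0. ennreal ((u + a0 \<bullet> z0)\<^sup>2) \<partial>gaussian h) + (\<integral>\<^sup>+z0. ennreal ((u + a0 \<bullet> - z0)\<^sup>2) \<partial>gaussian h)"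
      using gaussian_uminus[of "\<lambda>z0. ennreal ((u + a0 \<bullet> z0)\<^sup>2)" h] by (simp add: mult_2)
    also have "\<dots> = (\<integral>\<^sup>+z0. 2 * (ennreal (u\<^sup>2) + ennreal ((a0 \<bullet> z0)\<^sup>2)) \<partial>gaussian h)"
    proof (subst nn_integral_add[symmetric])
      show "(\<integral>\<^sup>+z0. ennreal ((u + a0 \<bullet> z0)\<^sup>2) + ennreal ((u + a0 \<bullet> - z0)\<^sup>2) \<partial>gaussian h)
          = (\<integral>\<^sup>+z0. 2 * (ennreal (u\<^sup>2) + ennreal ((a0 \<bullet> z0)\<^sup>2)) \<partial>gaussian h)"
      proof (rule nn_integral_cong)
        fix z0
        have "ennreal ((u + a0 \<bullet> z0)\<^sup>2) + ennreal ((u + a0 \<bullet> - z0)\<^sup>2) = ennreal ((u + a0 \<bullet> z0)\<^sup>2 + (u + a0 \<bullet> - z0)\<^sup>2)"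
          by (rule ennreal_plus[symmetric]) auto
        also have "(u + a0 \<bullet> z0)\<^sup>2 + (u + a0 \<bullet> - z0)\<^sup>2 = (u\<^sup>2 + (a0 \<bullet> z0)\<^sup>2) + (u\<^sup>2 + (a0 \<bullet> z0)\<^sup>2)"
          by (simp add: power2_eq_square algebra_simps)
        also have "ennreal \<dots> = 2 * (ennreal (u\<^sup>2) + ennreal ((a0 \<bullet> z0)\<^sup>2))"
          unfolding mult_2 by (simp only: ennreal_plus zero_le_power2 add_nonneg_nonneg)
        finally show "ennreal ((u + a0 \<bullet> z0)\<^sup>2) + ennreal ((u + a0 \<bullet> - z0)\<^sup>2) = 2 * (ennreal (u\<^sup>2) + ennreal ((a0 \<bullet> z0)\<^sup>2))" .
      qed
    qed auto
    also have "\<dots> = 2 * (ennreal (u\<^sup>2) + ennreal (h * (norm a0)\<^sup>2))"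
      by (simp add: nn_integral_cmult nn_integral_add n0 G0.emeasure_space_1[simplified])
    finally show ?thesis .
  qed
  have inner': "(\<integral>\<^sup>+z0. ennreal ((u + a0 \<bullet> z0)\<^sup>2) \<partial>gaussian h) = ennreal (u\<^sup>2) + ennreal (h * (norm a0)\<^sup>2)" for u
    using inner[of u] by (subst (asm) ennreal_mult_cancel_left) auto
  have "(\<integral>\<^sup>+z. ennreal ((a \<bullet> fst z + a0 \<bullet> snd z)\<^sup>2) \<partial>(gaussian h \<Otimes>\<^sub>M gaussian h))
      = (\<integral>\<^sup>+z. \<integral>\<^sup>+z0. ennreal ((a \<bullet> z + a0 \<bullet> z0)\<^sup>2) \<partial>gaussian h \<partial>gaussian h)"
    by (subst G0.nn_integral_fst[symmetric]) auto
  also have "\<dots> = ennreal (h * (norm a)\<^sup>2) + ennreal (h * (norm a0)\<^sup>2)"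
    by (simp add: inner' nn_integral_add n G.emeasure_space_1[simplified])
  also have "\<dots> = ennreal (h * ((norm a)\<^sup>2 + (norm a0)\<^sup>2))"
    using h by (simp add: ennreal_plus[symmetric] distrib_left del: ennreal_plus)
  finally show ?thesis .
qed

text \<open>Joins the common and the individual noise into one symmetric variable. The sequence c is
  fixed before h, s and s0, which is what makes the later constants uniform in n, in time and in the
  state.\<close>

lemma gaussian_symmetric_noise:
  obtains c :: "nat \<Rightarrow> real" where "\<And>k. c k \<ge> 0"
    "\<And>h (s :: real ^ 'm ^ 'd) (s0 :: real ^ 'm0 ^ 'd). h > 0 \<Longrightarrow>
      symmetric_noise (gaussian h \<Otimes>\<^sub>M gaussian h) (\<lambda>z. s *v fst z + s0 *v snd z)
        (h * ((norm s)\<^sup>2 + (norm s0)\<^sup>2)) c"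
proof -
  have "\<forall>k. \<exists>C\<ge>1. \<forall>h>0. (\<integral>\<^sup>+x. ennreal (norm x ^ (2 * k)) \<partial>(gaussian h :: (real ^ 'm) measure)) \<le> ennreal (C * h ^ k)"
    using gaussian_norm_moment_exists by blast
  then obtain d where d: "\<And>k. d k \<ge> 1" and
    dm: "\<And>k h. h > 0 \<Longrightarrow> (\<integral>\<^sup>+x. ennreal (norm x ^ (2 * k)) \<partial>(gaussian h :: (real ^ 'm) measure)) \<le> ennreal (d k * h ^ k)"
    by metis
  have "\<forall>k. \<exists>C\<ge>1. \<forall>h>0. (\<integral>\<^sup>+x. ennreal (norm x ^ (2 * k)) \<partial>(gaussian h :: (real ^ 'm0) measure)) \<le> ennreal (C * h ^ k)"
    using gaussian_norm_moment_exists by blast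
  then obtain d0 where d0: "\<And>k. d0 k \<ge> 1" and
    dm0: "\<And>k h. h > 0 \<Longrightarrow> (\<integral>\<^sup>+x. ennreal (norm x ^ (2 * k)) \<partial>(gaussian h :: (real ^ 'm0) measure)) \<le> ennreal (d0 k * h ^ k)"
    by metis
  define c where "c k = 4 ^ k * (d k + d0 k)" for k
  have c: "c k \<ge> 0" for k using d[of k] d0[of k] by (simp add: c_def)
  show ?thesis
  proof (rule that[OF c])
    fix h :: real and s :: "real ^ 'm ^ 'd" and s0 :: "real ^ 'm0 ^ 'd"
    assume h: "h > 0"
    interpret G: prob_space "gaussian h :: (real ^ 'm) measure" by (rule prob_space_gaussian[OF h])
    interpret G0: prob_space "gaussian h :: (real ^ 'm0) measure" by (rule prob_space_gaussian[OF h])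
    interpret P: pair_prob_space "gaussian h :: (real ^ 'm) measure" "gaussian h :: (real ^ 'm0) measure" ..
    define Q where "Q = (gaussian h :: (real ^ 'm) measure) \<Otimes>\<^sub>M (gaussian h :: (real ^ 'm0) measure)"
    define N where "N z = s *v fst z + s0 *v snd z" for z
    define g where "g = h * ((norm s)\<^sup>2 + (norm s0)\<^sup>2)"
    have ms [measurable]: "(\<lambda>z. s *v z) \<in> borel_measurable borel" "(\<lambda>z. s0 *v z) \<in> borel_measurable borel"
      by (intro borel_measurable_continuous_onI continuous_intros)+
    have [measurable]: "N \<in> borel_measurable Q" unfolding N_def Q_def by measurable
    have in_eq: "(x \<bullet> N z)\<^sup>2 = ((x v* s) \<bullet> fst z + (x v* s0) \<bullet> snd z)\<^sup>2" for x z
      by (simp add: N_def inner_add_right dot_lmul_matrix)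
    have lin: "(\<integral>\<^sup>+z. ennreal ((x \<bullet> N z)\<^sup>2) \<partial>Q) = ennreal (h * ((norm (x v* s))\<^sup>2 + (norm (x v* s0))\<^sup>2))" for x
      unfolding in_eq Q_def by (rule gaussian_pair_linear_square[OF h])
    have "symmetric_noise Q N g c"
    proof (intro symmetric_noise.intro symmetric_noise_axioms.intro)
      show "prob_space Q" unfolding Q_def by (rule P.P.prob_space_axioms)
      show "N \<in> borel_measurable Q" by measurable
      show "0 \<le> g" using h by (simp add: g_def)
      show "0 \<le> c k" for k by (rule c)
      fix f :: "real ^ 'd \<Rightarrow> ennreal" assume [measurable]: "f \<in> borel_measurable borel"
      have "(\<integral>\<^sup>+z. f (N z) \<partial>Q) = (\<integral>\<^sup>+z. \<integral>\<^sup>+z0. f (s *v z + s0 *v z0) \<partial>gaussian h \<partial>gaussian h)"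
        unfolding Q_def N_def by (subst G0.nn_integral_fst[symmetric]) auto
      \<comment> \<open>Joint symmetry by two flips, one for each independent factor.\<close>
      also have "\<dots> = (\<integral>\<^sup>+z. \<integral>\<^sup>+z0. f (s *v z + s0 *v (- z0)) \<partial>gaussian h \<partial>gaussian h)"
        by (intro nn_integral_cong gaussian_uminus[symmetric]) measurable
      also have "\<dots> = (\<integral>\<^sup>+z. \<integral>\<^sup>+z0. f (s *v (- z) + s0 *v (- z0)) \<partial>gaussian h \<partial>gaussian h)"
        by (rule gaussian_uminus[symmetric]) measurable
      also have "\<dots> = (\<integral>\<^sup>+z. f (- N z) \<partial>Q)"
        unfolding Q_def N_def
        by (subst G0.nn_integral_fst[symmetric]) (auto simp: matrix_vector_mult_uminus)
      finally show "(\<integral>\<^sup>+z. f (N z) \<partial>Q) = (\<integral>\<^sup>+z. f (- N z) \<partial>Q)" .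
    next
      \<comment> \<open>Testing \<open>lin\<close> with the coordinate vectors picks out the rows of
        s and s0, whose squared norms add up to the Hilbert-Schmidt norms.\<close>
      have "(\<integral>\<^sup>+z. ennreal ((norm (N z))\<^sup>2) \<partial>Q) = (\<integral>\<^sup>+z. (\<Sum>i\<in>UNIV. ennreal ((axis i 1 \<bullet> N z)\<^sup>2)) \<partial>Q)"
        by (intro nn_integral_cong) (simp add: norm_vec_sq inner_axis')
      also have "\<dots> = (\<Sum>i\<in>UNIV. ennreal (h * ((norm (s $ i))\<^sup>2 + (norm (s0 $ i))\<^sup>2)))"
      proof (subst nn_integral_sum)
        show "(\<Sum>i\<in>UNIV. \<integral>\<^sup>+z. ennreal ((axis i 1 \<bullet> N z)\<^sup>2) \<partial>Q)
            = (\<Sum>i\<in>UNIV. ennreal (h * ((norm (s $ i))\<^sup>2 + (norm (s0 $ i))\<^sup>2)))"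
          unfolding lin axis_vector_matrix_mult by simp
      qed measurable
      also have "\<dots> = ennreal g"
        using h by (simp add: sum_nonneg g_def norm_vec_sq[of s] norm_vec_sq[of s0] sum_distrib_left distrib_left sum.distrib)
      finally show "(\<integral>\<^sup>+z. ennreal ((norm (N z))\<^sup>2) \<partial>Q) \<le> ennreal g" by simp
    next
      fix x
      have "(norm (x v* s))\<^sup>2 \<le> (norm x * norm s)\<^sup>2" "(norm (x v* s0))\<^sup>2 \<le> (norm x * norm s0)\<^sup>2"
        by (intro power_mono norm_vector_matrix_le norm_ge_zero)+
      then have "h * ((norm (x v* s))\<^sup>2 + (norm (x v* s0))\<^sup>2) \<le> h * ((norm x * norm s)\<^sup>2 + (norm x * norm s0)\<^sup>2)"
        using h by (intro mult_left_mono add_mono) auto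
      also have "\<dots> = (norm x)\<^sup>2 * g" by (simp add: g_def power_mult_distrib algebra_simps)
      finally show "(\<integral>\<^sup>+z. ennreal ((x \<bullet> N z)\<^sup>2) \<partial>Q) \<le> ennreal ((norm x)\<^sup>2 * g)"
        unfolding lin by (rule ennreal_leI)
    next
      fix k
      \<comment> \<open>The factor 4^k is 2^(2k), from |N| <= 2 M with M the larger of the two
        contributions.\<close>
      have pw: "norm (N z) ^ (2 * k) \<le> (4 ^ k * norm s ^ (2 * k)) * norm (fst z) ^ (2 * k) + (4 ^ k * norm s0 ^ (2 * k)) * norm (snd z) ^ (2 * k)" for z
      proof -
        define M where "M = max (norm s * norm (fst z)) (norm s0 * norm (snd z))"
        have M: "norm s * norm (fst z) \<le> M" "norm s0 * norm (snd z) \<le> M"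
          "M = norm s * norm (fst z) \<or> M = norm s0 * norm (snd z)" by (auto simp: M_def max_def)
        have "norm (N z) \<le> norm (s *v fst z) + norm (s0 *v snd z)" unfolding N_def by (rule norm_triangle_ineq)
        also have "\<dots> \<le> norm s * norm (fst z) + norm s0 * norm (snd z)" by (intro add_mono norm_matrix_vector_le)
        finally have "norm (N z) \<le> 2 * M" using M by linarith
        then have "norm (N z) ^ (2 * k) \<le> (2 * M) ^ (2 * k)" by (intro power_mono) auto
        also have "\<dots> = 4 ^ k * M ^ (2 * k)" by (simp add: power_mult_distrib power_mult)
        also have "\<dots> \<le> 4 ^ k * ((norm s * norm (fst z)) ^ (2 * k) + (norm s0 * norm (snd z)) ^ (2 * k))"
          using M(3) by (intro mult_left_mono) (auto intro: add_increasing add_increasing2)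
        finally show ?thesis by (simp add: power_mult_distrib algebra_simps)
      qed
      have f1: "(\<integral>\<^sup>+z. ennreal (norm (fst z) ^ (2 * k)) \<partial>Q) = (\<integral>\<^sup>+z. ennreal (norm z ^ (2 * k)) \<partial>(gaussian h :: (real ^ 'm) measure))"
        unfolding Q_def by (subst G0.nn_integral_fst[symmetric]) (auto simp: G0.emeasure_space_1[simplified])
      have f2: "(\<integral>\<^sup>+z. ennreal (norm (snd z) ^ (2 * k)) \<partial>Q) = (\<integral>\<^sup>+z. ennreal (norm z ^ (2 * k)) \<partial>(gaussian h :: (real ^ 'm0) measure))"
        unfolding Q_def by (subst G0.nn_integral_fst[symmetric]) (auto simp: G.emeasure_space_1[simplified])
      have [measurable]: "fst \<in> Q \<rightarrow>\<^sub>M borel" "snd \<in> Q \<rightarrow>\<^sub>M borel" unfolding Q_def by measurable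
      have "(\<integral>\<^sup>+z. ennreal (norm (N z) ^ (2 * k)) \<partial>Q)
          \<le> (\<integral>\<^sup>+z. ennreal (4 ^ k * norm s ^ (2 * k)) * ennreal (norm (fst z) ^ (2 * k))
             + ennreal (4 ^ k * norm s0 ^ (2 * k)) * ennreal (norm (snd z) ^ (2 * k)) \<partial>Q)"
        using pw by (intro nn_integral_mono) (auto simp: ennreal_mult[symmetric] ennreal_plus[symmetric] simp del: ennreal_plus intro!: ennreal_leI)
      also have "\<dots> = ennreal (4 ^ k * norm s ^ (2 * k)) * (\<integral>\<^sup>+z. ennreal (norm (fst z) ^ (2 * k)) \<partial>Q)
             + ennreal (4 ^ k * norm s0 ^ (2 * k)) * (\<integral>\<^sup>+z. ennreal (norm (snd z) ^ (2 * k)) \<partial>Q)"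
        by (simp add: nn_integral_add nn_integral_cmult)
      also have "\<dots> \<le> ennreal (4 ^ k * norm s ^ (2 * k)) * ennreal (d k * h ^ k)
             + ennreal (4 ^ k * norm s0 ^ (2 * k)) * ennreal (d0 k * h ^ k)"
        unfolding f1 f2 using h by (intro add_mono mult_left_mono dm dm0) auto
      also have "\<dots> = ennreal (4 ^ k * norm s ^ (2 * k) * (d k * h ^ k) + 4 ^ k * norm s0 ^ (2 * k) * (d0 k * h ^ k))"
        using d[of k] d0[of k] h by (simp add: ennreal_mult[symmetric] ennreal_plus[symmetric] del: ennreal_plus)
      also have "\<dots> \<le> ennreal (c k * g ^ k)"
      proof (rule ennreal_leI)
        have "(h * (norm s)\<^sup>2) ^ k \<le> g ^ k" "(h * (norm s0)\<^sup>2) ^ k \<le> g ^ k"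
          using h by (auto intro!: power_mono simp: g_def)
        then have "4 ^ k * d k * (h * (norm s)\<^sup>2) ^ k + 4 ^ k * d0 k * (h * (norm s0)\<^sup>2) ^ k \<le> 4 ^ k * d k * g ^ k + 4 ^ k * d0 k * g ^ k"
          using d[of k] d0[of k] by (intro add_mono mult_left_mono) auto
        then show "4 ^ k * norm s ^ (2 * k) * (d k * h ^ k) + 4 ^ k * norm s0 ^ (2 * k) * (d0 k * h ^ k) \<le> c k * g ^ k"
          by (simp add: c_def power_mult_distrib algebra_simps flip: power_mult)
      qed
      finally show "(\<integral>\<^sup>+z. ennreal (norm (N z) ^ (2 * k)) \<partial>Q) \<le> ennreal (c k * g ^ k)" .
    qed
    then show "symmetric_noise (gaussian h \<Otimes>\<^sub>M gaussian h) (\<lambda>z. s *v fst z + s0 *v snd z)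
        (h * ((norm s)\<^sup>2 + (norm s0)\<^sup>2)) c"
      by (simp add: Q_def N_def[abs_def] g_def)
  qed
qed

section \<open>Oscillation of Wiener processes\<close>

lemma usual_filtration_subalgebra: "usual_filtration T M F \<Longrightarrow> t \<in> {0..T} \<Longrightarrow> subalgebra M (F t)"
  by (simp add: usual_filtration_def)

lemma measurable_mono_subalgebra:
  assumes "f \<in> F \<rightarrow>\<^sub>M N" "space G = space F" "sets F \<subseteq> sets G"
  shows "f \<in> G \<rightarrow>\<^sub>M N"
  using assms by (auto simp: measurable_def)

lemma usual_filtration_mono:
  assumes F: "usual_filtration T M F" and st: "0 \<le> s" "s \<le> t" "t \<le> T" and f: "f \<in> F s \<rightarrow>\<^sub>M N"
  shows "f \<in> F t \<rightarrow>\<^sub>M N"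
proof (rule measurable_mono_subalgebra[OF f])
  have "subalgebra M (F s)" "subalgebra M (F t)" using F st by (auto simp: usual_filtration_def)
  then show "space (F t) = space (F s)" by (simp add: subalgebra_def)
  show "sets (F s) \<subseteq> sets (F t)" using F st unfolding usual_filtration_def by auto
qed

lemma usual_filtration_measurable:
  assumes "usual_filtration T M F" "t \<in> {0..T}" "f \<in> F t \<rightarrow>\<^sub>M N"
  shows "f \<in> M \<rightarrow>\<^sub>M N"
  using assms usual_filtration_subalgebra[OF assms(1,2)]
  by (intro measurable_mono_subalgebra[OF assms(3)]) (auto simp: subalgebra_def)

context
  fixes T :: real and M :: "'w measure" and F :: "real \<Rightarrow> 'w measure" and W :: "real \<Rightarrow> 'w \<Rightarrow> real ^ 'm"
  assumes M: "prob_space M" and F: "usual_filtration T M F" and W: "wiener_process T M F W"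
begin

lemma wiener_measurable:
  assumes "0 \<le> s" "s \<le> t" "t \<le> T"
  shows "W s \<in> borel_measurable (F t)"
proof -
  have "W s \<in> borel_measurable (F s)" using W assms by (auto simp: wiener_process_def)
  then show ?thesis using usual_filtration_mono[OF F] assms by blast
qed

lemma wiener_measurable': "t \<in> {0..T} \<Longrightarrow> W t \<in> borel_measurable M"
  using wiener_measurable[of t t] usual_filtration_measurable[OF F] by auto

lemma wiener_increment_law:
  assumes "0 \<le> s" "s < t" "t \<le> T"
  shows "distr M borel (\<lambda>\<omega>. W t \<omega> - W s \<omega>) = gaussian (t - s)"
proof -
  have "distributed M lborel (\<lambda>\<omega>. W t \<omega> - W s \<omega>)
          (\<lambda>x. ennreal (\<Prod>k\<in>UNIV. normal_density 0 (sqrt (t - s)) (x $ k)))"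
    using W assms by (auto simp: wiener_process_def)
  from distributed_distr_eq_density[OF this] show ?thesis
    unfolding gaussian_def by (simp cong: distr_cong)
qed

lemma wiener_increment_indep:
  assumes "0 \<le> s" "s < t" "t \<le> T"
  shows "prob_space.indep_set M (sets (F s)) (sets (vimage_algebra (space M) (\<lambda>\<omega>. W t \<omega> - W s \<omega>) borel))"
  using W assms by (auto simp: wiener_process_def)

lemma wiener_increment_moment:
  assumes "0 \<le> s" "s < t" "t \<le> T" and [measurable]: "f \<in> borel_measurable borel"
  shows "(\<integral>\<^sup>+\<omega>. f (W t \<omega> - W s \<omega>) \<partial>M) = (\<integral>\<^sup>+z. f z \<partial>gaussian (t - s))"
proof -
  have [measurable]: "W s \<in> borel_measurable M" "W t \<in> borel_measurable M"
    using assms by (auto intro!: wiener_measurable')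
  show ?thesis unfolding wiener_increment_law[OF assms(1-3), symmetric] by (simp add: nn_integral_distr)
qed

text \<open>The factor 2 avoids conditional Jensen: by symmetry of the increment \<open>z\<close>,
  \<open>|a|\<^sup>k \<le> |a + z|\<^sup>k + |a - z|\<^sup>k\<close> suffices.\<close>

lemma wiener_submartingale:
  assumes st: "0 \<le> s" "s \<le> u" "u \<le> t" "t \<le> T" and A: "A \<in> sets (F u)"
  shows "(\<integral>\<^sup>+\<omega>. ennreal (norm (W u \<omega> - W s \<omega>) ^ k) * indicator A \<omega> \<partial>M)
    \<le> 2 * (\<integral>\<^sup>+\<omega>. ennreal (norm (W t \<omega> - W s \<omega>) ^ k) * indicator A \<omega> \<partial>M)"
proof (cases "u = t")
  case True
  then show ?thesis by (simp add: mult_2)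
next
  case False
  then have ut: "u < t" using st by simp
  interpret prob_space M by (rule M)
  have [measurable]: "A \<in> sets (F u)" by (rule A)
  have [measurable]: "W u \<in> borel_measurable (F u)" "W s \<in> borel_measurable (F u)"
    using wiener_measurable st by auto
  have sub: "subalgebra M (F u)" using st by (intro usual_filtration_subalgebra[OF F]) auto
  define Z where "Z = (\<lambda>\<omega>. W t \<omega> - W u \<omega>)"
  have [measurable]: "Z \<in> borel_measurable M"
    unfolding Z_def using st by (intro borel_measurable_diff wiener_measurable') auto
  have ind: "indep_set (sets (F u)) (sets (vimage_algebra (space M) Z borel))"
    unfolding Z_def using wiener_increment_indep st ut by auto
  have law: "distr M borel Z = gaussian (t - u)" unfolding Z_def using wiener_increment_law st ut by auto
  interpret G: prob_space "gaussian (t - u) :: (real ^ 'm) measure" using ut by (intro prob_space_gaussian) simp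
  define f where "f = (\<lambda>(\<omega>, z). ennreal (norm (W u \<omega> - W s \<omega> + z) ^ k) * indicator A \<omega>)"
  have [measurable]: "f \<in> borel_measurable (F u \<Otimes>\<^sub>M borel)" unfolding f_def by measurable
  have pw: "norm a ^ k \<le> norm (a + z) ^ k + norm (a + - z) ^ k" for a z :: "real ^ 'm"
  proof -
    have "norm ((a + z) + (a - z)) \<le> norm (a + z) + norm (a - z)" by (rule norm_triangle_ineq)
    moreover have "(a + z) + (a - z) = 2 *\<^sub>R a" by (simp add: scaleR_2)
    ultimately have "norm a \<le> norm (a + z) \<or> norm a \<le> norm (a - z)" by auto
    then have "norm a ^ k \<le> norm (a + z) ^ k \<or> norm a ^ k \<le> norm (a - z) ^ k" by (auto intro: power_mono)
    then show ?thesis by (auto intro: add_increasing add_increasing2)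
  qed
  have "(\<integral>\<^sup>+\<omega>. ennreal (norm (W u \<omega> - W s \<omega>) ^ k) * indicator A \<omega> \<partial>M)
      \<le> (\<integral>\<^sup>+\<omega>. 2 * (\<integral>\<^sup>+z. f (\<omega>, z) \<partial>gaussian (t - u)) \<partial>M)"
  proof (rule nn_integral_mono)
    fix \<omega>
    let ?a = "W u \<omega> - W s \<omega>"
    have "2 * (\<integral>\<^sup>+z. ennreal (norm (?a + z) ^ k) \<partial>gaussian (t - u))
       = (\<integral>\<^sup>+z. ennreal (norm (?a + z) ^ k) \<partial>gaussian (t - u)) + (\<integral>\<^sup>+z. ennreal (norm (?a + - z) ^ k) \<partial>gaussian (t - u))"
      using gaussian_uminus[of "\<lambda>z. ennreal (norm (?a + z) ^ k)" "t - u"] by (simp add: mult_2)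
    also have "\<dots> = (\<integral>\<^sup>+z. ennreal (norm (?a + z) ^ k) + ennreal (norm (?a + - z) ^ k) \<partial>gaussian (t - u))"
      by (rule nn_integral_add[symmetric]) auto
    also have "\<dots> \<ge> (\<integral>\<^sup>+z. ennreal (norm ?a ^ k) \<partial>(gaussian (t - u) :: (real ^ 'm) measure))"
      using pw by (intro nn_integral_mono) (auto simp: ennreal_plus[symmetric] simp del: ennreal_plus intro!: ennreal_leI)
    finally have "ennreal (norm ?a ^ k) \<le> 2 * (\<integral>\<^sup>+z. ennreal (norm (?a + z) ^ k) \<partial>gaussian (t - u))"
      using G.emeasure_space_1 by simp
    then show "ennreal (norm ?a ^ k) * indicator A \<omega> \<le> 2 * (\<integral>\<^sup>+z. f (\<omega>, z) \<partial>gaussian (t - u))"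
      by (auto simp: f_def indicator_def)
  qed
  also have "\<dots> = 2 * (\<integral>\<^sup>+\<omega>. (\<integral>\<^sup>+z. f (\<omega>, z) \<partial>gaussian (t - u)) \<partial>M)"
  proof (rule nn_integral_cmult)
    have "(\<lambda>\<omega>. \<integral>\<^sup>+z. f (\<omega>, z) \<partial>gaussian (t - u)) \<in> borel_measurable (F u)" by measurable
    then show "(\<lambda>\<omega>. \<integral>\<^sup>+z. f (\<omega>, z) \<partial>gaussian (t - u)) \<in> borel_measurable M"
      by (rule usual_filtration_measurable[OF F, rotated]) (use st in auto)
  qed
  also have "(\<integral>\<^sup>+\<omega>. (\<integral>\<^sup>+z. f (\<omega>, z) \<partial>gaussian (t - u)) \<partial>M) = (\<integral>\<^sup>+\<omega>. f (\<omega>, Z \<omega>) \<partial>M)"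
    using nn_integral_indep_freeze[OF sub _ ind, of f] by (simp add: law)
  also have "\<dots> = (\<integral>\<^sup>+\<omega>. ennreal (norm (W t \<omega> - W s \<omega>) ^ k) * indicator A \<omega> \<partial>M)"
    by (simp add: f_def Z_def algebra_simps)
  finally show ?thesis .
qed

text \<open>The weak-type inequality is applied to the power 4m and then integrated with \<delta> =
  1/2, which yields the power 2m of the maximum without the strong form of Doob's inequality.
  Dividing by h^(2m) first gives the scaling (t - s)^m, and the constant does not depend on the
  number K of grid points. The 2 in front of C is the factor of
  \<open>wiener_submartingale\<close>.\<close>

lemma wiener_grid_maximum:
  assumes st: "0 \<le> s" "s < t" "t \<le> T" and K: "K \<ge> 1"
    and C: "C \<ge> 0" "(\<integral>\<^sup>+z. ennreal (norm z ^ (2 * (2 * m))) \<partial>(gaussian (t - s) :: (real ^ 'm) measure)) \<le> ennreal (C * (t - s) ^ (2 * m))"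
  shows "(\<integral>\<^sup>+\<omega>. ennreal (Max ((\<lambda>j. norm (W (s + (t - s) * (real j / real K)) \<omega> - W s \<omega>) ^ (2 * m)) ` {..K})) \<partial>M)
    \<le> ennreal ((1 + 2 * C * (2 powr (1/2) / (1 - 2 powr (1/2 - 1)))) * (t - s) ^ m)"
proof -
  define h where "h = t - s"
  have h: "h > 0" using st by (simp add: h_def)
  define u where "u j = s + h * (real j / real K)" for j
  have u0: "u j \<ge> s" for j using h by (simp add: u_def)
  have u1: "u j \<le> t" if "j \<le> K" for j
  proof -
    have "h * (real j / real K) \<le> h * 1" using h that K by (intro mult_left_mono) auto
    then show ?thesis by (simp add: u_def h_def)
  qed
  have u2: "u i \<le> u j" if "i \<le> j" for i j using h that by (auto simp: u_def divide_right_mono)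
  have uK: "u K = t" using K by (simp add: u_def h_def)
  \<comment> \<open>The index is capped at K because the maximal inequality asks for measurable
    functions at every natural number.\<close>
  define S where "S j \<omega> = norm (W (u (min j K)) \<omega> - W s \<omega>) ^ (2 * (2 * m))" for j \<omega>
  have Wm [measurable]: "W (u (min j K)) \<in> borel_measurable M" "W s \<in> borel_measurable M" for j
    using u0[of "min j K"] u1[of "min j K"] st by (auto intro!: wiener_measurable')
  have [measurable]: "W t \<in> borel_measurable M" using st by (auto intro!: wiener_measurable')
  have Sm [measurable]: "S j \<in> borel_measurable M" for j unfolding S_def by measurable
  have SF: "S j \<in> borel_measurable (F (u k))" if "j \<le> k" "k \<le> K" for j k
  proof -
    have "W (u (min j K)) \<in> borel_measurable (F (u k))" "W s \<in> borel_measurable (F (u k))"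
      using that st u0 u1 u2 by (auto intro!: wiener_measurable simp: order_trans[OF _ u0] intro: order_trans)
    then show ?thesis unfolding S_def by measurable
  qed
  define Y where "Y \<omega> = Max ((\<lambda>j. S j \<omega>) ` {..K}) / h ^ (2 * m)" for \<omega>
  have Ym [measurable]: "Y \<in> borel_measurable M" unfolding Y_def by (intro borel_measurable_divide borel_measurable_Max) auto
  have S0: "S j \<omega> \<ge> 0" for j \<omega> by (simp add: S_def)
  have Max0: "Max ((\<lambda>j. S j \<omega>) ` {..K}) \<ge> 0" for \<omega>
    using S0[of 0 \<omega>] by (intro order_trans[OF S0[of 0 \<omega>]] Max_ge) auto
  have Y0: "Y \<omega> \<ge> 0" for \<omega> using Max0 h by (simp add: Y_def)
  have Kt: "S K \<omega> = norm (W t \<omega> - W s \<omega>) ^ (2 * (2 * m))" for \<omega> by (simp add: S_def uK)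
  have tail: "ennreal l * emeasure M {\<omega>\<in>space M. l \<le> Y \<omega>} \<le> ennreal (2 * C)" if l: "l > 0" for l
  proof -
    have "ennreal (l * h ^ (2 * m)) * emeasure M {\<omega>\<in>space M. \<exists>j\<le>K. ennreal (l * h ^ (2 * m)) \<le> ennreal (S j \<omega>)}
      \<le> (\<integral>\<^sup>+\<omega>. 2 * ennreal (S K \<omega>) \<partial>M)"
    proof (rule maximal_submartingale)
      fix k assume k: "k \<le> K"
      define A where "A = {\<omega>\<in>space M. ennreal (l * h ^ (2 * m)) \<le> ennreal (S k \<omega>) \<and> (\<forall>j<k. ennreal (S j \<omega>) < ennreal (l * h ^ (2 * m)))}"
      have uk: "u k \<in> {0..T}" using u0[of k] u1[OF k] st by auto
      have sp: "space M = space (F (u k))" using usual_filtration_subalgebra[OF F uk] by (simp add: subalgebra_def)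
      have [measurable]: "\<And>j. j \<le> k \<Longrightarrow> S j \<in> borel_measurable (F (u k))" using SF k by auto
      have "A \<in> sets (F (u k))"
      proof -
        have "A = {\<omega>\<in>space (F (u k)). ennreal (l * h ^ (2 * m)) \<le> ennreal (S k \<omega>)} \<inter> {\<omega>\<in>space (F (u k)). \<forall>j\<in>{..<k}. ennreal (S j \<omega>) < ennreal (l * h ^ (2 * m))}"
          by (auto simp: A_def sp)
        also have "\<dots> \<in> sets (F (u k))"
          by (intro sets.Int sets.sets_Collect_finite_All) (auto intro!: borel_measurable_less borel_measurable_le measurable_compose[OF SF measurable_ennreal] simp: k)
        finally show ?thesis .
      qed
      from wiener_submartingale[OF st(1) u0 u1[OF k] st(3) this, of "2 * (2 * m)"]
      have "(\<integral>\<^sup>+\<omega>. ennreal (S k \<omega>) * indicator A \<omega> \<partial>M) \<le> 2 * (\<integral>\<^sup>+\<omega>. ennreal (S K \<omega>) * indicator A \<omega> \<partial>M)"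
        using k by (simp add: S_def uK)
      also have "\<dots> = (\<integral>\<^sup>+\<omega>. 2 * ennreal (S K \<omega>) * indicator A \<omega> \<partial>M)"
      proof -
        have "A \<in> sets M" unfolding A_def by measurable
        then show ?thesis by (subst nn_integral_cmult[symmetric]) (auto simp: mult.assoc)
      qed
      finally show "(\<integral>\<^sup>+\<omega>. ennreal (S k \<omega>) * indicator {\<omega>\<in>space M. ennreal (l * h ^ (2 * m)) \<le> ennreal (S k \<omega>) \<and> (\<forall>j<k. ennreal (S j \<omega>) < ennreal (l * h ^ (2 * m)))} \<omega> \<partial>M)
        \<le> (\<integral>\<^sup>+\<omega>. 2 * ennreal (S K \<omega>) * indicator {\<omega>\<in>space M. ennreal (l * h ^ (2 * m)) \<le> ennreal (S k \<omega>) \<and> (\<forall>j<k. ennreal (S j \<omega>) < ennreal (l * h ^ (2 * m)))} \<omega> \<partial>M)"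
        unfolding A_def .
    qed auto
    also have "(\<integral>\<^sup>+\<omega>. 2 * ennreal (S K \<omega>) \<partial>M) = 2 * (\<integral>\<^sup>+z. ennreal (norm z ^ (2 * (2 * m))) \<partial>(gaussian (t - s) :: (real ^ 'm) measure))"
      unfolding Kt using wiener_increment_moment[OF st, of "\<lambda>z. ennreal (norm z ^ (2 * (2 * m)))"]
      by (subst nn_integral_cmult) (use st in auto)
    also have "\<dots> \<le> 2 * ennreal (C * h ^ (2 * m))" unfolding h_def by (intro mult_left_mono C) auto
    also have "{\<omega>\<in>space M. \<exists>j\<le>K. ennreal (l * h ^ (2 * m)) \<le> ennreal (S j \<omega>)} = {\<omega>\<in>space M. l \<le> Y \<omega>}"
    proof -
      have "(\<exists>j\<le>K. ennreal (l * h ^ (2 * m)) \<le> ennreal (S j \<omega>)) \<longleftrightarrow> l \<le> Y \<omega>" for \<omega>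
      proof -
        have "l \<le> Y \<omega> \<longleftrightarrow> l * h ^ (2 * m) \<le> Max ((\<lambda>j. S j \<omega>) ` {..K})"
          using h by (simp add: Y_def le_divide_eq)
        also have "\<dots> \<longleftrightarrow> (\<exists>j\<le>K. l * h ^ (2 * m) \<le> S j \<omega>)" by (subst Max_ge_iff) auto
        finally show ?thesis using S0 by simp
      qed
      then show ?thesis by simp
    qed
    finally have "ennreal (h ^ (2 * m)) * (ennreal l * emeasure M {\<omega>\<in>space M. l \<le> Y \<omega>}) \<le> ennreal (h ^ (2 * m)) * ennreal (2 * C)"
      using l h C by (simp add: ennreal_mult mult_ac)
    then show ?thesis using h by (subst (asm) ennreal_mult_le_mult_iff) auto
  qed
  have IY: "(\<integral>\<^sup>+\<omega>. ennreal (Y \<omega> powr (1/2)) \<partial>M) \<le> ennreal (1 + 2 * C * (2 powr (1/2) / (1 - 2 powr (1/2 - 1))))"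
    using C by (intro nn_integral_powr_le_of_tail M Y0 tail) auto
  have "ennreal (Max ((\<lambda>j. norm (W (s + (t - s) * (real j / real K)) \<omega> - W s \<omega>) ^ (2 * m)) ` {..K})) \<le> ennreal (h ^ m) * ennreal (Y \<omega> powr (1/2))" for \<omega>
  proof -
    define R where "R j = norm (W (s + (t - s) * (real j / real K)) \<omega> - W s \<omega>) ^ (2 * m)" for j
    have "Max (R ` {..K}) \<in> R ` {..K}" by (rule Max_in) auto
    then obtain i where i: "i \<in> {..K}" "Max (R ` {..K}) = R i" by blast
    then have iK: "i \<le> K" by simp
    have "(R i)\<^sup>2 = S i \<omega>" using iK by (simp add: R_def S_def u_def h_def power_mult[symmetric] mult_ac)
    also have "\<dots> \<le> Max ((\<lambda>j. S j \<omega>) ` {..K})" using i(1) by (intro Max_ge) auto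
    also have "\<dots> = (h ^ m)\<^sup>2 * Y \<omega>" using h by (simp add: Y_def power_mult[symmetric] mult_ac)
    also have "\<dots> = (h ^ m * sqrt (Y \<omega>))\<^sup>2" using Y0 by (simp add: power_mult_distrib)
    finally have "R i \<le> h ^ m * sqrt (Y \<omega>)" using h Y0 by (auto intro: power2_le_imp_le)
    then show ?thesis unfolding R_def[symmetric] using i h Y0 by (simp add: powr_half_sqrt ennreal_mult[symmetric] ennreal_leI)
  qed
  then have "(\<integral>\<^sup>+\<omega>. ennreal (Max ((\<lambda>j. norm (W (s + (t - s) * (real j / real K)) \<omega> - W s \<omega>) ^ (2 * m)) ` {..K})) \<partial>M)
      \<le> (\<integral>\<^sup>+\<omega>. ennreal (h ^ m) * ennreal (Y \<omega> powr (1/2)) \<partial>M)" by (intro nn_integral_mono)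
  also have "\<dots> = ennreal (h ^ m) * (\<integral>\<^sup>+\<omega>. ennreal (Y \<omega> powr (1/2)) \<partial>M)" by (rule nn_integral_cmult) measurable
  finally have "(\<integral>\<^sup>+\<omega>. ennreal (Max ((\<lambda>j. norm (W (s + (t - s) * (real j / real K)) \<omega> - W s \<omega>) ^ (2 * m)) ` {..K})) \<partial>M)
      \<le> ennreal (h ^ m) * ennreal (1 + 2 * C * (2 powr (1/2) / (1 - 2 powr (1/2 - 1))))"
    by (rule order_trans) (intro mult_left_mono IY, simp)
  then show ?thesis using h by (simp add: h_def ennreal_mult'[symmetric] mult.commute)
qed

text \<open>Dyadic grids are nested, so the grid maxima increase and their bound survives monotone
  convergence; path continuity then covers every u in the interval. The conclusion supplies a
  measurable majorant R, which avoids any claim on measurability of a supremum over uncountably many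
  times.\<close>

lemma wiener_oscillation:
  assumes st: "0 \<le> s" "s \<le> t" "t \<le> T" and m: "m \<ge> 1"
    and C: "C \<ge> 0" "\<And>h. h > 0 \<Longrightarrow> (\<integral>\<^sup>+z. ennreal (norm z ^ (2 * (2 * m))) \<partial>(gaussian h :: (real ^ 'm) measure)) \<le> ennreal (C * h ^ (2 * m))"
  shows "\<exists>R. R \<in> borel_measurable M \<and>
    (\<integral>\<^sup>+\<omega>. R \<omega> \<partial>M) \<le> ennreal ((1 + 2 * C * (2 powr (1/2) / (1 - 2 powr (1/2 - 1)))) * (t - s) ^ m) \<and>
    (AE \<omega> in M. \<forall>u\<in>{s..t}. ennreal (norm (W u \<omega> - W s \<omega>) ^ (2 * m)) \<le> R \<omega>)"
proof (cases "s = t")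
  case True
  \<comment> \<open>The interval is a point; m >= 1 makes the power of the zero increment
    vanish.\<close>
  then show ?thesis using m by (intro exI[of _ "\<lambda>_. 0"]) auto
next
  case False
  then have s_t: "s < t" using st by simp
  define g where "g K j = s + (t - s) * (real j / real K)" for K j
  define N where "N K \<omega> = Max ((\<lambda>j. norm (W (g K j) \<omega> - W s \<omega>) ^ (2 * m)) ` {..K})" for K \<omega>
  have g_in: "g K j \<in> {0..T}" if "j \<le> K" for K j
  proof -
    have "real j / real K \<le> 1" using that by (cases "K = 0") auto
    then have "(t - s) * (real j / real K) \<le> (t - s) * 1" using s_t by (intro mult_left_mono) auto
    moreover have "0 \<le> (t - s) * (real j / real K)" using s_t by simp
    ultimately show ?thesis using st by (auto simp: g_def)
  qed
  have [measurable]: "N K \<in> borel_measurable M" for K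
  proof -
    have "W (g K j) \<in> borel_measurable M" if "j \<le> K" for j using g_in[OF that] by (rule wiener_measurable')
    moreover have "W s \<in> borel_measurable M" using st by (intro wiener_measurable') auto
    ultimately show ?thesis
      unfolding N_def
      by (intro borel_measurable_Max) (auto intro!: borel_measurable_power borel_measurable_norm borel_measurable_diff)
  qed
  have mono: "N (2 ^ l) \<omega> \<le> N (2 ^ Suc l) \<omega>" for l \<omega>
    unfolding N_def
  proof (rule Max_mono)
    show "(\<lambda>j. norm (W (g (2 ^ l) j) \<omega> - W s \<omega>) ^ (2 * m)) ` {..2 ^ l} \<subseteq> (\<lambda>j. norm (W (g (2 ^ Suc l) j) \<omega> - W s \<omega>) ^ (2 * m)) ` {..2 ^ Suc l}"
    proof
      fix y assume "y \<in> (\<lambda>j. norm (W (g (2 ^ l) j) \<omega> - W s \<omega>) ^ (2 * m)) ` {..2 ^ l}"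
      then obtain j where j: "j \<le> 2 ^ l" "y = norm (W (g (2 ^ l) j) \<omega> - W s \<omega>) ^ (2 * m)" by blast
      have "g (2 ^ l) j = g (2 ^ Suc l) (2 * j)" by (simp add: g_def)
      then show "y \<in> (\<lambda>j. norm (W (g (2 ^ Suc l) j) \<omega> - W s \<omega>) ^ (2 * m)) ` {..2 ^ Suc l}"
        using j by (intro image_eqI[of _ _ "2 * j"]) auto
    qed
  qed auto
  define R where "R \<omega> = (SUP l. ennreal (N (2 ^ l) \<omega>))" for \<omega>
  have "R \<in> borel_measurable M" unfolding R_def by measurable
  moreover have "(\<integral>\<^sup>+\<omega>. R \<omega> \<partial>M) \<le> ennreal ((1 + 2 * C * (2 powr (1/2) / (1 - 2 powr (1/2 - 1)))) * (t - s) ^ m)"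
  proof -
    have "(\<integral>\<^sup>+\<omega>. R \<omega> \<partial>M) = (SUP l. \<integral>\<^sup>+\<omega>. ennreal (N (2 ^ l) \<omega>) \<partial>M)"
      unfolding R_def
      by (intro nn_integral_monotone_convergence_SUP) (auto simp: incseq_Suc_iff le_fun_def simp del: power_Suc intro!: ennreal_leI mono)
    also have "\<dots> \<le> ennreal ((1 + 2 * C * (2 powr (1/2) / (1 - 2 powr (1/2 - 1)))) * (t - s) ^ m)"
      unfolding N_def g_def using st s_t C by (intro SUP_least wiener_grid_maximum) auto
    finally show ?thesis .
  qed
  moreover have "AE \<omega> in M. \<forall>u\<in>{s..t}. ennreal (norm (W u \<omega> - W s \<omega>) ^ (2 * m)) \<le> R \<omega>"
  proof -
    have "AE \<omega> in M. continuous_on {0..T} (\<lambda>t. W t \<omega>)" using W by (simp add: wiener_process_def)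
    then show ?thesis
    proof eventually_elim
      fix \<omega> assume cont: "continuous_on {0..T} (\<lambda>t. W t \<omega>)"
      show "\<forall>u\<in>{s..t}. ennreal (norm (W u \<omega> - W s \<omega>) ^ (2 * m)) \<le> R \<omega>"
      proof
        fix u assume u: "u \<in> {s..t}"
        define a where "a = (u - s) / (t - s)"
        have a: "0 \<le> a" "a \<le> 1" using u s_t by (auto simp: a_def)
        have ua: "u = s + (t - s) * a" using s_t by (simp add: a_def)
        \<comment> \<open>Rounding 2^l a down gives dyadic points that converge to u from the
          left.\<close>
        define j where "j l = nat \<lfloor>2 ^ l * a\<rfloor>" for l :: nat
        have j1: "real (j l) \<le> 2 ^ l * a" and j2: "2 ^ l * a \<le> real (j l) + 1" for l
        proof -
          have "0 \<le> 2 ^ l * a" using a by simp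
          then show "real (j l) \<le> 2 ^ l * a" "2 ^ l * a \<le> real (j l) + 1" unfolding j_def by linarith+
        qed
        have jl: "j l \<le> 2 ^ l" for l
        proof -
          have "2 ^ l * a \<le> 2 ^ l * 1" using a by (intro mult_left_mono) auto
          then have "real (j l) \<le> 2 ^ l" using j1[of l] by linarith
          then have "real (j l) \<le> real (2 ^ l)" unfolding of_nat_power of_nat_numeral .
          then show ?thesis by (rule of_nat_le_iff[THEN iffD1])
        qed
        have lim: "(\<lambda>l. real (j l) / real (2 ^ l)) \<longlonglongrightarrow> a"
        proof (rule tendsto_sandwich)
          have "a - (1/2) ^ l \<le> real (j l) / real (2 ^ l)" for l
          proof -
            have "2 ^ l * a / 2 ^ l \<le> (real (j l) + 1) / 2 ^ l" using j2 by (rule divide_right_mono) simp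
            then show ?thesis by (simp add: add_divide_distrib power_one_over)
          qed
          then show "\<forall>\<^sub>F l in sequentially. a - (1/2) ^ l \<le> real (j l) / real (2 ^ l)"
            by (intro always_eventually allI)
          show "\<forall>\<^sub>F l in sequentially. real (j l) / real (2 ^ l) \<le> a"
            using j1 by (intro always_eventually allI) (simp add: field_simps)
          have "(\<lambda>l. a - (1/2) ^ l) \<longlonglongrightarrow> a - 0" by (intro tendsto_intros LIMSEQ_power_zero) simp
          then show "(\<lambda>l. a - (1/2) ^ l) \<longlonglongrightarrow> a" by simp
        qed simp
        have "(\<lambda>l. g (2 ^ l) (j l)) \<longlonglongrightarrow> u"
          unfolding g_def ua by (intro tendsto_intros lim)
        moreover have "u \<in> {0..T}" using u st by auto
        ultimately have "(\<lambda>l. W (g (2 ^ l) (j l)) \<omega>) \<longlonglongrightarrow> W u \<omega>"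
          using g_in jl by (intro continuous_on_tendsto_compose[OF cont]) auto
        then have lim': "(\<lambda>l. ennreal (norm (W (g (2 ^ l) (j l)) \<omega> - W s \<omega>) ^ (2 * m))) \<longlonglongrightarrow> ennreal (norm (W u \<omega> - W s \<omega>) ^ (2 * m))"
          by (intro tendsto_ennrealI tendsto_intros)
        have le: "ennreal (norm (W (g (2 ^ l) (j l)) \<omega> - W s \<omega>) ^ (2 * m)) \<le> R \<omega>" for l
        proof -
          have "norm (W (g (2 ^ l) (j l)) \<omega> - W s \<omega>) ^ (2 * m) \<le> N (2 ^ l) \<omega>"
            unfolding N_def using jl by (intro Max_ge) auto
          then show ?thesis unfolding R_def by (intro SUP_upper2[of l]) (auto intro: ennreal_leI)
        qed
        show "ennreal (norm (W u \<omega> - W s \<omega>) ^ (2 * m)) \<le> R \<omega>"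
          by (rule LIMSEQ_le_const2[OF lim']) (use le in blast)
      qed
    qed
  qed
  ultimately show ?thesis by blast
qed

end

section \<open>Empirical measures and coefficients\<close>

lemma nn_integral_uniform_count:
  "N \<ge> 1 \<Longrightarrow> (\<integral>\<^sup>+j. f j \<partial>uniform_count_measure {1..N}) = ennreal (1 / real N) * (\<Sum>j=1..N. f j)"
  by (simp add: uniform_count_measure_def nn_integral_point_measure_finite sum_distrib_left)

lemma empirical_measure_P2:
  fixes x :: "nat \<Rightarrow> 'a::euclidean_space"
  assumes N: "N \<ge> 1"
  shows "empirical_measure N x \<in> P2"
proof -
  interpret U: prob_space "uniform_count_measure {1..N}" using N by (intro prob_space_uniform_count_measure) auto
  have m: "x \<in> uniform_count_measure {1..N} \<rightarrow>\<^sub>M borel" by (auto simp: measurable_def space_uniform_count_measure sets_uniform_count_measure)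
  have "(\<integral>\<^sup>+z. ennreal (norm ((norm z)\<^sup>2)) \<partial>empirical_measure N x) < \<infinity>"
    unfolding empirical_measure_def using N m
    by (subst nn_integral_distr, simp, simp, subst nn_integral_uniform_count[OF N])
      (auto simp: ennreal_mult_less_top sum_ennreal)
  then have "integrable (empirical_measure N x) (\<lambda>z. (norm z)\<^sup>2)"
    by (intro integrableI_bounded) (auto simp: empirical_measure_def)
  moreover have "prob_space (empirical_measure N x)" unfolding empirical_measure_def by (rule U.prob_space_distr[OF m])
  ultimately show ?thesis by (simp add: P2_def empirical_measure_def)
qed

lemma W2_nonneg: "W2 \<mu> \<nu> \<ge> 0"
  by (simp add: W2_def)

text \<open>Any coupling gives an upper bound. The one used pairs particles with equal index: the
  image of the uniform measure on {1..N} under j |-> (x j, y j).\<close>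

lemma W2_empirical_le:
  fixes x y :: "nat \<Rightarrow> 'a::euclidean_space"
  assumes N: "N \<ge> 1"
  shows "(W2 (empirical_measure N x) (empirical_measure N y))\<^sup>2 \<le> (\<Sum>j=1..N. (dist (x j) (y j))\<^sup>2) / real N"
proof -
  define U where "U = uniform_count_measure {1..N}"
  have m [measurable]: "f \<in> U \<rightarrow>\<^sub>M borel" for f :: "nat \<Rightarrow> 'a"
    by (auto simp: measurable_def space_uniform_count_measure sets_uniform_count_measure U_def)
  define \<pi> where "\<pi> = distr U (borel \<Otimes>\<^sub>M borel) (\<lambda>j. (x j, y j))"
  have "\<pi> \<in> couplings (empirical_measure N x) (empirical_measure N y)"
  proof -
    have "empirical_measure N z = distr U borel z" for z :: "nat \<Rightarrow> 'a"
      by (simp add: empirical_measure_def U_def)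
    then show ?thesis by (simp add: couplings_def \<pi>_def distr_distr o_def)
  qed
  then have "(\<Sqinter>\<pi>\<in>couplings (empirical_measure N x) (empirical_measure N y). \<integral>\<^sup>+ z. ennreal ((dist (fst z) (snd z))\<^sup>2) \<partial>\<pi>)
      \<le> (\<integral>\<^sup>+ z. ennreal ((dist (fst z) (snd z))\<^sup>2) \<partial>\<pi>)" by (rule INF_lower)
  also have "\<dots> = (\<integral>\<^sup>+ j. ennreal ((dist (x j) (y j))\<^sup>2) \<partial>U)"
    unfolding \<pi>_def by (subst nn_integral_distr) auto
  also have "\<dots> = ennreal ((\<Sum>j=1..N. (dist (x j) (y j))\<^sup>2) / real N)"
    unfolding U_def nn_integral_uniform_count[OF N]
    by (simp add: sum_ennreal ennreal_mult[symmetric] sum_nonneg)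
  finally have "enn2real (\<Sqinter>\<pi>\<in>couplings (empirical_measure N x) (empirical_measure N y). \<integral>\<^sup>+ z. ennreal ((dist (fst z) (snd z))\<^sup>2) \<partial>\<pi>)
      \<le> (\<Sum>j=1..N. (dist (x j) (y j))\<^sup>2) / real N"
    by (intro enn2real_leI) (auto intro!: divide_nonneg_nonneg sum_nonneg)
  then show ?thesis by (simp add: W2_def)
qed

text \<open>Regarding the Dirac measure at 0 as the empirical measure of N zeros makes the distance
  to it a special case of the bound between empirical measures.\<close>

lemma empirical_measure_zero:
  "N \<ge> 1 \<Longrightarrow> empirical_measure N (\<lambda>_. 0) = return borel (0 :: 'a::euclidean_space)"
proof (rule measure_eqI)
  fix A assume N: "N \<ge> 1" and "A \<in> sets (empirical_measure N (\<lambda>_. 0 :: 'a))"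
  then have A: "A \<in> sets borel" by (simp add: empirical_measure_def)
  have "ennreal (1 / real N) * of_nat N = 1"
    using N by (simp add: ennreal_of_nat_eq_real_of_nat ennreal_mult[symmetric])
  then show "emeasure (empirical_measure N (\<lambda>_. 0)) A = emeasure (return borel 0) A"
    unfolding emeasure_empirical_measure[OF N A] by (simp add: mult.assoc[symmetric])
qed (simp add: empirical_measure_def)

lemma return_zero_P2: "return borel 0 \<in> P2"
  using empirical_measure_P2[of 1 "\<lambda>_. 0"] by (simp add: empirical_measure_zero)

lemma W2_return_zero: "W2 (return borel 0) (return borel (0 :: 'a::euclidean_space)) = 0"
  using W2_empirical_le[of 1 "\<lambda>_. 0 :: 'a" "\<lambda>_. 0"] by (simp add: empirical_measure_zero)

lemma W2_empirical_zero_le: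
  "N \<ge> 1 \<Longrightarrow> (W2 (empirical_measure N x) (return borel 0))\<^sup>2 \<le> (\<Sum>j=1..N. (norm (x j))\<^sup>2) / real N"
  using W2_empirical_le[of N x "\<lambda>_. 0"] by (simp add: empirical_measure_zero)

lemma continuous_on_of_modulus:
  fixes f :: "'a::topological_space \<Rightarrow> 'b::real_normed_vector"
  assumes "\<And>y y'. norm (f y' - f y) \<le> G y y'" "\<And>y. ((\<lambda>y'. G y y') \<longlongrightarrow> 0) (at y)"
  shows "continuous_on UNIV f"
proof -
  have "(f \<longlongrightarrow> f y) (at y)" for y
    unfolding LIM_zero_iff[of f, symmetric]
    by (rule Lim_null_comparison[OF _ assms(2)]) (simp add: assms(1))
  then show ?thesis by (simp add: continuous_on_def)
qed

section \<open>Growth of the tamed coefficients and their continuity in the particle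
  positions\<close>

locale coefficients =
  fixes T \<rho> L p0 p1 :: real
    and b :: "real \<Rightarrow> real ^ 'd \<Rightarrow> (real ^ 'd) measure \<Rightarrow> real ^ 'd"
    and \<sigma> :: "real \<Rightarrow> real ^ 'd \<Rightarrow> (real ^ 'd) measure \<Rightarrow> real ^ 'm ^ 'd"
    and \<sigma>0 :: "real \<Rightarrow> real ^ 'd \<Rightarrow> (real ^ 'd) measure \<Rightarrow> real ^ 'm0 ^ 'd"
  assumes T: "T > 0" and p0: "p0 > 2" and p1: "p1 > 2" and \<rho>: "\<rho> > 0" and L: "L > 0"
    and coercive: "\<And>t x \<mu>. t \<in> {0..T} \<Longrightarrow> \<mu> \<in> P2 \<Longrightarrow>
      2 * (x \<bullet> b t x \<mu>) + (p0 - 1) * (norm (\<sigma> t x \<mu>))\<^sup>2 + (p0 - 1) * (norm (\<sigma>0 t x \<mu>))\<^sup>2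
        \<le> L * ((1 + norm x)\<^sup>2 + (W2 \<mu> (return borel 0))\<^sup>2)"
    and monotone: "\<And>t x y \<mu> \<nu>. t \<in> {0..T} \<Longrightarrow> \<mu> \<in> P2 \<Longrightarrow> \<nu> \<in> P2 \<Longrightarrow>
      2 * ((x - y) \<bullet> (b t x \<mu> - b t y \<nu>))
        + (p1 - 1) * (norm (\<sigma> t x \<mu> - \<sigma> t y \<nu>))\<^sup>2
        + (p1 - 1) * (norm (\<sigma>0 t x \<mu> - \<sigma>0 t y \<nu>))\<^sup>2
        \<le> L * ((norm (x - y))\<^sup>2 + (W2 \<mu> \<nu>)\<^sup>2)"
    and lipschitz: "\<And>t x y \<mu> \<nu>. t \<in> {0..T} \<Longrightarrow> \<mu> \<in> P2 \<Longrightarrow> \<nu> \<in> P2 \<Longrightarrow>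
      norm (b t x \<mu> - b t y \<nu>)
        \<le> L * ((1 + norm x + norm y) powr (\<rho> / 2) * norm (x - y) + W2 \<mu> \<nu>)"
begin

text \<open>Boundedness in t of the drift at the origin is not among the assumptions but follows
  from them. Coercivity bounds the drift at the unit vector e pointing along b0 from above in that
  direction, and the Lipschitz condition carries this from e to 0, where the component along e is
  the full norm of b0.\<close>

lemma drift_at_zero_bound:
  assumes t: "t \<in> {0..T}"
  shows "norm (b t 0 (return borel 0)) \<le> L * (2 + 2 powr (\<rho> / 2))"
proof (cases "b t 0 (return borel 0) = 0")
  case True then show ?thesis using L by simp
next
  case False
  define b0 where "b0 = b t 0 (return borel 0)"
  define e where "e = b0 /\<^sub>R norm b0"
  have e: "norm e = 1" using False by (simp add: e_def b0_def)
  have eb: "e \<bullet> b0 = norm b0" using False by (simp add: e_def b0_def power2_norm_eq_inner[symmetric] power2_eq_square)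
  have c: "2 * (e \<bullet> b t e (return borel 0)) \<le> L * 4"
  proof -
    have "0 \<le> (p0 - 1) * (norm (\<sigma> t e (return borel 0)))\<^sup>2" "0 \<le> (p0 - 1) * (norm (\<sigma>0 t e (return borel 0)))\<^sup>2"
      using p0 by auto
    then show ?thesis using coercive[OF t return_zero_P2, of e] by (simp add: e W2_return_zero)
  qed
  have l: "norm (b t e (return borel 0) - b0) \<le> L * 2 powr (\<rho> / 2)"
    using lipschitz[OF t return_zero_P2 return_zero_P2, of e 0] by (simp add: e W2_return_zero b0_def)
  have "\<bar>e \<bullet> (b t e (return borel 0) - b0)\<bar> \<le> norm e * norm (b t e (return borel 0) - b0)"
    by (rule Cauchy_Schwarz_ineq2)
  then have "norm b0 \<le> e \<bullet> b t e (return borel 0) + norm (b t e (return borel 0) - b0)"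
    using eb by (simp add: e inner_diff_right)
  then show ?thesis using c l by (simp add: b0_def algebra_simps)
qed

text \<open>One summand for each part of the drift estimate: the value at the origin, the dependence
  on x after damping, and the dependence on the measure.\<close>

definition growth_const :: real where
  "growth_const = L * (2 + 2 powr (\<rho> / 2)) + L * 2 powr (\<rho> / 2) + L"

lemma growth_const_pos: "growth_const > 0"
  unfolding growth_const_def using L by (intro add_nonneg_pos) auto

definition damping :: "nat \<Rightarrow> real ^ 'd \<Rightarrow> real" where
  "damping n x = 1 + real n powr (- 1 / 2) * norm x powr (\<rho> / 2)"

lemma damping_ge_1: "damping n x \<ge> 1"
  by (simp add: damping_def)

lemma tamed_damping: "tamed n \<rho> f t x \<mu> = f t x \<mu> /\<^sub>R damping n x"
  by (simp add: tamed_def damping_def)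

text \<open>The purpose of taming: sqrt n times the damping equals sqrt n + |x|^(\<rho>/2), which
  dominates the polynomial factor of the Lipschitz condition. Division by the damping thus trades
  superlinear growth for a factor sqrt n.\<close>

lemma damping_growth:
  assumes "n \<ge> 1"
  shows "(1 + norm x) powr (\<rho> / 2) \<le> 2 powr (\<rho> / 2) * (sqrt (real n) * damping n x)"
proof -
  define M where "M = max 1 (norm x)"
  have "(1 + norm x) powr (\<rho> / 2) \<le> (2 * M) powr (\<rho> / 2)" using \<rho> by (intro powr_mono2) (auto simp: M_def)
  also have "\<dots> = 2 powr (\<rho> / 2) * M powr (\<rho> / 2)" by (simp add: powr_mult)
  also have "\<dots> \<le> 2 powr (\<rho> / 2) * (1 + norm x powr (\<rho> / 2))"
    by (intro mult_left_mono) (auto simp: M_def max_def)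
  also have "1 + norm x powr (\<rho> / 2) \<le> sqrt (real n) + norm x powr (\<rho> / 2)" using assms by simp
  also have "\<dots> = sqrt (real n) * damping n x"
    using assms by (simp add: damping_def distrib_left powr_minus powr_half_sqrt mult.assoc[symmetric])
  finally show ?thesis by simp
qed

lemma tamed_drift_bound:
  assumes t: "t \<in> {0..T}" and n: "n \<ge> 1" and \<mu>: "\<mu> \<in> P2"
  shows "norm (tamed n \<rho> b t x \<mu>) \<le> growth_const * (sqrt (real n) * (1 + norm x) + W2 \<mu> (return borel 0))"
proof -
  define w where "w = W2 \<mu> (return borel 0)"
  have w: "w \<ge> 0" by (simp add: w_def W2_nonneg)
  have n1: "sqrt (real n) \<ge> 1" using n by simp
  note D = damping_ge_1[of n x]
  have "norm (b t x \<mu>) \<le> norm (b t 0 (return borel 0)) + norm (b t x \<mu> - b t 0 (return borel 0))"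
    by (metis add.commute diff_add_cancel norm_triangle_ineq)
  also have "\<dots> \<le> L * (2 + 2 powr (\<rho> / 2)) + L * ((1 + norm x) powr (\<rho> / 2) * norm x + w)"
    using drift_at_zero_bound[OF t] lipschitz[OF t \<mu> return_zero_P2, of x 0] by (intro add_mono) (auto simp: w_def)
  finally have "norm (b t x \<mu>) / damping n x
      \<le> (L * (2 + 2 powr (\<rho> / 2)) + L * ((1 + norm x) powr (\<rho> / 2) * norm x + w)) / damping n x"
    using D by (intro divide_right_mono) auto
  also have "\<dots> = L * (2 + 2 powr (\<rho> / 2)) / damping n x + L * ((1 + norm x) powr (\<rho> / 2) / damping n x * norm x) + L * (w / damping n x)"
    by (simp add: add_divide_distrib distrib_left)
  also have "\<dots> \<le> L * (2 + 2 powr (\<rho> / 2)) + L * ((2 powr (\<rho> / 2) * sqrt (real n)) * norm x) + L * w"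
  proof (intro add_mono mult_left_mono mult_right_mono)
    have "L * (2 + 2 powr (\<rho> / 2)) \<ge> 0" using L by simp
    then show "L * (2 + 2 powr (\<rho> / 2)) / damping n x \<le> L * (2 + 2 powr (\<rho> / 2))"
      using D divide_left_mono[of 1 "damping n x" "L * (2 + 2 powr (\<rho> / 2))"] by simp
    show "(1 + norm x) powr (\<rho> / 2) / damping n x \<le> 2 powr (\<rho> / 2) * sqrt (real n)"
      using damping_growth[OF n, of x] D by (simp add: divide_le_eq mult.assoc)
    show "w / damping n x \<le> w" using D w divide_left_mono[of 1 "damping n x" w] by simp
  qed (use L in auto)
  also have "\<dots> \<le> growth_const * (sqrt (real n) * (1 + norm x) + w)"
  proof -
    have 1: "L * (2 + 2 powr (\<rho> / 2)) * 1 \<le> L * (2 + 2 powr (\<rho> / 2)) * (sqrt (real n) * (1 + norm x) + w)"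
    proof (intro mult_left_mono)
      have "1 * 1 \<le> sqrt (real n) * (1 + norm x)" using n1 by (intro mult_mono) auto
      then show "1 \<le> sqrt (real n) * (1 + norm x) + w" using w by simp
    qed (use L in auto)
    have 2: "L * 2 powr (\<rho> / 2) * (sqrt (real n) * norm x) \<le> L * 2 powr (\<rho> / 2) * (sqrt (real n) * (1 + norm x) + w)"
      using L w n1 by (intro mult_left_mono) (auto simp: distrib_left)
    have 3: "L * w \<le> L * (sqrt (real n) * (1 + norm x) + w)" using L n1 by (intro mult_left_mono) auto
    show ?thesis using 1 2 3 by (simp add: growth_const_def algebra_simps)
  qed
  finally show ?thesis using D by (simp add: tamed_damping w_def divide_inverse mult.commute)
qed

lemma tamed_coefficient_bounds:
  fixes x :: "real ^ 'd"
  assumes t: "t \<in> {0..T}" and n: "n \<ge> 1" and \<mu>: "\<mu> \<in> P2" and q: "(W2 \<mu> (return borel 0))\<^sup>2 \<le> q"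
  defines "\<beta> \<equiv> tamed n \<rho> b t x \<mu>"
    and "S \<equiv> (norm (tamed n \<rho> \<sigma> t x \<mu>))\<^sup>2 + (norm (tamed n \<rho> \<sigma>0 t x \<mu>))\<^sup>2"
    and "C \<equiv> 4 * growth_const\<^sup>2 + 5 * growth_const + 2 * L"
  shows "2 * (x \<bullet> \<beta>) + (2 * (p0 / 2) - 1) * S \<le> 2 * L * (1 + (norm x)\<^sup>2 + q)"
    and "(norm \<beta>)\<^sup>2 \<le> C * (real n * (1 + (norm x)\<^sup>2) + q)"
    and "S \<le> C * (sqrt (real n) * (1 + (norm x)\<^sup>2) + q)"
proof -
  define w where "w = W2 \<mu> (return borel 0)"
  have w: "w \<ge> 0" "w\<^sup>2 \<le> q" using q by (auto simp: w_def W2_nonneg)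
  have q0: "q \<ge> 0" using w(2) by (smt (verit) zero_le_power2)
  define A where "A = 1 + (norm x)\<^sup>2"
  have x1: "(1 + norm x)\<^sup>2 \<le> 2 * A"
    using sum_squares_bound[of 1 "norm x"] by (simp add: A_def power2_sum)
  have A1: "A \<ge> 1" by (simp add: A_def)
  define K where "K = growth_const"
  have K: "K > 0" by (simp add: K_def growth_const_pos)
  have n1: "sqrt (real n) \<ge> 1" "(sqrt (real n))\<^sup>2 = real n" using n by auto
  define D where "D = damping n x"
  have D: "D \<ge> 1" by (simp add: D_def damping_ge_1)
  define s where "s = (norm (\<sigma> t x \<mu>))\<^sup>2 + (norm (\<sigma>0 t x \<mu>))\<^sup>2"
  have s0: "s \<ge> 0" by (simp add: s_def)
  have S_eq: "S = s / D\<^sup>2" using D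
    by (simp add: S_def s_def tamed_damping D_def[symmetric] divide_inverse power_mult_distrib power_inverse distrib_left distrib_right mult.commute)
  have \<beta>_eq: "\<beta> = b t x \<mu> /\<^sub>R D" by (simp add: \<beta>_def tamed_damping D_def)
  \<comment> \<open>The tamed diffusion carries the square of the damping but the tamed drift only
    its first power. Giving up one factor leaves a common denominator, and coercivity can be divided
    by it.\<close>
  have SD: "S \<le> s / D"
    unfolding S_eq using D s0 by (intro divide_left_mono) (auto simp: power2_eq_square)
  have co: "2 * (x \<bullet> b t x \<mu>) + (p0 - 1) * s \<le> L * (2 * A + q)"
  proof -
    have "2 * (x \<bullet> b t x \<mu>) + (p0 - 1) * s \<le> L * ((1 + norm x)\<^sup>2 + w\<^sup>2)"
      using coercive[OF t \<mu>, of x] by (simp add: s_def w_def distrib_left)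
    also have "\<dots> \<le> L * (2 * A + q)" using x1 w L by (intro mult_left_mono add_mono) auto
    finally show ?thesis .
  qed
  have r0: "0 \<le> L * (2 * A + q)" using L A1 q0 by simp
  have "2 * (x \<bullet> \<beta>) + (p0 - 1) * S \<le> 2 * (x \<bullet> \<beta>) + (p0 - 1) * (s / D)"
    using SD p0 by (intro add_left_mono mult_left_mono) auto
  also have "\<dots> = (2 * (x \<bullet> b t x \<mu>) + (p0 - 1) * s) / D"
    using D by (simp add: \<beta>_eq field_simps)
  also have "\<dots> \<le> L * (2 * A + q) / D" using co D by (intro divide_right_mono) auto
  also have "\<dots> \<le> L * (2 * A + q)" using r0 D divide_left_mono[of 1 D "L * (2 * A + q)"] by simp
  also have "\<dots> \<le> L * (2 * A + 2 * q)" using L q0 by (intro mult_left_mono) auto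
  finally show "2 * (x \<bullet> \<beta>) + (2 * (p0 / 2) - 1) * S \<le> 2 * L * (1 + (norm x)\<^sup>2 + q)"
    by (simp add: A_def algebra_simps)
  have \<beta>_le: "norm \<beta> \<le> K * (sqrt (real n) * (1 + norm x) + w)"
    unfolding \<beta>_def K_def w_def by (rule tamed_drift_bound[OF t n \<mu>])
  have CK: "C \<ge> 4 * K\<^sup>2" "C \<ge> 5 * K + 2 * L" using K L by (auto simp: C_def K_def)
  have "(norm \<beta>)\<^sup>2 \<le> (K * (sqrt (real n) * (1 + norm x) + w))\<^sup>2" using \<beta>_le by (intro power_mono) auto
  also have "\<dots> \<le> K\<^sup>2 * (2 * (real n * (1 + norm x)\<^sup>2) + 2 * w\<^sup>2)"
    unfolding power_mult_distrib
    using sum_squares_bound[of "sqrt (real n) * (1 + norm x)" w] n1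
    by (intro mult_left_mono) (auto simp: power2_sum power_mult_distrib)
  also have "\<dots> \<le> K\<^sup>2 * (2 * (real n * (2 * A)) + 2 * (2 * q))"
    using x1 w q0 by (intro mult_left_mono add_mono) auto
  also have "\<dots> = 4 * K\<^sup>2 * (real n * A + q)" by (simp add: algebra_simps)
  also have "\<dots> \<le> C * (real n * A + q)" using CK A1 q0 by (intro mult_right_mono) auto
  finally show "(norm \<beta>)\<^sup>2 \<le> C * (real n * (1 + (norm x)\<^sup>2) + q)" by (simp add: A_def)
  \<comment> \<open>p0 > 2 makes the coefficient at least 1; coercivity is then solved for s, and
    the drift term is moved to the right by Cauchy-Schwarz.\<close>
  have "s \<le> (p0 - 1) * s" using p0 s0 mult_right_mono[of 1 "p0 - 1" s] by simp
  also have "\<dots> \<le> L * (2 * A + q) + 2 * (norm x * norm (b t x \<mu>))"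
    using co Cauchy_Schwarz_ineq2[of x "b t x \<mu>"] by linarith
  finally have "s / D \<le> (L * (2 * A + q) + 2 * (norm x * norm (b t x \<mu>))) / D"
    using D by (intro divide_right_mono) auto
  also have "\<dots> = L * (2 * A + q) / D + 2 * (norm x * norm \<beta>)"
    using D by (simp add: \<beta>_eq add_divide_distrib divide_inverse mult_ac distrib_left)
  also have "\<dots> \<le> L * (2 * A + q) + 2 * (norm x * (K * (sqrt (real n) * (1 + norm x) + w)))"
    using r0 D divide_left_mono[of 1 D "L * (2 * A + q)"] \<beta>_le by (intro add_mono mult_left_mono) auto
  also have "\<dots> = L * (2 * A + q) + K * (sqrt (real n) * (2 * (norm x * (1 + norm x))) + 2 * norm x * w)"
    by (simp add: algebra_simps)
  also have "\<dots> \<le> L * (2 * (sqrt (real n) * A) + 2 * q) + K * (sqrt (real n) * (4 * A) + (sqrt (real n) * A + q))"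
  proof -
    have A_n: "A \<le> sqrt (real n) * A" using n1 A1 by simp
    have "2 * norm x \<le> A" using sum_squares_bound[of 1 "norm x"] by (simp add: A_def)
    then have "norm x \<le> A" using norm_ge_zero[of x] by linarith
    then have "2 * (norm x * (1 + norm x)) \<le> 4 * A" using x1 by (simp add: A_def power2_eq_square algebra_simps)
    moreover have "2 * norm x * w \<le> sqrt (real n) * A + q"
      using sum_squares_bound[of "norm x" w] w A_n by (simp add: A_def)
    ultimately show ?thesis using A_n L K q0 n1 by (intro add_mono mult_left_mono) auto
  qed
  also have "\<dots> \<le> (5 * K + 2 * L) * (sqrt (real n) * A + q)"
    using K q0 by (simp add: algebra_simps)
  also have "\<dots> \<le> C * (sqrt (real n) * A + q)" using CK A1 q0 n1 by (intro mult_right_mono) auto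
  finally show "S \<le> C * (sqrt (real n) * (1 + (norm x)\<^sup>2) + q)" using SD by (simp add: A_def)
qed

lemma modulus_tendsto:
  assumes N: "N \<ge> 1"
  shows "((\<lambda>y'. L * ((1 + norm (y' i) + norm (y i)) powr (\<rho> / 2) * norm (y' i - y i)
      + sqrt ((\<Sum>j=1..N. (dist (y' j) (y j))\<^sup>2) / real N))) \<longlongrightarrow> 0) (at (y :: nat \<Rightarrow> real ^ 'd))"
proof -
  have c: "((\<lambda>y'. y' j) \<longlongrightarrow> y j) (at y)" for j
    using continuous_on_product_coordinates[of j] by (auto simp: continuous_on_def)
  have "((\<lambda>y'. L * ((1 + norm (y' i) + norm (y i)) powr (\<rho> / 2) * norm (y' i - y i)
      + sqrt ((\<Sum>j=1..N. (dist (y' j) (y j))\<^sup>2) / real N))) \<longlongrightarrow>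
      L * ((1 + norm (y i) + norm (y i)) powr (\<rho> / 2) * norm (y i - y i)
      + sqrt ((\<Sum>j=1..N. (dist (y j) (y j))\<^sup>2) / real N))) (at y)"
    by (intro tendsto_intros c) (use N in \<open>auto simp: add_nonneg_eq_0_iff\<close>)
  then show ?thesis by simp
qed

text \<open>The scheme evaluates its coefficients at empirical measures. At a fixed time they depend
  continuously on the particle positions in the product topology, because the coupling by equal
  indices bounds the Wasserstein distance; measurability along the scheme follows from this.\<close>

lemma continuous_drift:
  assumes t: "t \<in> {0..T}" and N: "N \<ge> 1"
  shows "continuous_on UNIV (\<lambda>y. b t (y i) (empirical_measure N y))"
proof (rule continuous_on_of_modulus[OF _ modulus_tendsto[OF N]])
  fix y y' :: "nat \<Rightarrow> real ^ 'd"
  have "W2 (empirical_measure N y') (empirical_measure N y) \<le> sqrt ((\<Sum>j=1..N. (dist (y' j) (y j))\<^sup>2) / real N)"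
    using W2_empirical_le[OF N] by (rule real_le_rsqrt)
  then show "norm (b t (y' i) (empirical_measure N y') - b t (y i) (empirical_measure N y))
    \<le> L * ((1 + norm (y' i) + norm (y i)) powr (\<rho> / 2) * norm (y' i - y i)
      + sqrt ((\<Sum>j=1..N. (dist (y' j) (y j))\<^sup>2) / real N))"
    using lipschitz[OF t empirical_measure_P2[OF N, of y'] empirical_measure_P2[OF N, of y], of "y' i" "y i"] L
    by (smt (verit) mult_left_mono)
qed

text \<open>The monotonicity condition bounds the squared differences of both diffusion coefficients
  by L times squared distances plus 2 |x - y| |b - b'|, using p1 - 1 >= 1. Continuity of the drift
  therefore passes to the diffusions; H is the resulting modulus.\<close>

lemma continuous_diffusion:
  assumes t: "t \<in> {0..T}" and N: "N \<ge> 1"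
  shows "continuous_on UNIV (\<lambda>y. \<sigma> t (y i) (empirical_measure N y))"
    and "continuous_on UNIV (\<lambda>y. \<sigma>0 t (y i) (empirical_measure N y))"
proof -
  define G where "G y y' = L * ((1 + norm (y' i) + norm (y i)) powr (\<rho> / 2) * norm (y' i - y i)
      + sqrt ((\<Sum>j=1..N. (dist (y' j) (y j))\<^sup>2) / real N))" for y y' :: "nat \<Rightarrow> real ^ 'd"
  define H where "H y y' = sqrt (L * ((norm (y' i - y i))\<^sup>2 + (\<Sum>j=1..N. (dist (y' j) (y j))\<^sup>2) / real N)
      + 2 * (norm (y' i - y i) * norm (b t (y' i) (empirical_measure N y') - b t (y i) (empirical_measure N y))))"
    for y y' :: "nat \<Rightarrow> real ^ 'd"
  have H0: "(H y \<longlongrightarrow> 0) (at y)" for y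
  proof -
    have c: "((\<lambda>y'. y' j) \<longlongrightarrow> y j) (at y)" for j
      using continuous_on_product_coordinates[of j] by (auto simp: continuous_on_def)
    have d: "((\<lambda>y'. b t (y' i) (empirical_measure N y')) \<longlongrightarrow> b t (y i) (empirical_measure N y)) (at y)"
      using continuous_drift[OF t N, of i] by (auto simp: continuous_on_def)
    have "(H y \<longlongrightarrow> H y y) (at y)" unfolding H_def[abs_def]
      by (intro tendsto_intros c d) (use N in auto)
    moreover have "H y y = 0" by (simp add: H_def)
    ultimately show ?thesis by simp
  qed
  have le: "norm (\<sigma> t (y' i) (empirical_measure N y') - \<sigma> t (y i) (empirical_measure N y)) \<le> H y y'
     \<and> norm (\<sigma>0 t (y' i) (empirical_measure N y') - \<sigma>0 t (y i) (empirical_measure N y)) \<le> H y y'" for y y'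
  proof -
    let ?u = "(norm (\<sigma> t (y' i) (empirical_measure N y') - \<sigma> t (y i) (empirical_measure N y)))\<^sup>2"
    let ?v = "(norm (\<sigma>0 t (y' i) (empirical_measure N y') - \<sigma>0 t (y i) (empirical_measure N y)))\<^sup>2"
    let ?b = "b t (y' i) (empirical_measure N y') - b t (y i) (empirical_measure N y)"
    have m: "2 * ((y' i - y i) \<bullet> ?b) + (p1 - 1) * ?u + (p1 - 1) * ?v
        \<le> L * ((norm (y' i - y i))\<^sup>2 + (W2 (empirical_measure N y') (empirical_measure N y))\<^sup>2)"
      by (rule monotone[OF t empirical_measure_P2[OF N] empirical_measure_P2[OF N]])
    also have "\<dots> \<le> L * ((norm (y' i - y i))\<^sup>2 + (\<Sum>j=1..N. (dist (y' j) (y j))\<^sup>2) / real N)"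
      using L W2_empirical_le[OF N] by (intro mult_left_mono add_left_mono) auto
    finally have "(p1 - 1) * ?u + (p1 - 1) * ?v \<le> L * ((norm (y' i - y i))\<^sup>2 + (\<Sum>j=1..N. (dist (y' j) (y j))\<^sup>2) / real N)
        + 2 * (norm (y' i - y i) * norm ?b)"
      using Cauchy_Schwarz_ineq2[of "y' i - y i" ?b] by linarith
    moreover have "?u \<le> (p1 - 1) * ?u" "?v \<le> (p1 - 1) * ?v"
      using p1 mult_right_mono[of 1 "p1 - 1" ?u] mult_right_mono[of 1 "p1 - 1" ?v] by auto
    moreover have "?u \<ge> 0" "?v \<ge> 0" by auto
    ultimately have "?u \<le> L * ((norm (y' i - y i))\<^sup>2 + (\<Sum>j=1..N. (dist (y' j) (y j))\<^sup>2) / real N) + 2 * (norm (y' i - y i) * norm ?b)"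
      and "?v \<le> L * ((norm (y' i - y i))\<^sup>2 + (\<Sum>j=1..N. (dist (y' j) (y j))\<^sup>2) / real N) + 2 * (norm (y' i - y i) * norm ?b)"
      by linarith+
    then show ?thesis unfolding H_def by (auto intro: real_le_rsqrt)
  qed
  show "continuous_on UNIV (\<lambda>y. \<sigma> t (y i) (empirical_measure N y))"
    using le H0 by (intro continuous_on_of_modulus[of _ H]) auto
  show "continuous_on UNIV (\<lambda>y. \<sigma>0 t (y i) (empirical_measure N y))"
    using le H0 by (intro continuous_on_of_modulus[of _ H]) auto
qed

lemma measurable_tamed:
  assumes t: "t \<in> {0..T}" and N: "N \<ge> 1" and Y: "\<And>j. (\<lambda>\<omega>. Y \<omega> j) \<in> borel_measurable M"
  shows "(\<lambda>\<omega>. tamed n \<rho> b t (Y \<omega> i) (empirical_measure N (Y \<omega>))) \<in> borel_measurable M"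
    and "(\<lambda>\<omega>. tamed n \<rho> \<sigma> t (Y \<omega> i) (empirical_measure N (Y \<omega>))) \<in> borel_measurable M"
    and "(\<lambda>\<omega>. tamed n \<rho> \<sigma>0 t (Y \<omega> i) (empirical_measure N (Y \<omega>))) \<in> borel_measurable M"
proof -
  have [measurable]: "Y \<in> borel_measurable M" by (rule measurable_coordinatewise_then_product[OF Y])
  have [measurable]: "(\<lambda>\<omega>. damping n (Y \<omega> i)) \<in> borel_measurable M"
    using Y[of i] unfolding damping_def by measurable
  have [measurable]: "(\<lambda>y. b t (y i) (empirical_measure N y)) \<in> borel_measurable borel"
    "(\<lambda>y. \<sigma> t (y i) (empirical_measure N y)) \<in> borel_measurable borel"
    "(\<lambda>y. \<sigma>0 t (y i) (empirical_measure N y)) \<in> borel_measurable borel"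
    by (intro borel_measurable_continuous_onI continuous_drift continuous_diffusion t N)+
  show "(\<lambda>\<omega>. tamed n \<rho> b t (Y \<omega> i) (empirical_measure N (Y \<omega>))) \<in> borel_measurable M"
    and "(\<lambda>\<omega>. tamed n \<rho> \<sigma> t (Y \<omega> i) (empirical_measure N (Y \<omega>))) \<in> borel_measurable M"
    and "(\<lambda>\<omega>. tamed n \<rho> \<sigma>0 t (Y \<omega> i) (empirical_measure N (Y \<omega>))) \<in> borel_measurable M"
    unfolding tamed_damping by measurable
qed

end

section \<open>The tamed scheme\<close>

text \<open>Jensen's inequality with uniform weights. The added 1 keeps the points positive and
  turns the right side into a mean of the moment functions that are being estimated.\<close>

lemma powr_mean_le:
  fixes y :: "nat \<Rightarrow> 'a::real_normed_vector"
  assumes N: "N \<ge> 1" and a: "a \<ge> 1"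
  shows "((\<Sum>j=1..N. (norm (y j))\<^sup>2) / real N) powr a \<le> (\<Sum>j=1..N. (1 + (norm (y j))\<^sup>2) powr a) / real N"
proof -
  have "((\<Sum>j=1..N. (norm (y j))\<^sup>2) / real N) powr a \<le> (\<Sum>j=1..N. (1 / real N) *\<^sub>R (1 + (norm (y j))\<^sup>2)) powr a"
  proof (rule powr_mono2)
    show "(\<Sum>j=1..N. (norm (y j))\<^sup>2) / real N \<le> (\<Sum>j=1..N. (1 / real N) *\<^sub>R (1 + (norm (y j))\<^sup>2))"
      unfolding sum_divide_distrib by (intro sum_mono) (simp add: divide_right_mono)
  qed (use a in \<open>auto intro!: sum_nonneg divide_nonneg_nonneg\<close>)
  also have "\<dots> \<le> (\<Sum>j=1..N. (1 / real N) * (1 + (norm (y j))\<^sup>2) powr a)"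
    using N a by (intro convex_on_sum[OF _ _ powr_convex]) (auto simp: add_pos_nonneg)
  finally show ?thesis by (simp add: sum_divide_distrib)
qed

lemma empirical_measure_cong:
  "(\<And>j. j \<in> {1..N} \<Longrightarrow> x j = y j) \<Longrightarrow> empirical_measure N x = empirical_measure N y"
  unfolding empirical_measure_def by (intro distr_cong) (auto simp: space_uniform_count_measure)

lemma kappa_grid:
  assumes "n \<ge> 1" "real j / real n \<le> s" "s < real (Suc j) / real n"
  shows "kappa n s = real j / real n"
proof -
  have "real j \<le> real n * s" "real n * s < real j + 1"
    using assms by (auto simp: field_simps)
  then have "\<lfloor>real n * s\<rfloor> = int j" by (intro floor_unique) auto
  then show ?thesis by (simp add: kappa_def)
qed

lemma set_lebesgue_integral_kappa:
  fixes f :: "real \<Rightarrow> 'a::{banach,second_countable_topology}"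
  assumes n: "n \<ge> 1" and t: "real k / real n \<le> t" "t \<le> real (Suc k) / real n"
  shows "(LINT s:{0..t}|lborel. f (kappa n s))
    = (\<Sum>j<k. (1 / real n) *\<^sub>R f (real j / real n)) + (t - real k / real n) *\<^sub>R f (real k / real n)"
proof -
  have n0: "real n > 0" using n by simp
  define I where "I j = {real j / real n ..< real (Suc j) / real n} \<inter> {0..t}" for j
  have t0: "0 \<le> t" using t by (meson divide_nonneg_nonneg of_nat_0_le_iff order_trans)
  have eq: "indicator {0..t} s *\<^sub>R f (kappa n s) = (\<Sum>j\<le>Suc k. indicator (I j) s *\<^sub>R f (real j / real n))" for s
  proof (cases "s \<in> {0..t}")
    case False
    then show ?thesis by (simp add: I_def)
  next
    case True
    define i where "i = nat \<lfloor>real n * s\<rfloor>"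
    have "0 \<le> real n * s" using True by simp
    then have i: "real i \<le> real n * s" "real n * s < real i + 1" unfolding i_def by linarith+
    then have grid: "real i / real n \<le> s" "s < real (Suc i) / real n" using n0 by (auto simp: field_simps)
    have "real i / real n \<le> real (Suc k) / real n" using grid True t by auto
    then have ik: "i \<le> Suc k" using n0 by (simp add: divide_le_cancel)
    have ind: "indicator (I j) s = (if j = i then 1 else 0 :: real)" if "j \<le> Suc k" for j
    proof (cases "j = i")
      case True then show ?thesis using grid \<open>s \<in> {0..t}\<close> by (simp add: I_def)
    next
      case False
      have "s \<notin> {real j / real n ..< real (Suc j) / real n}"
      proof
        assume "s \<in> {real j / real n ..< real (Suc j) / real n}"
        then have "real j \<le> real n * s" "real n * s < real j + 1" using n0 by (auto simp: field_simps)
        then have "j = i" using i by linarith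
        then show False using False by simp
      qed
      then show ?thesis using False by (auto simp: I_def indicator_def)
    qed
    have "(\<Sum>j\<le>Suc k. indicator (I j) s *\<^sub>R f (real j / real n)) = (\<Sum>j\<le>Suc k. if j = i then f (real j / real n) else 0)"
      by (intro sum.cong) (auto simp: ind)
    also have "\<dots> = f (real i / real n)" using ik by (simp add: sum.delta)
    finally show ?thesis using True kappa_grid[OF n grid] by simp
  qed
  have meas: "measure lborel (I j) = (if j < k then 1 / real n else if j = k then t - real k / real n else 0)" if "j \<le> Suc k" for j
  proof -
    have j0: "0 \<le> real j / real n" "0 \<le> real k / real n" by auto
    have "j < k \<or> j = k \<or> j = Suc k" "t < real (Suc k) / real n \<or> t = real (Suc k) / real n"
      using that t(2) by linarith+
    then consider "j < k" | "j = k" "t < real (Suc k) / real n" | "j = k" "t = real (Suc k) / real n" | "j = Suc k"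
      by blast
    then show ?thesis
    proof cases
      case 1
      have "real (Suc j) / real n \<le> real k / real n" using 1 n0 by (intro divide_right_mono) auto
      then have "I j = {real j / real n ..< real (Suc j) / real n}" using t by (auto simp: I_def intro: order_trans[OF j0(1)] order_trans[OF j0(2)])
      then show ?thesis using 1 n0 by (simp add: add_divide_distrib divide_right_mono)
    next
      case 2
      then have "I j = {real k / real n .. t}" using t by (auto simp: I_def intro: order_trans[OF j0(1)] order_trans[OF j0(2)])
      then show ?thesis using 2 t by simp
    next
      case 3
      then have "I j = {real k / real n ..< t}" using t by (auto simp: I_def intro: order_trans[OF j0(1)] order_trans[OF j0(2)])
      then show ?thesis using 3 t by simp
    next
      case 4
      then have "I j \<subseteq> {t}" using t by (auto simp: I_def)
      then have "I j = {} \<or> I j = {t}" by auto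
      then show ?thesis using 4 by auto
    qed
  qed
  have fin: "emeasure lborel (I j) < \<infinity>" for j
  proof -
    have "emeasure lborel (I j) \<le> emeasure lborel {0..t}" by (intro emeasure_mono) (auto simp: I_def)
    then show ?thesis using t0 by (auto simp: top_unique less_top[symmetric])
  qed
  have "(LINT s:{0..t}|lborel. f (kappa n s)) = (\<integral>s. (\<Sum>j\<le>Suc k. indicator (I j) s *\<^sub>R f (real j / real n)) \<partial>lborel)"
    unfolding set_lebesgue_integral_def eq ..
  also have "\<dots> = (\<Sum>j\<le>Suc k. \<integral>s. indicator (I j) s *\<^sub>R f (real j / real n) \<partial>lborel)"
    using fin by (intro Bochner_Integration.integral_sum integrable_scaleR_left integrable_real_indicator) (auto simp: I_def)
  also have "\<dots> = (\<Sum>j\<le>Suc k. measure lborel (I j) *\<^sub>R f (real j / real n))"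
    using fin by (intro sum.cong refl) (simp add: I_def less_top)
  also have "\<dots> = (\<Sum>j\<le>Suc k. (if j < k then 1 / real n else if j = k then t - real k / real n else 0) *\<^sub>R f (real j / real n))"
    by (intro sum.cong refl) (simp add: meas)
  also have "\<dots> = (\<Sum>j<k. (1 / real n) *\<^sub>R f (real j / real n)) + (t - real k / real n) *\<^sub>R f (real k / real n)"
    by (simp add: lessThan_Suc_atMost[symmetric])
  finally show ?thesis .
qed

text \<open>The number of summands is the ceiling of n t: it equals k at the left end of the cell
  and k + 1 elsewhere. The formula covers both cases because its last increment vanishes at the left
  end.\<close>

lemma step_ito_integral_cell:
  assumes n: "n \<ge> 1" and t: "real k / real n \<le> t" "t \<le> real (Suc k) / real n"
  shows "step_ito_integral n H W t
    = (\<Sum>j<k. H (real j / real n) *v (W (real (Suc j) / real n) - W (real j / real n)))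
      + H (real k / real n) *v (W t - W (real k / real n))"
proof -
  have n0: "real n > 0" using n by simp
  have a: "min t (real (Suc j) / real n) = real (Suc j) / real n" "min t (real j / real n) = real j / real n" if "j < k" for j
  proof -
    have "real (Suc j) / real n \<le> real k / real n" "real j / real n \<le> real k / real n"
      using that n0 by (auto intro!: divide_right_mono)
    then show "min t (real (Suc j) / real n) = real (Suc j) / real n" "min t (real j / real n) = real j / real n"
      using t by auto
  qed
  have sum: "(\<Sum>j<k. H (real j / real n) *v (W (min t (real (Suc j) / real n)) - W (min t (real j / real n))))
      = (\<Sum>j<k. H (real j / real n) *v (W (real (Suc j) / real n) - W (real j / real n)))"
    by (intro sum.cong refl) (simp only: a lessThan_iff)
  show ?thesis
  proof (cases "t = real k / real n")
    case True
    then have "real n * t = real k" using n0 by simp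
    then have "nat \<lceil>real n * t\<rceil> = k" by simp
    then show ?thesis unfolding step_ito_integral_def using sum True by simp
  next
    case False
    have "real k < real n * t" "real n * t \<le> real k + 1" using False t n0 by (auto simp: field_simps)
    then have "nat \<lceil>real n * t\<rceil> = Suc k" by (simp add: nat_eq_iff ceiling_eq_iff)
    then show ?thesis unfolding step_ito_integral_def using sum t by (simp add: min_def)
  qed
qed

text \<open>One step as a deterministic function of the state, the elapsed time and the two
  increments. Keeping the increments as arguments is what allows them to be frozen.\<close>

definition tamed_step ::
  "real \<Rightarrow> (real \<Rightarrow> real ^ 'd \<Rightarrow> (real ^ 'd) measure \<Rightarrow> real ^ 'd) \<Rightarrow>
   (real \<Rightarrow> real ^ 'd \<Rightarrow> (real ^ 'd) measure \<Rightarrow> real ^ 'm ^ 'd) \<Rightarrow>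
   (real \<Rightarrow> real ^ 'd \<Rightarrow> (real ^ 'd) measure \<Rightarrow> real ^ 'm0 ^ 'd) \<Rightarrow>
   nat \<Rightarrow> nat \<Rightarrow> real \<Rightarrow> (nat \<Rightarrow> real ^ 'd) \<Rightarrow> nat \<Rightarrow> real \<Rightarrow> real ^ 'm \<Rightarrow> real ^ 'm0 \<Rightarrow> real ^ 'd" where
  "tamed_step \<rho> b \<sigma> \<sigma>0 N n t y i h z z0 = y i + h *\<^sub>R tamed n \<rho> b t (y i) (empirical_measure N y)
     + tamed n \<rho> \<sigma> t (y i) (empirical_measure N y) *v z + tamed n \<rho> \<sigma>0 t (y i) (empirical_measure N y) *v z0"

lemma tamed_step_cong:
  assumes "\<And>j. j \<in> {1..N} \<Longrightarrow> y j = y' j" "i \<in> {1..N}"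
  shows "tamed_step \<rho> b \<sigma> \<sigma>0 N n t y i h z z0 = tamed_step \<rho> b \<sigma> \<sigma>0 N n t y' i h z z0"
  using assms empirical_measure_cong[of N y y'] by (simp add: tamed_step_def)

text \<open>The integrals accumulated up to k / n, here called R, are recognised as the value of the
  scheme at k / n by evaluating the same formula there. The scheme thus becomes a one-step
  recursion, also for partial steps.\<close>

lemma tamed_euler_scheme_cell:
  assumes n: "n \<ge> 1" and i: "i \<in> {1..N}"
    and eq: "\<And>i t. i \<in> {1..N} \<Longrightarrow> t \<in> {0..T} \<Longrightarrow> x i t = \<xi> i
      + (LINT s:{0..t}|lborel. tamed n \<rho> b (kappa n s) (x i (kappa n s)) (empirical_measure N (\<lambda>j. x j (kappa n s))))
      + step_ito_integral n (\<lambda>s. tamed n \<rho> \<sigma> (kappa n s) (x i (kappa n s)) (empirical_measure N (\<lambda>j. x j (kappa n s)))) (W i) t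
      + step_ito_integral n (\<lambda>s. tamed n \<rho> \<sigma>0 (kappa n s) (x i (kappa n s)) (empirical_measure N (\<lambda>j. x j (kappa n s)))) W0 t"
    and t: "t \<in> {0..T}" "real k / real n \<le> t" "t \<le> real (Suc k) / real n"
  shows "x i t = tamed_step \<rho> b \<sigma> \<sigma>0 N n (real k / real n) (\<lambda>j. x j (real k / real n)) i (t - real k / real n)
      (W i t - W i (real k / real n)) (W0 t - W0 (real k / real n))"
proof -
  have kj: "kappa n (real j / real n) = real j / real n" for j
    using n by (intro kappa_grid) (auto simp: divide_strict_right_mono)
  define fb where "fb s = tamed n \<rho> b s (x i s) (empirical_measure N (\<lambda>j. x j s))" for s
  define fs where "fs s = tamed n \<rho> \<sigma> s (x i s) (empirical_measure N (\<lambda>j. x j s))" for s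
  define f0 where "f0 s = tamed n \<rho> \<sigma>0 s (x i s) (empirical_measure N (\<lambda>j. x j s))" for s
  have eq': "x i t = \<xi> i + (LINT s:{0..t}|lborel. fb (kappa n s)) + step_ito_integral n (\<lambda>s. fs (kappa n s)) (W i) t
      + step_ito_integral n (\<lambda>s. f0 (kappa n s)) W0 t" if "t \<in> {0..T}" for t
    using eq[OF i that] by (simp add: fb_def fs_def f0_def)
  define R where "R = \<xi> i + (\<Sum>j<k. (1 / real n) *\<^sub>R fb (real j / real n))
     + (\<Sum>j<k. fs (real j / real n) *v (W i (real (Suc j) / real n) - W i (real j / real n)))
     + (\<Sum>j<k. f0 (real j / real n) *v (W0 (real (Suc j) / real n) - W0 (real j / real n)))"
  have form: "x i u = R + (u - real k / real n) *\<^sub>R fb (real k / real n) + fs (real k / real n) *v (W i u - W i (real k / real n))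
      + f0 (real k / real n) *v (W0 u - W0 (real k / real n))"
    if u: "u \<in> {0..T}" "real k / real n \<le> u" "u \<le> real (Suc k) / real n" for u
    unfolding eq'[OF u(1)] set_lebesgue_integral_kappa[OF n u(2,3)] step_ito_integral_cell[OF n u(2,3)] kj R_def
    by (simp add: algebra_simps)
  have "x i (real k / real n) = R"
  proof -
    have "real k / real n \<in> {0..T}" "real k / real n \<le> real (Suc k) / real n"
      using t by (auto intro: order_trans divide_right_mono)
    then show ?thesis using form[of "real k / real n"] by simp
  qed
  then show ?thesis using form[OF t] by (simp add: tamed_step_def fb_def fs_def f0_def)
qed

lemma borel_measurable_matrix_vector_mult [measurable (raw)]:
  fixes A :: "'a \<Rightarrow> real ^ 'm ^ 'd"
  assumes [measurable]: "A \<in> borel_measurable M" "z \<in> borel_measurable M"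
  shows "(\<lambda>x. A x *v z x) \<in> borel_measurable M"
proof (rule borel_measurable_continuous_Pair[OF assms])
  have "(\<lambda>x :: (real ^ 'm ^ 'd) \<times> (real ^ 'm). fst x *v snd x) = (\<lambda>x. \<chi> i. \<Sum>j\<in>UNIV. fst x $ i $ j * snd x $ j)"
    by (simp add: matrix_vector_mult_def)
  then show "continuous_on UNIV (\<lambda>x :: (real ^ 'm ^ 'd) \<times> (real ^ 'm). fst x *v snd x)"
    by (simp only:) (intro continuous_intros)
qed

section \<open>The recursion on the grid and its one-step estimates\<close>

locale tamed_particles = coefficients T \<rho> L p0 p1 b \<sigma> \<sigma>0
  for T \<rho> L p0 p1 :: real
    and b :: "real \<Rightarrow> real ^ 'd \<Rightarrow> (real ^ 'd) measure \<Rightarrow> real ^ 'd"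
    and \<sigma> :: "real \<Rightarrow> real ^ 'd \<Rightarrow> (real ^ 'd) measure \<Rightarrow> real ^ 'm ^ 'd"
    and \<sigma>0 :: "real \<Rightarrow> real ^ 'd \<Rightarrow> (real ^ 'd) measure \<Rightarrow> real ^ 'm0 ^ 'd" +
  fixes M0 :: "'v measure" and F0 :: "real \<Rightarrow> 'v measure"
    and M1 :: "'w measure" and F1 :: "real \<Rightarrow> 'w measure"
    and W0 :: "real \<Rightarrow> 'v \<Rightarrow> real ^ 'm0"
    and W :: "nat \<Rightarrow> real \<Rightarrow> 'w \<Rightarrow> real ^ 'm"
    and X0 :: "'w \<Rightarrow> real ^ 'd" and \<xi> :: "nat \<Rightarrow> 'w \<Rightarrow> real ^ 'd"
  assumes M0: "prob_space M0" and F0: "usual_filtration T M0 F0"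
    and M1: "prob_space M1" and F1: "usual_filtration T M1 F1"
    and W0: "wiener_process T M0 F0 W0"
    and W: "\<And>i. i \<ge> 1 \<Longrightarrow> wiener_process T M1 F1 (W i)"
    and X0: "X0 \<in> borel_measurable M1"
    and \<xi>: "\<And>i. i \<ge> 1 \<Longrightarrow> \<xi> i \<in> borel_measurable (F1 0)"
    and \<xi>_law: "\<And>i. i \<ge> 1 \<Longrightarrow> distr M1 borel (\<xi> i) = distr M1 borel X0"
    and X0_moment: "integrable M1 (\<lambda>\<omega>. norm (X0 \<omega>) powr p0)"
begin

sublocale M0: prob_space M0 by (rule M0)
sublocale M1: prob_space M1 by (rule M1)
sublocale PP: pair_prob_space M0 M1 ..

abbreviation Pr where "Pr \<equiv> M0 \<Otimes>\<^sub>M M1"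
text \<open>The plain product of the two filtrations: the recursion \<open>euler\<close> is
  measurable with respect to it, and it is the past to which the freezing lemma for product spaces
  applies.\<close>

abbreviation fil where "fil t \<equiv> F0 t \<Otimes>\<^sub>M F1 t"
abbreviation V :: "real ^ 'd \<Rightarrow> real" where "V x \<equiv> (1 + (norm x)\<^sup>2) powr (p0 / 2)"
abbreviation sqmean :: "nat \<Rightarrow> (nat \<Rightarrow> real ^ 'd) \<Rightarrow> real" where "sqmean N y \<equiv> (\<Sum>j=1..N. (norm (y j))\<^sup>2) / real N"
abbreviation estep where "estep \<equiv> tamed_step \<rho> b \<sigma> \<sigma>0"

lemma measurable_pair_mono:
  assumes "(\<lambda>x. x) \<in> A' \<rightarrow>\<^sub>M A" "(\<lambda>x. x) \<in> B' \<rightarrow>\<^sub>M B" "f \<in> A \<Otimes>\<^sub>M B \<rightarrow>\<^sub>M K"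
  shows "f \<in> A' \<Otimes>\<^sub>M B' \<rightarrow>\<^sub>M K"
proof -
  have "(\<lambda>x. (fst x, snd x)) \<in> A' \<Otimes>\<^sub>M B' \<rightarrow>\<^sub>M A \<Otimes>\<^sub>M B"
    by (intro measurable_Pair measurable_compose[OF measurable_fst assms(1)] measurable_compose[OF measurable_snd assms(2)])
  then have "(\<lambda>x. x) \<in> A' \<Otimes>\<^sub>M B' \<rightarrow>\<^sub>M A \<Otimes>\<^sub>M B" by simp
  from measurable_compose[OF this assms(3)] show ?thesis .
qed

lemma fil_mono:
  assumes "0 \<le> s" "s \<le> t" "t \<le> T" "f \<in> fil s \<rightarrow>\<^sub>M K"
  shows "f \<in> fil t \<rightarrow>\<^sub>M K"
  by (rule measurable_pair_mono[OF usual_filtration_mono[OF F0 assms(1-3)] usual_filtration_mono[OF F1 assms(1-3)] assms(4)]) auto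

lemma fil_measurable:
  assumes "t \<in> {0..T}" "f \<in> fil t \<rightarrow>\<^sub>M K"
  shows "f \<in> Pr \<rightarrow>\<^sub>M K"
  by (rule measurable_pair_mono[OF usual_filtration_measurable[OF F0 assms(1)] usual_filtration_measurable[OF F1 assms(1)] assms(2)]) auto

lemma fil_space: "t \<in> {0..T} \<Longrightarrow> space (fil t) = space Pr"
  using usual_filtration_subalgebra[OF F0] usual_filtration_subalgebra[OF F1]
  by (auto simp: subalgebra_def space_pair_measure)

lemma fil_sets:
  assumes t: "t \<in> {0..T}" and A: "A \<in> sets (fil t)"
  shows "A \<in> sets Pr"
proof -
  have "(\<lambda>x. x) \<in> Pr \<rightarrow>\<^sub>M fil t" by (rule fil_measurable[OF t]) simp
  from measurable_sets[OF this A] have "(\<lambda>x. x) -` A \<inter> space Pr \<in> sets Pr" .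
  moreover have "(\<lambda>x. x) -` A \<inter> space Pr = A" using sets.sets_into_space[OF A] fil_space[OF t] by auto
  ultimately show ?thesis by simp
qed

text \<open>A version of the scheme on the grid that is defined for every outcome and adapted,
  whereas X satisfies its equation only almost surely and is not assumed measurable. Coordinates
  outside {1..N} are set to 0 so that all coordinates are measurable; the empirical measure does not
  see them.\<close>

primrec euler :: "nat \<Rightarrow> nat \<Rightarrow> nat \<Rightarrow> 'v \<times> 'w \<Rightarrow> nat \<Rightarrow> real ^ 'd" where
  "euler N n 0 = (\<lambda>\<omega> i. if i \<in> {1..N} then \<xi> i (snd \<omega>) else 0)"
| "euler N n (Suc k) = (\<lambda>\<omega> i. if i \<in> {1..N} then
     estep N n (real k / real n) (euler N n k \<omega>) i (real (Suc k) / real n - real k / real n)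
       (W i (real (Suc k) / real n) (snd \<omega>) - W i (real k / real n) (snd \<omega>))
       (W0 (real (Suc k) / real n) (fst \<omega>) - W0 (real k / real n) (fst \<omega>)) else 0)"

abbreviation interpolant :: "nat \<Rightarrow> nat \<Rightarrow> nat \<Rightarrow> nat \<Rightarrow> real \<Rightarrow> 'v \<times> 'w \<Rightarrow> real ^ 'd" where
  "interpolant N n k i t \<omega> \<equiv> estep N n (real k / real n) (euler N n k \<omega>) i (t - real k / real n)
     (W i t (snd \<omega>) - W i (real k / real n) (snd \<omega>)) (W0 t (fst \<omega>) - W0 (real k / real n) (fst \<omega>))"

lemma measurable_estep:
  assumes t: "t \<in> {0..T}" and N: "N \<ge> 1" and Y: "\<And>j. (\<lambda>\<omega>. Y \<omega> j) \<in> borel_measurable M"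
    and [measurable]: "z \<in> borel_measurable M" "z0 \<in> borel_measurable M"
  shows "(\<lambda>\<omega>. estep N n t (Y \<omega>) i h (z \<omega>) (z0 \<omega>)) \<in> borel_measurable M"
proof -
  note [measurable] = measurable_tamed[OF t N Y] Y
  show ?thesis unfolding tamed_step_def by measurable
qed

lemma euler_measurable:
  assumes N: "N \<ge> 1" and n: "n \<ge> 1"
  shows "real k / real n \<le> T \<Longrightarrow> (\<lambda>\<omega>. euler N n k \<omega> i) \<in> borel_measurable (fil (real k / real n))"
proof (induction k arbitrary: i)
  case 0
  have "(\<lambda>\<omega>. \<xi> i (snd \<omega>)) \<in> borel_measurable (fil 0)" if "i \<ge> 1"
    using measurable_compose[OF measurable_snd \<xi>[OF that], of "F0 0"] .
  then show ?case by (cases "i \<in> {1..N}") auto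
next
  case (Suc k)
  let ?s = "real k / real n" and ?u = "real (Suc k) / real n"
  have s: "0 \<le> ?s" "?s \<le> ?u" by (auto intro: divide_right_mono)
  have sT: "?s \<le> T" using s(2) Suc.prems by (rule order_trans)
  have y: "(\<lambda>\<omega>. euler N n k \<omega> j) \<in> borel_measurable (fil ?u)" for j
    by (rule fil_mono[OF s Suc.prems Suc.IH[OF sT]])
  show ?case
  proof (cases "i \<in> {1..N}")
    case True
    then have i: "i \<ge> 1" by simp
    have "W i ?s \<in> borel_measurable (F1 ?u)" "W i ?u \<in> borel_measurable (F1 ?u)"
      using wiener_measurable[OF M1 F1 W[OF i]] s Suc.prems by auto
    then have z: "(\<lambda>\<omega>. W i ?u (snd \<omega>) - W i ?s (snd \<omega>)) \<in> borel_measurable (fil ?u)"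
      by (intro borel_measurable_diff measurable_compose[OF measurable_snd])
    have "W0 ?s \<in> borel_measurable (F0 ?u)" "W0 ?u \<in> borel_measurable (F0 ?u)"
      using wiener_measurable[OF M0 F0 W0] s Suc.prems by auto
    then have z0: "(\<lambda>\<omega>. W0 ?u (fst \<omega>) - W0 ?s (fst \<omega>)) \<in> borel_measurable (fil ?u)"
      by (intro borel_measurable_diff measurable_compose[OF measurable_fst])
    have "?s \<in> {0..T}" using s sT by simp
    from measurable_estep[OF this N y z z0] show ?thesis using True by (simp del: of_nat_Suc)
  next
    case False
    then have "(\<lambda>\<omega>. euler N n (Suc k) \<omega> i) = (\<lambda>_. 0)" by auto
    then show ?thesis by (simp only: borel_measurable_const)
  qed
qed

lemma euler_measurable_Pr:
  assumes "N \<ge> 1" "n \<ge> 1" "real k / real n \<le> T"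
  shows "(\<lambda>\<omega>. euler N n k \<omega> i) \<in> borel_measurable Pr"
  using fil_measurable[OF _ euler_measurable[OF assms]] assms by auto

text \<open>Freezing applied to one step, full or partial: given the past up to k / n the state is
  fixed and the two increments become independent Gaussian variables. The event A stands in for
  conditioning.\<close>

lemma estep_expectation:
  assumes N: "N \<ge> 1" and n: "n \<ge> 1" and i: "i \<in> {1..N}" and u: "real k / real n < u" "u \<le> T"
    and A: "A \<in> sets (fil (real k / real n))" and g [measurable]: "g \<in> borel_measurable borel"
  shows "(\<integral>\<^sup>+\<omega>. g (interpolant N n k i u \<omega>)
        * indicator A \<omega> \<partial>Pr)
    = (\<integral>\<^sup>+\<omega>. (\<integral>\<^sup>+\<zeta>. g (estep N n (real k / real n) (euler N n k \<omega>) i (u - real k / real n) (fst \<zeta>) (snd \<zeta>))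
        \<partial>(gaussian (u - real k / real n) \<Otimes>\<^sub>M gaussian (u - real k / real n))) * indicator A \<omega> \<partial>Pr)"
proof -
  define s where "s = real k / real n"
  have s: "0 \<le> s" "s \<le> T" "s \<in> {0..T}" "s < u" using u by (auto simp: s_def)
  have i1: "i \<ge> 1" using i by simp
  define Z where "Z \<omega> = W i u \<omega> - W i s \<omega>" for \<omega>
  define Z0 where "Z0 \<omega> = W0 u \<omega> - W0 s \<omega>" for \<omega>
  have Zm: "Z \<in> borel_measurable M1" unfolding Z_def using s u
    by (intro borel_measurable_diff wiener_measurable'[OF M1 F1 W[OF i1]]) auto
  have Z0m: "Z0 \<in> borel_measurable M0" unfolding Z0_def using s u
    by (intro borel_measurable_diff wiener_measurable'[OF M0 F0 W0]) auto
  have lawZ: "distr M1 borel Z = gaussian (u - s)" unfolding Z_def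
    by (rule wiener_increment_law[OF M1 F1 W[OF i1] s(1,4) u(2)])
  have lawZ0: "distr M0 borel Z0 = gaussian (u - s)" unfolding Z0_def
    by (rule wiener_increment_law[OF M0 F0 W0 s(1,4) u(2)])
  define f where "f = (\<lambda>(\<omega>, \<zeta>). g (estep N n s (euler N n k \<omega>) i (u - s) (fst \<zeta>) (snd \<zeta>)) * indicator A \<omega>)"
  have fm: "f \<in> borel_measurable (fil s \<Otimes>\<^sub>M (borel \<Otimes>\<^sub>M borel))"
  proof -
    have y: "(\<lambda>x. euler N n k (fst x) j) \<in> borel_measurable (fil s \<Otimes>\<^sub>M (borel \<Otimes>\<^sub>M borel))" for j
      using measurable_compose[OF measurable_fst euler_measurable[OF N n]] s by (simp add: s_def)
    have "(\<lambda>x. estep N n s (euler N n k (fst x)) i (u - s) (fst (snd x)) (snd (snd x))) \<in> borel_measurable (fil s \<Otimes>\<^sub>M (borel \<Otimes>\<^sub>M borel))"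
      by (rule measurable_estep[OF s(3) N y]) measurable
    moreover have [measurable]: "A \<in> sets (fil s)" using A by (simp add: s_def)
    ultimately show ?thesis unfolding f_def by measurable
  qed
  have "(\<integral>\<^sup>+\<omega>. f (\<omega>, (Z (snd \<omega>), Z0 (fst \<omega>))) \<partial>Pr)
    = (\<integral>\<^sup>+\<omega>. (\<integral>\<^sup>+\<zeta>. f (\<omega>, \<zeta>) \<partial>(distr M1 borel Z \<Otimes>\<^sub>M distr M0 borel Z0)) \<partial>Pr)"
    by (rule nn_integral_indep_freeze_prod[OF M0 M1 usual_filtration_subalgebra[OF F0 s(3)] usual_filtration_subalgebra[OF F1 s(3)] Z0m Zm _ _ fm])
      (unfold Z_def Z0_def, rule wiener_increment_indep[OF M0 F0 W0 s(1,4) u(2)], rule wiener_increment_indep[OF M1 F1 W[OF i1] s(1,4) u(2)])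
  also have "\<dots> = (\<integral>\<^sup>+\<omega>. (\<integral>\<^sup>+\<zeta>. g (estep N n s (euler N n k \<omega>) i (u - s) (fst \<zeta>) (snd \<zeta>)) \<partial>(gaussian (u - s) \<Otimes>\<^sub>M gaussian (u - s))) * indicator A \<omega> \<partial>Pr)"
    unfolding lawZ lawZ0 by (intro nn_integral_cong) (auto simp: f_def indicator_def)
  finally show ?thesis by (simp add: f_def Z_def Z0_def s_def)
qed

lemma V_measurable: "(\<lambda>x. ennreal (V x)) \<in> borel_measurable borel"
  by measurable

lemma sqmean_bound: "N \<ge> 1 \<Longrightarrow> (W2 (empirical_measure N y) (return borel 0))\<^sup>2 \<le> sqmean N y"
  by (rule W2_empirical_zero_le)

lemma sqmean_nonneg: "0 \<le> sqmean N y"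
  by (intro divide_nonneg_nonneg sum_nonneg) auto

text \<open>The event A is kept because the estimate is used twice: on the whole space for the
  Gronwall argument, and on the event that a level has not been reached for the maximal
  inequality.\<close>

lemma grid_step_expectation:
  obtains K where "K > 0"
    "\<And>N n i k A. N \<ge> 1 \<Longrightarrow> n \<ge> 1 \<Longrightarrow> i \<in> {1..N} \<Longrightarrow> real (Suc k) / real n \<le> T \<Longrightarrow> A \<in> sets (fil (real k / real n)) \<Longrightarrow>
      (\<integral>\<^sup>+\<omega>. ennreal (V (euler N n (Suc k) \<omega> i)) * indicator A \<omega> \<partial>Pr)
      \<le> (\<integral>\<^sup>+\<omega>. ennreal (V (euler N n k \<omega> i) + K / real n * (V (euler N n k \<omega> i) + sqmean N (euler N n k \<omega>) powr (p0 / 2))) * indicator A \<omega> \<partial>Pr)"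
proof -
  obtain c :: "nat \<Rightarrow> real" where c: "\<And>k. c k \<ge> 0" and noise:
    "\<And>h (s :: real ^ 'm ^ 'd) (s0 :: real ^ 'm0 ^ 'd). h > 0 \<Longrightarrow>
      symmetric_noise (gaussian h \<Otimes>\<^sub>M gaussian h) (\<lambda>z. s *v fst z + s0 *v snd z) (h * ((norm s)\<^sup>2 + (norm s0)\<^sup>2)) c"
    using gaussian_symmetric_noise by blast
  define C1 where "C1 = 4 * growth_const\<^sup>2 + 5 * growth_const + 2 * L"
  have C1: "C1 \<ge> 0" using growth_const_pos L by (simp add: C1_def)
  have r: "p0 / 2 > 1" using p0 by simp
  have L2: "2 * L \<ge> 0" using L by simp
  show ?thesis
  proof (rule one_step_moment_bound[OF r C1 L2 c, where 'a="real ^ 'd" and 'q="(real ^ 'm) \<times> (real ^ 'm0)"])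
  fix K :: real assume K: "K > 0" and step:
    "\<And>(Q :: ((real ^ 'm) \<times> (real ^ 'm0)) measure) (G :: _ \<Rightarrow> real ^ 'd) n x \<beta> S q.
      n \<ge> 1 \<Longrightarrow> q \<ge> 0 \<Longrightarrow> S \<ge> 0 \<Longrightarrow> symmetric_noise Q G (S / real n) c \<Longrightarrow>
      2 * (x \<bullet> \<beta>) + (2 * (p0 / 2) - 1) * S \<le> (2 * L) * (1 + (norm x)\<^sup>2 + q) \<Longrightarrow>
      (norm \<beta>)\<^sup>2 \<le> C1 * (real n * (1 + (norm x)\<^sup>2) + q) \<Longrightarrow>
      S \<le> C1 * (sqrt (real n) * (1 + (norm x)\<^sup>2) + q) \<Longrightarrow>
      (\<integral>\<^sup>+z. ennreal (V (x + \<beta> /\<^sub>R real n + G z)) \<partial>Q) \<le> ennreal (V x + K / real n * (V x + q powr (p0 / 2)))"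
  show ?thesis
  proof (rule that[OF K])
    fix N n i k :: nat and A :: "('v \<times> 'w) set"
    assume N: "N \<ge> 1" and n: "n \<ge> 1" and i: "i \<in> {1..N}" and kT: "real (Suc k) / real n \<le> T" and A: "A \<in> sets (fil (real k / real n))"
    define s where "s = real k / real n"
    have n0: "real n > 0" using n by simp
    have u: "real k / real n < real (Suc k) / real n" using n0 by (simp add: divide_strict_right_mono)
    have sT: "s \<in> {0..T}" using u kT by (auto simp: s_def)
    have h: "real (Suc k) / real n - real k / real n = 1 / real n" by (simp add: add_divide_distrib)
    have inner: "(\<integral>\<^sup>+\<zeta>. ennreal (V (estep N n s y i (1 / real n) (fst \<zeta>) (snd \<zeta>))) \<partial>(gaussian (1 / real n) \<Otimes>\<^sub>M gaussian (1 / real n)))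
      \<le> ennreal (V (y i) + K / real n * (V (y i) + sqmean N y powr (p0 / 2)))" for y :: "nat \<Rightarrow> real ^ 'd"
    proof -
      define S where "S = (norm (tamed n \<rho> \<sigma> s (y i) (empirical_measure N y)))\<^sup>2 + (norm (tamed n \<rho> \<sigma>0 s (y i) (empirical_measure N y)))\<^sup>2"
      note bd = tamed_coefficient_bounds[OF sT n empirical_measure_P2[OF N] sqmean_bound[OF N], of "y i" y]
      define B where "B = tamed n \<rho> \<sigma> s (y i) (empirical_measure N y)"
      define B0 where "B0 = tamed n \<rho> \<sigma>0 s (y i) (empirical_measure N y)"
      define \<beta> where "\<beta> = tamed n \<rho> b s (y i) (empirical_measure N y)"
      have S_eq: "S = (norm B)\<^sup>2 + (norm B0)\<^sup>2" by (simp add: S_def B_def B0_def)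
      have S0: "S \<ge> 0" by (simp add: S_eq)
      have "symmetric_noise (gaussian (1 / real n) \<Otimes>\<^sub>M gaussian (1 / real n)) (\<lambda>\<zeta>. B *v fst \<zeta> + B0 *v snd \<zeta>) (S / real n) c"
        using noise[of "1 / real n" B B0] n0 by (simp add: S_eq)
      from step[OF n sqmean_nonneg[where N=N and y=y] S0 this
          bd(1)[folded S_def \<beta>_def] bd(2)[folded C1_def \<beta>_def] bd(3)[folded S_def C1_def]]
      have le: "(\<integral>\<^sup>+\<zeta>. ennreal (V (y i + \<beta> /\<^sub>R real n + (B *v fst \<zeta> + B0 *v snd \<zeta>))) \<partial>(gaussian (1 / real n) \<Otimes>\<^sub>M gaussian (1 / real n)))
        \<le> ennreal (V (y i) + K / real n * (V (y i) + sqmean N y powr (p0 / 2)))" .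
      have "estep N n s y i (1 / real n) z z0 = y i + \<beta> /\<^sub>R real n + (B *v z + B0 *v z0)" for z z0
        by (simp add: tamed_step_def B_def B0_def \<beta>_def divide_inverse add.assoc)
      then show ?thesis using le by (simp only:)
    qed
    have "(\<integral>\<^sup>+\<omega>. ennreal (V (euler N n (Suc k) \<omega> i)) * indicator A \<omega> \<partial>Pr)
      = (\<integral>\<^sup>+\<omega>. (\<integral>\<^sup>+\<zeta>. ennreal (V (estep N n s (euler N n k \<omega>) i (1 / real n) (fst \<zeta>) (snd \<zeta>)))
        \<partial>(gaussian (1 / real n) \<Otimes>\<^sub>M gaussian (1 / real n))) * indicator A \<omega> \<partial>Pr)"
      using estep_expectation[OF N n i u kT A V_measurable] i unfolding h s_def by (simp add: h del: of_nat_Suc)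
    also have "\<dots> \<le> (\<integral>\<^sup>+\<omega>. ennreal (V (euler N n k \<omega> i) + K / real n * (V (euler N n k \<omega> i) + sqmean N (euler N n k \<omega>) powr (p0 / 2))) * indicator A \<omega> \<partial>Pr)"
      by (intro nn_integral_mono mult_right_mono inner) auto
    finally show "(\<integral>\<^sup>+\<omega>. ennreal (V (euler N n (Suc k) \<omega> i)) * indicator A \<omega> \<partial>Pr) \<le> \<dots>" .
  qed
  qed
qed

text \<open>From the last grid point to an intermediate time only one step is taken, so a constant
  factor does no harm and the crude bound replaces the expansion.\<close>

lemma partial_step_expectation:
  obtains K where "K > 0"
    "\<And>N n i k u. N \<ge> 1 \<Longrightarrow> n \<ge> 1 \<Longrightarrow> i \<in> {1..N} \<Longrightarrow> real k / real n < u \<Longrightarrow> u \<le> real (Suc k) / real n \<Longrightarrow> u \<le> T \<Longrightarrow>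
      (\<integral>\<^sup>+\<omega>. ennreal (V (interpolant N n k i u \<omega>)) \<partial>Pr)
      \<le> (\<integral>\<^sup>+\<omega>. ennreal (K * (V (euler N n k \<omega> i) + sqmean N (euler N n k \<omega>) powr (p0 / 2))) \<partial>Pr)"
proof -
  obtain c :: "nat \<Rightarrow> real" where c: "\<And>k. c k \<ge> 0" and noise:
    "\<And>h (s :: real ^ 'm ^ 'd) (s0 :: real ^ 'm0 ^ 'd). h > 0 \<Longrightarrow>
      symmetric_noise (gaussian h \<Otimes>\<^sub>M gaussian h) (\<lambda>z. s *v fst z + s0 *v snd z) (h * ((norm s)\<^sup>2 + (norm s0)\<^sup>2)) c"
    using gaussian_symmetric_noise by blast
  define C1 where "C1 = 4 * growth_const\<^sup>2 + 5 * growth_const + 2 * L"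
  have C1: "C1 \<ge> 0" using growth_const_pos L by (simp add: C1_def)
  define m where "m = nat \<lceil>p0 / 2\<rceil>"
  have m: "0 \<le> p0 / 2" "p0 / 2 \<le> real m" using p0 by (auto simp: m_def)
  define K where "K = 9 powr (p0 / 2) * (3 + c m) * ((1 + C1) powr (p0 / 2) * 3 powr (p0 / 2))"
  have K: "K > 0" unfolding K_def using c[of m] C1 by (intro mult_pos_pos) auto
  show ?thesis
  proof (rule that[OF K])
    fix N n i k :: nat and u :: real
    assume N: "N \<ge> 1" and n: "n \<ge> 1" and i: "i \<in> {1..N}" and u: "real k / real n < u" "u \<le> real (Suc k) / real n" "u \<le> T"
    define s where "s = real k / real n"
    define h where "h = u - s"
    have n0: "real n \<ge> 1" using n by simp
    have h: "0 < h" "h \<le> 1 / real n" using u by (auto simp: h_def s_def add_divide_distrib)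
    have sT: "s \<in> {0..T}" using u by (auto simp: s_def)
    have inner: "(\<integral>\<^sup>+\<zeta>. ennreal (V (estep N n s y i h (fst \<zeta>) (snd \<zeta>))) \<partial>(gaussian h \<Otimes>\<^sub>M gaussian h))
      \<le> ennreal (K * (V (y i) + sqmean N y powr (p0 / 2)))" for y :: "nat \<Rightarrow> real ^ 'd"
    proof -
      define q where "q = sqmean N y"
      have q: "q \<ge> 0" unfolding q_def by (rule sqmean_nonneg)
      define A where "A = 1 + (norm (y i))\<^sup>2"
      have A: "A \<ge> 1" by (simp add: A_def)
      define \<beta> where "\<beta> = tamed n \<rho> b s (y i) (empirical_measure N y)"
      define S where "S = (norm (tamed n \<rho> \<sigma> s (y i) (empirical_measure N y)))\<^sup>2 + (norm (tamed n \<rho> \<sigma>0 s (y i) (empirical_measure N y)))\<^sup>2"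
      have S0: "S \<ge> 0" by (simp add: S_def)
      note bd = tamed_coefficient_bounds[OF sT n empirical_measure_P2[OF N] sqmean_bound[OF N], of "y i" y]
      have b2: "(norm \<beta>)\<^sup>2 \<le> C1 * (real n * A + q)" using bd(2) by (simp add: \<beta>_def C1_def A_def q_def)
      have S2: "S \<le> C1 * (sqrt (real n) * A + q)" using bd(3) by (simp add: S_def C1_def A_def q_def)
      interpret N: symmetric_noise "gaussian h \<Otimes>\<^sub>M gaussian h"
          "\<lambda>\<zeta>. tamed n \<rho> \<sigma> s (y i) (empirical_measure N y) *v fst \<zeta> + tamed n \<rho> \<sigma>0 s (y i) (empirical_measure N y) *v snd \<zeta>" "h * S" c
        unfolding S_def by (rule noise[OF h(1)])
      \<comment> \<open>One scale for position, drift and noise: h n <= 1 and h <= 1 absorb the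
        factors n and sqrt n of the coefficient bounds.\<close>
      define D where "D = (1 + C1) * (A + q)"
      have CD: "C1 * (A + q) \<le> D" "A + q \<le> D" using C1 A q by (auto simp: D_def distrib_right)
      have hn: "h * real n \<le> 1" using h n0 by (simp add: le_divide_eq)
      have h1: "h \<le> 1" using hn h n0 by (smt (verit) mult_left_le mult_le_cancel_left1)
      have "(norm (h *\<^sub>R \<beta>))\<^sup>2 = h\<^sup>2 * (norm \<beta>)\<^sup>2" by (simp add: power_mult_distrib)
      also have "\<dots> \<le> h\<^sup>2 * (C1 * (real n * A + q))" using b2 by (intro mult_left_mono) auto
      also have "\<dots> = C1 * ((h * (h * real n)) * A + h\<^sup>2 * q)" by (simp add: power2_eq_square algebra_simps)
      also have "\<dots> \<le> C1 * (1 * A + 1 * q)"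
      proof (intro mult_left_mono add_mono mult_right_mono)
        show "h * (h * real n) \<le> 1" by (rule mult_le_one[OF h1 _ hn]) (use h in simp)
        show "h\<^sup>2 \<le> 1" using h1 h by (intro power_le_one) auto
      qed (use C1 A q in auto)
      finally have D2: "(norm (h *\<^sub>R \<beta>))\<^sup>2 \<le> D" using CD by simp
      have sn: "sqrt (real n) \<le> real n"
        using n0 mult_left_mono[of 1 "sqrt (real n)" "sqrt (real n)"] by simp
      have "h * S \<le> h * (C1 * (sqrt (real n) * A + q))" using S2 h by (intro mult_left_mono) auto
      also have "\<dots> = C1 * ((h * sqrt (real n)) * A + h * q)" by (simp add: algebra_simps)
      also have "\<dots> \<le> C1 * (1 * A + 1 * q)"
      proof (intro mult_left_mono add_mono mult_right_mono)
        have "h * sqrt (real n) \<le> h * real n" using sn h by (intro mult_left_mono) auto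
        then show "h * sqrt (real n) \<le> 1" using hn by linarith
      qed (use C1 A q h1 in auto)
      finally have D3: "h * S \<le> D" using CD by simp
      have D1: "1 + (norm (y i))\<^sup>2 \<le> D" using CD q by (simp add: A_def)
      have "(\<integral>\<^sup>+\<zeta>. ennreal (V (estep N n s y i h (fst \<zeta>) (snd \<zeta>))) \<partial>(gaussian h \<Otimes>\<^sub>M gaussian h))
          \<le> ennreal (9 powr (p0 / 2) * (3 + c m) * D powr (p0 / 2))"
        using N.crude_moment_bound[OF D1 D2 D3 m] by (simp add: tamed_step_def \<beta>_def add.assoc)
      also have "\<dots> \<le> ennreal (K * (V (y i) + q powr (p0 / 2)))"
      proof (rule ennreal_leI)
        have "D powr (p0 / 2) = (1 + C1) powr (p0 / 2) * (A + q + 0) powr (p0 / 2)" by (simp add: D_def powr_mult)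
        also have "\<dots> \<le> (1 + C1) powr (p0 / 2) * (3 powr (p0 / 2) * (A powr (p0 / 2) + q powr (p0 / 2) + 0 powr (p0 / 2)))"
          using A q p0 by (intro mult_left_mono powr_add3_le) auto
        finally have "9 powr (p0 / 2) * (3 + c m) * D powr (p0 / 2) \<le> 9 powr (p0 / 2) * (3 + c m) * ((1 + C1) powr (p0 / 2) * (3 powr (p0 / 2) * (A powr (p0 / 2) + q powr (p0 / 2))))"
          using c[of m] p0 by (intro mult_left_mono) auto
        then show "9 powr (p0 / 2) * (3 + c m) * D powr (p0 / 2) \<le> K * (V (y i) + q powr (p0 / 2))"
          by (simp add: K_def A_def mult_ac)
      qed
      finally show ?thesis by (simp add: q_def)
    qed
    have "(\<integral>\<^sup>+\<omega>. ennreal (V (estep N n s (euler N n k \<omega>) i (u - s) (W i u (snd \<omega>) - W i s (snd \<omega>)) (W0 u (fst \<omega>) - W0 s (fst \<omega>)))) \<partial>Pr)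
      = (\<integral>\<^sup>+\<omega>. ennreal (V (estep N n s (euler N n k \<omega>) i (u - s) (W i u (snd \<omega>) - W i s (snd \<omega>)) (W0 u (fst \<omega>) - W0 s (fst \<omega>)))) * indicator (space (fil s)) \<omega> \<partial>Pr)"
      using sT by (intro nn_integral_cong) (simp add: fil_space)
    also have "\<dots> = (\<integral>\<^sup>+\<omega>. (\<integral>\<^sup>+\<zeta>. ennreal (V (estep N n s (euler N n k \<omega>) i h (fst \<zeta>) (snd \<zeta>))) \<partial>(gaussian h \<Otimes>\<^sub>M gaussian h)) * indicator (space (fil s)) \<omega> \<partial>Pr)"
      unfolding s_def h_def by (rule estep_expectation[OF N n i u(1,3) _ V_measurable]) simp
    also have "\<dots> \<le> (\<integral>\<^sup>+\<omega>. ennreal (K * (V (euler N n k \<omega> i) + sqmean N (euler N n k \<omega>) powr (p0 / 2))) \<partial>Pr)"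
      using inner by (intro nn_integral_mono) (auto simp: indicator_def)
    finally show "(\<integral>\<^sup>+\<omega>. ennreal (V (interpolant N n k i u \<omega>)) \<partial>Pr)
      \<le> (\<integral>\<^sup>+\<omega>. ennreal (K * (V (euler N n k \<omega> i) + sqmean N (euler N n k \<omega>) powr (p0 / 2))) \<partial>Pr)"
      unfolding s_def .
  qed
qed

end

text \<open>The exponent b = a a' / (a' - a) solves 1 / a = 1 / a' + 1 / b. Comparing the two
  factors directly gives the inequality with constant 1. The gap between a and a' leaves room for a
  high moment of the noise next to the moment a' of the state.\<close>

lemma powr_mult_young:
  fixes u v :: real
  assumes u: "u > 0" and v: "v > 0" and a: "0 < a" "a < a'"
  shows "(u * v) powr a \<le> u powr a' + v powr (a * a' / (a' - a))"
proof (cases "v powr a \<le> u powr (a' - a)")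
  case True
  have "(u * v) powr a = u powr a * v powr a" by (rule powr_mult)
  also have "\<dots> \<le> u powr a * u powr (a' - a)" using True by (intro mult_left_mono) auto
  also have "\<dots> = u powr a'" by (simp add: powr_add[symmetric])
  finally show ?thesis by (simp add: add_increasing2)
next
  case False
  then have "(u powr (a' - a)) powr (a / (a' - a)) \<le> (v powr a) powr (a / (a' - a))"
    using a by (intro powr_mono2) auto
  then have "u powr a \<le> v powr (a * (a / (a' - a)))" using a by (simp add: powr_powr)
  then have "u powr a * v powr a \<le> v powr (a * (a / (a' - a))) * v powr a" by (intro mult_right_mono) auto
  also have "\<dots> = v powr (a * a' / (a' - a))"
  proof -
    have "a * (a / (a' - a)) + a = a * a' / (a' - a)" using a by (simp add: field_simps)
    then show ?thesis by (simp add: powr_add[symmetric])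
  qed
  finally show ?thesis by (simp add: powr_mult add_increasing)
qed

lemma ennreal_affine:
  "0 \<le> a \<Longrightarrow> 0 \<le> v \<Longrightarrow> 0 \<le> w \<Longrightarrow> ennreal (v + a * (v + w)) = ennreal v + ennreal a * (ennreal v + ennreal w)"
  by (simp add: ennreal_mult)

section \<open>Moments and maxima along the grid\<close>

context tamed_particles
begin

lemma nn_integral_Pr_snd: "f \<in> borel_measurable M1 \<Longrightarrow> (\<integral>\<^sup>+\<omega>. f (snd \<omega>) \<partial>Pr) = (\<integral>\<^sup>+\<omega>. f \<omega> \<partial>M1)"
  by (subst M1.nn_integral_fst[symmetric]) (auto simp: M0.emeasure_space_1)

lemma nn_integral_Pr_fst: "f \<in> borel_measurable M0 \<Longrightarrow> (\<integral>\<^sup>+\<omega>. f (fst \<omega>) \<partial>Pr) = (\<integral>\<^sup>+\<omega>. f \<omega> \<partial>M0)"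
  by (subst M1.nn_integral_fst[symmetric]) (auto simp: M1.emeasure_space_1)

lemma AE_Pr_snd:
  assumes "AE \<omega> in M1. Q \<omega>"
  shows "AE \<omega> in Pr. Q (snd \<omega>)"
proof -
  obtain N where N: "{\<omega> \<in> space M1. \<not> Q \<omega>} \<subseteq> N" "N \<in> null_sets M1" using assms by (auto simp: eventually_ae_filter)
  have "space M0 \<times> N \<in> null_sets Pr"
    using N(2) by (intro null_setsI) (auto simp: M1.emeasure_pair_measure_Times null_sets_def)
  then show ?thesis by (rule AE_I') (use N(1) in \<open>auto simp: space_pair_measure\<close>)
qed

lemma AE_Pr_fst:
  assumes "AE \<omega> in M0. Q \<omega>"
  shows "AE \<omega> in Pr. Q (fst \<omega>)"
proof -
  obtain N where N: "{\<omega> \<in> space M0. \<not> Q \<omega>} \<subseteq> N" "N \<in> null_sets M0" using assms by (auto simp: eventually_ae_filter)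
  have "N \<times> space M1 \<in> null_sets Pr"
    using N(2) by (intro null_setsI) (auto simp: M1.emeasure_pair_measure_Times null_sets_def)
  then show ?thesis by (rule AE_I') (use N(1) in \<open>auto simp: space_pair_measure\<close>)
qed

lemma initial_moment:
  obtains B where "B \<ge> 0" "\<And>i. i \<ge> 1 \<Longrightarrow> (\<integral>\<^sup>+\<omega>. ennreal (V (\<xi> i (snd \<omega>))) \<partial>Pr) \<le> ennreal B"
proof -
  have [measurable]: "X0 \<in> borel_measurable M1" by (rule X0)
  define c where "c = (3 powr (p0 / 2) :: real)"
  define B where "B = c * (1 + (\<integral>\<omega>. norm (X0 \<omega>) powr p0 \<partial>M1))"
  have B: "B \<ge> 0" by (auto simp: B_def c_def intro!: mult_nonneg_nonneg add_nonneg_nonneg Bochner_Integration.integral_nonneg)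
  have pw: "V x \<le> c * (1 + norm x powr p0)" for x
  proof -
    have "((norm x)\<^sup>2) powr (p0 / 2) = norm x powr p0"
    proof (cases "x = 0")
      case False
      then have "(norm x)\<^sup>2 = norm x powr 2" using powr_realpow[of "norm x" 2] by simp
      then have "((norm x)\<^sup>2) powr (p0 / 2) = norm x powr (2 * (p0 / 2))" by (simp only: powr_powr)
      then show ?thesis by simp
    qed simp
    then show ?thesis using powr_add3_le[of 1 "(norm x)\<^sup>2" 0 "p0 / 2"] p0 by (simp add: c_def)
  qed
  show ?thesis
  proof (rule that[OF B])
    fix i :: nat assume i: "i \<ge> 1"
    have [measurable]: "\<xi> i \<in> borel_measurable M1"
      using usual_filtration_measurable[OF F1 _ \<xi>[OF i]] T by simp
    have "(\<integral>\<^sup>+\<omega>. ennreal (V (\<xi> i (snd \<omega>))) \<partial>Pr) = (\<integral>\<^sup>+\<omega>. ennreal (V (\<xi> i \<omega>)) \<partial>M1)"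
      by (rule nn_integral_Pr_snd) measurable
    also have "\<dots> = (\<integral>\<^sup>+x. ennreal (V x) \<partial>distr M1 borel (\<xi> i))" by (rule nn_integral_distr[symmetric]) measurable
    also have "\<dots> = (\<integral>\<^sup>+\<omega>. ennreal (V (X0 \<omega>)) \<partial>M1)" unfolding \<xi>_law[OF i] by (rule nn_integral_distr) measurable
    also have "\<dots> \<le> (\<integral>\<^sup>+\<omega>. ennreal (c * (1 + norm (X0 \<omega>) powr p0)) \<partial>M1)" by (intro nn_integral_mono ennreal_leI pw)
    also have "\<dots> = ennreal (\<integral>\<omega>. c * (1 + norm (X0 \<omega>) powr p0) \<partial>M1)"
      using X0_moment by (intro nn_integral_eq_integral) (auto simp: c_def)
    also have "\<dots> = ennreal B" using X0_moment by (simp add: B_def M1.prob_space)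
    finally show "(\<integral>\<^sup>+\<omega>. ennreal (V (\<xi> i (snd \<omega>))) \<partial>Pr) \<le> ennreal B" .
  qed
qed

text \<open>By Jensen's inequality the interaction term has the same bound as the worst single
  particle. This closes the estimate uniformly in N.\<close>

lemma sqmean_moment:
  assumes N: "N \<ge> 1" and n: "n \<ge> 1" and k: "real k / real n \<le> T" and C: "C \<ge> 0"
    and m: "\<And>j. j \<in> {1..N} \<Longrightarrow> (\<integral>\<^sup>+\<omega>. ennreal (V (euler N n k \<omega> j)) \<partial>Pr) \<le> ennreal C"
  shows "(\<integral>\<^sup>+\<omega>. ennreal (sqmean N (euler N n k \<omega>) powr (p0 / 2)) \<partial>Pr) \<le> ennreal C"
proof -
  note [measurable] = euler_measurable_Pr[OF N n k]
  have "(\<integral>\<^sup>+\<omega>. ennreal (sqmean N (euler N n k \<omega>) powr (p0 / 2)) \<partial>Pr)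
      \<le> (\<integral>\<^sup>+\<omega>. ennreal (1 / real N) * (\<Sum>j=1..N. ennreal (V (euler N n k \<omega> j))) \<partial>Pr)"
    using powr_mean_le[OF N, of "p0 / 2"] p0
    by (intro nn_integral_mono) (auto simp: sum_ennreal ennreal_mult[symmetric] sum_nonneg intro!: ennreal_leI)
  also have "\<dots> = ennreal (1 / real N) * (\<Sum>j=1..N. \<integral>\<^sup>+\<omega>. ennreal (V (euler N n k \<omega> j)) \<partial>Pr)"
    by (simp add: nn_integral_cmult nn_integral_sum del: sum_ennreal)
  also have "\<dots> \<le> ennreal (1 / real N) * (\<Sum>j=1..N. ennreal C)"
    by (intro mult_left_mono sum_mono m) auto
  also have "\<dots> = ennreal C"
    using N C by (simp add: ennreal_of_nat_eq_real_of_nat ennreal_mult[symmetric])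
  finally show ?thesis .
qed

text \<open>Discrete Gronwall for all particles at once: the induction hypothesis is needed for
  every index, since the mean of the squared norms involves them all.\<close>

lemma euler_moment:
  obtains B where "B > 0"
    "\<And>N n k i. N \<ge> 1 \<Longrightarrow> n \<ge> 1 \<Longrightarrow> i \<in> {1..N} \<Longrightarrow> real k / real n \<le> T \<Longrightarrow> (\<integral>\<^sup>+\<omega>. ennreal (V (euler N n k \<omega> i)) \<partial>Pr) \<le> ennreal B"
proof -
  obtain B0 where B0: "B0 \<ge> 0" and init: "\<And>i. i \<ge> 1 \<Longrightarrow> (\<integral>\<^sup>+\<omega>. ennreal (V (\<xi> i (snd \<omega>))) \<partial>Pr) \<le> ennreal B0"
    using initial_moment by blast
  show ?thesis
  proof (rule grid_step_expectation, goal_cases)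
    case (1 K)
    note K = 1(1) and step = 1(2)
    \<comment> \<open>The added 1 only makes B positive when the initial bound vanishes.\<close>
    define B where "B = B0 * exp (2 * K * T) + 1"
    have B: "B > 0" using B0 by (simp add: B_def add_nonneg_pos)
    show ?thesis
    proof (rule that[OF B])
      fix N n k i :: nat
      assume N: "N \<ge> 1" and n: "n \<ge> 1" and i: "i \<in> {1..N}" and k: "real k / real n \<le> T"
      have n0: "real n > 0" using n by simp
      \<comment> \<open>Each step multiplies the bound by 1 + 2 K / n: once K / n for the particle
        itself, once for the mean. Since k <= n T, the product stays below exp (2 K T).\<close>
      define e where "e k = B0 * (1 + 2 * K / real n) ^ k" for k
      have e0: "e k \<ge> 0" for k using B0 K n0 by (simp add: e_def)
      have "(\<integral>\<^sup>+\<omega>. ennreal (V (euler N n k \<omega> i)) \<partial>Pr) \<le> ennreal (e k)"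
        using i k
      proof (induction k arbitrary: i)
        case 0
        then show ?case using init[of i] by (simp add: e_def)
      next
        case (Suc k)
        have "real k / real n \<le> real (Suc k) / real n" by (intro divide_right_mono) auto
        then have kT: "real k / real n \<le> T" using Suc.prems by linarith
        then have sT: "real k / real n \<in> {0..T}" by simp
        note [measurable] = euler_measurable_Pr[OF N n kT]
        have IH: "\<And>j. j \<in> {1..N} \<Longrightarrow> (\<integral>\<^sup>+\<omega>. ennreal (V (euler N n k \<omega> j)) \<partial>Pr) \<le> ennreal (e k)"
          using Suc.IH kT by blast
        have "(\<integral>\<^sup>+\<omega>. ennreal (V (euler N n (Suc k) \<omega> i)) \<partial>Pr)
            = (\<integral>\<^sup>+\<omega>. ennreal (V (euler N n (Suc k) \<omega> i)) * indicator (space (fil (real k / real n))) \<omega> \<partial>Pr)"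
          by (intro nn_integral_cong) (simp add: fil_space[OF sT])
        also have "\<dots> \<le> (\<integral>\<^sup>+\<omega>. ennreal (V (euler N n k \<omega> i) + K / real n * (V (euler N n k \<omega> i) + sqmean N (euler N n k \<omega>) powr (p0 / 2))) * indicator (space (fil (real k / real n))) \<omega> \<partial>Pr)"
          by (rule step[OF N n Suc.prems]) simp
        also have "\<dots> = (\<integral>\<^sup>+\<omega>. ennreal (V (euler N n k \<omega> i)) + ennreal (K / real n) * (ennreal (V (euler N n k \<omega> i)) + ennreal (sqmean N (euler N n k \<omega>) powr (p0 / 2))) \<partial>Pr)"
        proof (intro nn_integral_cong)
          fix \<omega> assume "\<omega> \<in> space Pr"
          then have i1: "indicator (space (fil (real k / real n))) \<omega> = (1 :: ennreal)" by (simp add: fil_space[OF sT])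
          show "ennreal (V (euler N n k \<omega> i) + K / real n * (V (euler N n k \<omega> i) + sqmean N (euler N n k \<omega>) powr (p0 / 2))) * indicator (space (fil (real k / real n))) \<omega>
            = ennreal (V (euler N n k \<omega> i)) + ennreal (K / real n) * (ennreal (V (euler N n k \<omega> i)) + ennreal (sqmean N (euler N n k \<omega>) powr (p0 / 2)))"
            unfolding i1 mult_1_right using K n0 by (intro ennreal_affine) auto
        qed
        also have "\<dots> = (\<integral>\<^sup>+\<omega>. ennreal (V (euler N n k \<omega> i)) \<partial>Pr) + ennreal (K / real n) * ((\<integral>\<^sup>+\<omega>. ennreal (V (euler N n k \<omega> i)) \<partial>Pr) + (\<integral>\<^sup>+\<omega>. ennreal (sqmean N (euler N n k \<omega>) powr (p0 / 2)) \<partial>Pr))"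
          by (simp add: nn_integral_add nn_integral_cmult)
        also have "\<dots> \<le> ennreal (e k) + ennreal (K / real n) * (ennreal (e k) + ennreal (e k))"
          using Suc.prems(1) by (intro add_mono mult_left_mono IH sqmean_moment[OF N n kT e0]) auto
        also have "\<dots> = ennreal (e k + K / real n * (e k + e k))"
          using K n0 e0[of k] by (intro ennreal_affine[symmetric]) auto
        also have "e k + K / real n * (e k + e k) = e (Suc k)"
          by (simp add: e_def algebra_simps)
        finally show ?case .
      qed
      also have "\<dots> \<le> ennreal B"
      proof (rule ennreal_leI)
        have "(1 + 2 * K / real n) ^ k \<le> exp (2 * K / real n) ^ k"
          using K n0 by (intro power_mono exp_ge_add_one_self) auto
        also have "\<dots> = exp (2 * K * (real k / real n))" by (simp add: exp_of_nat_mult[symmetric] field_simps)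
        also have "\<dots> \<le> exp (2 * K * T)"
          unfolding exp_le_cancel_iff using k K by (intro mult_left_mono) auto
        finally have "e k \<le> B0 * exp (2 * K * T)" unfolding e_def using B0 by (intro mult_left_mono)
        then show "e k \<le> B" by (simp add: B_def)
      qed
      finally show "(\<integral>\<^sup>+\<omega>. ennreal (V (euler N n k \<omega> i)) \<partial>Pr) \<le> ennreal B" .
    qed
  qed
qed

text \<open>With the moment bound B known, the error of each step is at most 2 K B / n, and over at
  most n T steps these errors add up to 2 K B T. The maximal inequality then gives a tail C / l with
  C independent of N and n, and hence all powers \<delta> < 1.\<close>

lemma euler_maximum_moment:
  assumes \<delta>: "0 < \<delta>" "\<delta> < 1"
  obtains B where "B > 0"
    "\<And>N n k i. N \<ge> 1 \<Longrightarrow> n \<ge> 1 \<Longrightarrow> i \<in> {1..N} \<Longrightarrow> real k / real n \<le> T \<Longrightarrow>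
      (\<integral>\<^sup>+\<omega>. ennreal (Max ((\<lambda>j. V (euler N n j \<omega> i)) ` {..k}) powr \<delta>) \<partial>Pr) \<le> ennreal B"
proof -
  obtain B where B: "B > 0" and mom: "\<And>N n k i. N \<ge> 1 \<Longrightarrow> n \<ge> 1 \<Longrightarrow> i \<in> {1..N} \<Longrightarrow> real k / real n \<le> T \<Longrightarrow> (\<integral>\<^sup>+\<omega>. ennreal (V (euler N n k \<omega> i)) \<partial>Pr) \<le> ennreal B"
    using euler_moment by blast
  show ?thesis
  proof (rule grid_step_expectation, goal_cases)
    case (1 K)
    note K = 1(1) and step = 1(2)
    define C where "C = B + 2 * K * B * T"
    have C: "C \<ge> 0" using B K T by (simp add: C_def)
    have q: "2 powr (\<delta> - 1) < (1::real)" using \<delta> powr_less_mono[of "\<delta> - 1" 0 2] by simp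
    have "1 + C * (2 powr \<delta> / (1 - 2 powr (\<delta> - 1))) > 0" using C q by (intro add_pos_nonneg) auto
    then show ?thesis
    proof (rule that)
      fix N n k i :: nat
      assume N: "N \<ge> 1" and n: "n \<ge> 1" and i: "i \<in> {1..N}" and k: "real k / real n \<le> T"
      have n0: "real n > 0" using n by simp
      have jT: "real j / real n \<le> T" if "j \<le> k" for j
      proof -
        have "real j / real n \<le> real k / real n" using that by (intro divide_right_mono) auto
        then show ?thesis using k by linarith
      qed
      \<comment> \<open>Frozen after step k, because the maximal inequality is stated for sequences
        indexed by all natural numbers.\<close>
      define U where "U j \<omega> = ennreal (V (euler N n (min j k) \<omega> i))" for j \<omega>
      have Um [measurable]: "U j \<in> borel_measurable Pr" for j
      proof -
        note [measurable] = euler_measurable_Pr[OF N n jT[of "min j k"]]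
        show ?thesis unfolding U_def by measurable
      qed
      define Mx where "Mx \<omega> = Max ((\<lambda>j. V (euler N n j \<omega> i)) ` {..k})" for \<omega>
      have Mm [measurable]: "Mx \<in> borel_measurable Pr"
      proof -
        have "(\<lambda>\<omega>. V (euler N n j \<omega> i)) \<in> borel_measurable Pr" if "j \<le> k" for j
        proof -
          note [measurable] = euler_measurable_Pr[OF N n jT[OF that]]
          show ?thesis by measurable
        qed
        then show ?thesis unfolding Mx_def by (intro borel_measurable_Max) auto
      qed
      have M0: "Mx \<omega> \<ge> 0" for \<omega>
      proof -
        have "V (euler N n 0 \<omega> i) \<le> Mx \<omega>" unfolding Mx_def by (rule Max_ge) (auto simp del: euler.simps)
        then show ?thesis using powr_ge_zero by (rule order_trans[rotated])
      qed
      have tail: "ennreal l * emeasure Pr {\<omega>\<in>space Pr. l \<le> Mx \<omega>} \<le> ennreal C" if l: "l > 0" for l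
      proof -
        have "ennreal l * emeasure Pr {\<omega>\<in>space Pr. \<exists>j\<le>k. ennreal l \<le> U j \<omega>}
          \<le> (\<integral>\<^sup>+\<omega>. U 0 \<omega> \<partial>Pr) + of_nat k * ennreal (2 * K * B / real n)"
        proof (rule maximal_almost_supermartingale[OF Um])
          fix j assume j: "j < k"
          define A where "A = {\<omega>\<in>space Pr. \<forall>i\<le>j. U i \<omega> < ennreal l}"
          have jT': "real j / real n \<le> T" "real (Suc j) / real n \<le> T" using j by (auto intro!: jT simp del: of_nat_Suc)
          then have sT: "real j / real n \<in> {0..T}" by simp
          have "A \<in> sets (fil (real j / real n))"
          proof -
            have "U l \<in> borel_measurable (fil (real j / real n))" if "l \<le> j" for l
            proof -
              have "0 \<le> real l / real n" "real l / real n \<le> real j / real n" using that by (auto intro: divide_right_mono)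
              then have [measurable]: "(\<lambda>\<omega>. euler N n l \<omega> i) \<in> borel_measurable (fil (real j / real n))"
                using jT' by (intro fil_mono[OF _ _ _ euler_measurable[OF N n]]) auto
              have "min l k = l" using that j by simp
              then show ?thesis unfolding U_def by simp
            qed
            then have "{\<omega>\<in>space (fil (real j / real n)). \<forall>i\<in>{..j}. U i \<omega> < ennreal l} \<in> sets (fil (real j / real n))"
              by (intro sets.sets_Collect_finite_All) (auto intro: borel_measurable_less)
            also have "{\<omega>\<in>space (fil (real j / real n)). \<forall>i\<in>{..j}. U i \<omega> < ennreal l} = A"
              by (auto simp: A_def fil_space[OF sT])
            finally show ?thesis .
          qed
          note AF = this
          have [measurable]: "A \<in> sets Pr" by (rule fil_sets[OF sT AF])
          note [measurable] = euler_measurable_Pr[OF N n jT'(1)]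
          have "(\<integral>\<^sup>+\<omega>. U (Suc j) \<omega> * indicator A \<omega> \<partial>Pr)
            \<le> (\<integral>\<^sup>+\<omega>. ennreal (V (euler N n j \<omega> i) + K / real n * (V (euler N n j \<omega> i) + sqmean N (euler N n j \<omega>) powr (p0 / 2))) * indicator A \<omega> \<partial>Pr)"
            using step[OF N n i jT'(2) AF] j by (simp add: U_def min_absorb1 Suc_leI del: euler.simps)
          \<comment> \<open>The leading term keeps the event A; the error term is enlarged to the
            whole space, where its expectation is already bounded.\<close>
          also have "\<dots> \<le> (\<integral>\<^sup>+\<omega>. U j \<omega> * indicator A \<omega> + ennreal (K / real n) * (ennreal (V (euler N n j \<omega> i)) + ennreal (sqmean N (euler N n j \<omega>) powr (p0 / 2))) \<partial>Pr)"
          proof (rule nn_integral_mono)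
            fix \<omega>
            have "min j k = j" using j by simp
            moreover have "ennreal (V (euler N n j \<omega> i) + K / real n * (V (euler N n j \<omega> i) + sqmean N (euler N n j \<omega>) powr (p0 / 2)))
                = ennreal (V (euler N n j \<omega> i)) + ennreal (K / real n) * (ennreal (V (euler N n j \<omega> i)) + ennreal (sqmean N (euler N n j \<omega>) powr (p0 / 2)))"
              using K n0 by (intro ennreal_affine) auto
            ultimately show "ennreal (V (euler N n j \<omega> i) + K / real n * (V (euler N n j \<omega> i) + sqmean N (euler N n j \<omega>) powr (p0 / 2))) * indicator A \<omega>
              \<le> U j \<omega> * indicator A \<omega> + ennreal (K / real n) * (ennreal (V (euler N n j \<omega> i)) + ennreal (sqmean N (euler N n j \<omega>) powr (p0 / 2)))"
              unfolding U_def by (cases "\<omega> \<in> A") (simp_all only: indicator_simps simp_thms mult_1_right mult_zero_right order_refl zero_le)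
          qed
          also have "\<dots> = (\<integral>\<^sup>+\<omega>. U j \<omega> * indicator A \<omega> \<partial>Pr) + ennreal (K / real n) * ((\<integral>\<^sup>+\<omega>. ennreal (V (euler N n j \<omega> i)) \<partial>Pr) + (\<integral>\<^sup>+\<omega>. ennreal (sqmean N (euler N n j \<omega>) powr (p0 / 2)) \<partial>Pr))"
            by (simp add: nn_integral_add nn_integral_cmult)
          also have "\<dots> \<le> (\<integral>\<^sup>+\<omega>. U j \<omega> * indicator A \<omega> \<partial>Pr) + ennreal (K / real n) * (ennreal B + ennreal B)"
            using B by (intro add_left_mono mult_left_mono add_mono mom[OF N n i jT'(1)] sqmean_moment[OF N n jT'(1)] mom[OF N n _ jT'(1)]) auto
          also have "ennreal (K / real n) * (ennreal B + ennreal B) = ennreal (2 * K * B / real n)"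
          proof -
            have "ennreal (K / real n) * (ennreal B + ennreal B) = ennreal (K / real n * (B + B))"
              using K B n0 ennreal_mult[of "K / real n" "B + B"] ennreal_plus[of B B] by (simp only: less_imp_le divide_nonneg_pos add_nonneg_nonneg)
            also have "K / real n * (B + B) = 2 * K * B / real n" by (simp add: field_simps)
            finally show ?thesis .
          qed
          finally show "(\<integral>\<^sup>+\<omega>. U (Suc j) \<omega> * indicator {\<omega>\<in>space Pr. \<forall>i\<le>j. U i \<omega> < ennreal l} \<omega> \<partial>Pr)
            \<le> (\<integral>\<^sup>+\<omega>. U j \<omega> * indicator {\<omega>\<in>space Pr. \<forall>i\<le>j. U i \<omega> < ennreal l} \<omega> \<partial>Pr) + ennreal (2 * K * B / real n)"
            unfolding A_def .
        qed
        also have "(\<integral>\<^sup>+\<omega>. U 0 \<omega> \<partial>Pr) \<le> ennreal B"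
          unfolding U_def using mom[OF N n i jT[of 0]] by simp
        also have "of_nat k * ennreal (2 * K * B / real n) = ennreal (2 * K * B * (real k / real n))"
          using K B n0 by (simp add: ennreal_of_nat_eq_real_of_nat ennreal_mult[symmetric] field_simps)
        also have "ennreal B + ennreal (2 * K * B * (real k / real n)) = ennreal (B + 2 * K * B * (real k / real n))"
          using K B by (intro ennreal_plus[symmetric]) auto
        also have "\<dots> \<le> ennreal C"
          unfolding C_def using k K B by (intro ennreal_leI add_left_mono mult_left_mono) auto
        also have "{\<omega>\<in>space Pr. \<exists>j\<le>k. ennreal l \<le> U j \<omega>} = {\<omega>\<in>space Pr. l \<le> Mx \<omega>}"
        proof -
          have "(\<exists>j\<le>k. ennreal l \<le> U j \<omega>) \<longleftrightarrow> l \<le> Mx \<omega>" for \<omega>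
          proof -
            have "l \<le> Mx \<omega> \<longleftrightarrow> (\<exists>j\<le>k. l \<le> V (euler N n j \<omega> i))" unfolding Mx_def by (subst Max_ge_iff) auto
            then show ?thesis unfolding U_def by (auto simp: min_absorb1)
          qed
          then show ?thesis by simp
        qed
        finally show ?thesis by (simp add: add_right_mono)
      qed
      show "(\<integral>\<^sup>+\<omega>. ennreal (Max ((\<lambda>j. V (euler N n j \<omega> i)) ` {..k}) powr \<delta>) \<partial>Pr)
          \<le> ennreal (1 + C * (2 powr \<delta> / (1 - 2 powr (\<delta> - 1))))"
        using nn_integral_powr_le_of_tail[OF PP.prob_space_axioms Mm M0 tail \<delta> C] by (simp add: Mx_def)
    qed
  qed
qed

end

section \<open>Identification of the scheme with the recursion, and moments at fixed times\<close>

context tamed_particles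
begin

text \<open>A single null set serves all particles, cells and times, which the supremum over t
  requires. Induction over the grid identifies the scheme with the recursion; the cell formula then
  extends this to times in between.\<close>

lemma scheme_eq_estep:
  assumes N: "N \<ge> 1" and n: "n \<ge> 1"
    and scheme: "tamed_euler_scheme T M0 M1 \<rho> b \<sigma> \<sigma>0 W0 W \<xi> N n Y"
  shows "AE \<omega> in Pr. \<forall>i\<in>{1..N}. \<forall>k. \<forall>t\<in>{0..T}. real k / real n \<le> t \<longrightarrow> t \<le> real (Suc k) / real n \<longrightarrow>
    Y i t \<omega> = interpolant N n k i t \<omega>"
proof -
  \<comment> \<open>Almost sure statements are the same for a measure and its completion, so the
    argument continues on the plain product.\<close>
  have "AE \<omega> in Pr. \<forall>i\<in>{1..N}. \<forall>t\<in>{0..T}. Y i t \<omega> = \<xi> i (snd \<omega>)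
      + (LINT s:{0..t}|lborel. tamed n \<rho> b (kappa n s) (Y i (kappa n s) \<omega>) (empirical_measure N (\<lambda>j. Y j (kappa n s) \<omega>)))
      + step_ito_integral n (\<lambda>s. tamed n \<rho> \<sigma> (kappa n s) (Y i (kappa n s) \<omega>) (empirical_measure N (\<lambda>j. Y j (kappa n s) \<omega>))) (\<lambda>s. W i s (snd \<omega>)) t
      + step_ito_integral n (\<lambda>s. tamed n \<rho> \<sigma>0 (kappa n s) (Y i (kappa n s) \<omega>) (empirical_measure N (\<lambda>j. Y j (kappa n s) \<omega>))) (\<lambda>s. W0 s (fst \<omega>)) t"
    using scheme unfolding tamed_euler_scheme_def prod_space_def Let_def AE_completion_iff .
  then show ?thesis
  proof eventually_elim
    case (elim \<omega>)
    note eq = elim[rule_format]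
    have cell: "Y i t \<omega> = estep N n (real k / real n) (\<lambda>j. Y j (real k / real n) \<omega>) i (t - real k / real n)
      (W i t (snd \<omega>) - W i (real k / real n) (snd \<omega>)) (W0 t (fst \<omega>) - W0 (real k / real n) (fst \<omega>))"
      if "i \<in> {1..N}" "t \<in> {0..T}" "real k / real n \<le> t" "t \<le> real (Suc k) / real n" for i k t
      using tamed_euler_scheme_cell[OF n that(1) eq that(2-4)] .
    have grid: "\<forall>i\<in>{1..N}. Y i (real k / real n) \<omega> = euler N n k \<omega> i" if "real k / real n \<le> T" for k
      using that
    proof (induction k)
      case 0
      have z: "real 0 / real n \<le> 0" "0 \<le> real (Suc 0) / real n" by auto
      show ?case
      proof
        fix i assume i: "i \<in> {1..N}"
        have t0: "0 \<in> {0..T}" using T by simp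
        have "Y i 0 \<omega> = \<xi> i (snd \<omega>)"
          using eq[OF i t0] set_lebesgue_integral_kappa[OF n z, of "\<lambda>s. tamed n \<rho> b s (Y i s \<omega>) (empirical_measure N (\<lambda>j. Y j s \<omega>))"]
          by (simp add: step_ito_integral_def)
        then show "Y i (real 0 / real n) \<omega> = euler N n 0 \<omega> i" using i by simp
      qed
    next
      case (Suc k)
      have le: "real k / real n \<le> real (Suc k) / real n" by (intro divide_right_mono) auto
      then have IH: "\<forall>i\<in>{1..N}. Y i (real k / real n) \<omega> = euler N n k \<omega> i" using Suc by linarith
      show ?case
      proof
        fix i assume i: "i \<in> {1..N}"
        have "real (Suc k) / real n \<in> {0..T}" using Suc.prems by simp
        from cell[OF i this le order_refl]
        have "Y i (real (Suc k) / real n) \<omega> = estep N n (real k / real n) (\<lambda>j. Y j (real k / real n) \<omega>) i (real (Suc k) / real n - real k / real n)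
          (W i (real (Suc k) / real n) (snd \<omega>) - W i (real k / real n) (snd \<omega>)) (W0 (real (Suc k) / real n) (fst \<omega>) - W0 (real k / real n) (fst \<omega>))" .
        also have "\<dots> = euler N n (Suc k) \<omega> i"
          using tamed_step_cong[of N "\<lambda>j. Y j (real k / real n) \<omega>" "euler N n k \<omega>" i] IH i by (simp del: of_nat_Suc)
        finally show "Y i (real (Suc k) / real n) \<omega> = euler N n (Suc k) \<omega> i" .
      qed
    qed
    show "\<forall>i\<in>{1..N}. \<forall>k. \<forall>t\<in>{0..T}. real k / real n \<le> t \<longrightarrow> t \<le> real (Suc k) / real n \<longrightarrow>
      Y i t \<omega> = interpolant N n k i t \<omega>"
    proof (intro ballI allI impI)
      fix i k t assume h: "i \<in> {1..N}" "t \<in> {0..T}" "real k / real n \<le> t" "t \<le> real (Suc k) / real n"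
      have "real k / real n \<le> T" using h by auto
      then have "\<And>j. j \<in> {1..N} \<Longrightarrow> Y j (real k / real n) \<omega> = euler N n k \<omega> j" using grid by blast
      then show "Y i t \<omega> = interpolant N n k i t \<omega>"
        unfolding cell[OF h] using h(1) by (rule tamed_step_cong)
    qed
  qed
qed

lemma grid_cell:
  assumes n: "n \<ge> 1" and t: "0 \<le> t"
  shows "real (nat \<lfloor>real n * t\<rfloor>) / real n \<le> t" "t \<le> real (Suc (nat \<lfloor>real n * t\<rfloor>)) / real n"
proof -
  have "0 \<le> real n * t" using t by simp
  then have "real (nat \<lfloor>real n * t\<rfloor>) \<le> real n * t" "real n * t \<le> real (Suc (nat \<lfloor>real n * t\<rfloor>))" by linarith+
  then show "real (nat \<lfloor>real n * t\<rfloor>) / real n \<le> t" "t \<le> real (Suc (nat \<lfloor>real n * t\<rfloor>)) / real n"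
    using n by (auto simp: field_simps)
qed

lemma estep_zero: "estep N n t y i 0 0 0 = y i"
  by (simp add: tamed_step_def matrix_vector_mult_def vec_eq_iff)

lemma uniform_moment_bound:
  obtains K where "K > 0"
    "\<And>N n Y i t. N \<ge> 1 \<Longrightarrow> n \<ge> 1 \<Longrightarrow> tamed_euler_scheme T M0 M1 \<rho> b \<sigma> \<sigma>0 W0 W \<xi> N n Y \<Longrightarrow> i \<in> {1..N} \<Longrightarrow> t \<in> {0..T} \<Longrightarrow>
      (\<integral>\<^sup>+\<omega>. ennreal (V (Y i t \<omega>)) \<partial>prod_space M0 M1) \<le> ennreal K"
proof -
  obtain B where B: "B > 0" and mom: "\<And>N n k i. N \<ge> 1 \<Longrightarrow> n \<ge> 1 \<Longrightarrow> i \<in> {1..N} \<Longrightarrow> real k / real n \<le> T \<Longrightarrow> (\<integral>\<^sup>+\<omega>. ennreal (V (euler N n k \<omega> i)) \<partial>Pr) \<le> ennreal B"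
    using euler_moment by blast
  show ?thesis
  proof (rule partial_step_expectation, goal_cases)
    case (1 K)
    note K = 1(1) and step = 1(2)
    have "B + 2 * K * B > 0" using B K by (simp add: add_pos_pos)
    then show ?thesis
    proof (rule that)
      fix N n :: nat and Y and i :: nat and t :: real
      assume N: "N \<ge> 1" and n: "n \<ge> 1" and Y: "tamed_euler_scheme T M0 M1 \<rho> b \<sigma> \<sigma>0 W0 W \<xi> N n Y" and i: "i \<in> {1..N}" and t: "t \<in> {0..T}"
      define k where "k = nat \<lfloor>real n * t\<rfloor>"
      have tk: "real k / real n \<le> t" "t \<le> real (Suc k) / real n" using grid_cell[OF n, of t] t by (auto simp: k_def)
      have kT: "real k / real n \<le> T" using tk t by auto
      note [measurable] = euler_measurable_Pr[OF N n kT]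
      have "(\<integral>\<^sup>+\<omega>. ennreal (V (Y i t \<omega>)) \<partial>prod_space M0 M1) = (\<integral>\<^sup>+\<omega>. ennreal (V (Y i t \<omega>)) \<partial>Pr)"
        by (simp add: prod_space_def nn_integral_completion)
      also have "\<dots> = (\<integral>\<^sup>+\<omega>. ennreal (V (interpolant N n k i t \<omega>)) \<partial>Pr)"
      proof (rule nn_integral_cong_AE)
        show "AE \<omega> in Pr. ennreal (V (Y i t \<omega>)) = ennreal (V (interpolant N n k i t \<omega>))"
          using scheme_eq_estep[OF N n Y] by eventually_elim (use i t tk in auto)
      qed
      also have "\<dots> \<le> ennreal (B + 2 * K * B)"
      \<comment> \<open>At a grid point no time has elapsed and there is no Gaussian increment to
        integrate; the grid moment applies directly.\<close>
      proof (cases "real k / real n = t")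
        case True
        then have "(\<integral>\<^sup>+\<omega>. ennreal (V (interpolant N n k i t \<omega>)) \<partial>Pr) = (\<integral>\<^sup>+\<omega>. ennreal (V (euler N n k \<omega> i)) \<partial>Pr)"
          by (simp add: estep_zero)
        also have "\<dots> \<le> ennreal B" by (rule mom[OF N n i kT])
        also have "\<dots> \<le> ennreal (B + 2 * K * B)" using B K by (intro ennreal_leI) simp
        finally show ?thesis .
      next
        case False
        then have "(\<integral>\<^sup>+\<omega>. ennreal (V (interpolant N n k i t \<omega>)) \<partial>Pr)
          \<le> (\<integral>\<^sup>+\<omega>. ennreal (K * (V (euler N n k \<omega> i) + sqmean N (euler N n k \<omega>) powr (p0 / 2))) \<partial>Pr)"
          using tk t by (intro step[OF N n i]) auto
        also have "\<dots> = (\<integral>\<^sup>+\<omega>. ennreal K * (ennreal (V (euler N n k \<omega> i)) + ennreal (sqmean N (euler N n k \<omega>) powr (p0 / 2))) \<partial>Pr)"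
        proof (rule nn_integral_cong)
          fix \<omega>
          have "0 \<le> V (euler N n k \<omega> i)" "0 \<le> sqmean N (euler N n k \<omega>) powr (p0 / 2)" by (rule powr_ge_zero)+
          then show "ennreal (K * (V (euler N n k \<omega> i) + sqmean N (euler N n k \<omega>) powr (p0 / 2)))
            = ennreal K * (ennreal (V (euler N n k \<omega> i)) + ennreal (sqmean N (euler N n k \<omega>) powr (p0 / 2)))"
            using K by (simp only: ennreal_mult ennreal_plus less_imp_le add_nonneg_nonneg)
        qed
        also have "\<dots> = ennreal K * ((\<integral>\<^sup>+\<omega>. ennreal (V (euler N n k \<omega> i)) \<partial>Pr) + (\<integral>\<^sup>+\<omega>. ennreal (sqmean N (euler N n k \<omega>) powr (p0 / 2)) \<partial>Pr))"
          by (simp add: nn_integral_add nn_integral_cmult)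
        also have "\<dots> \<le> ennreal K * (ennreal B + ennreal B)"
          using B by (intro mult_left_mono add_mono mom[OF N n i kT] sqmean_moment[OF N n kT] mom[OF N n _ kT]) auto
        also have "\<dots> = ennreal (K * (B + B))"
          using K B ennreal_mult[of K "B + B"] ennreal_plus[of B B] by (simp only: less_imp_le add_nonneg_nonneg)
        also have "\<dots> \<le> ennreal (B + 2 * K * B)" using B by (intro ennreal_leI) (simp add: algebra_simps)
        finally show ?thesis .
      qed
      finally show "(\<integral>\<^sup>+\<omega>. ennreal (V (Y i t \<omega>)) \<partial>prod_space M0 M1) \<le> ennreal (B + 2 * K * B)" .
    qed
  qed
qed

text \<open>A pathwise bound in product form: a factor for the state and one for the noise, to be
  separated by Young's inequality. The weight sqrt n is the size of the squared diffusion relative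
  to the state; as the squared increments are of order 1 / n, the noise factor keeps bounded
  moments.\<close>

lemma estep_norm_bound:
  assumes t: "t \<in> {0..T}" and N: "N \<ge> 1" and n: "n \<ge> 1" and h: "0 \<le> h" "h \<le> 1 / real n"
  shows "1 + (norm (estep N n t y i h z z0))\<^sup>2 \<le> 4 * (1 + (4 * growth_const\<^sup>2 + 5 * growth_const + 2 * L))
    * ((1 + (norm (y i))\<^sup>2 + sqmean N y) * (1 + sqrt (real n) * (norm z)\<^sup>2 + sqrt (real n) * (norm z0)\<^sup>2))"
proof -
  define C where "C = 4 * growth_const\<^sup>2 + 5 * growth_const + 2 * L"
  have C: "C \<ge> 0" using growth_const_pos L by (simp add: C_def)
  define q where "q = sqmean N y"
  have q: "q \<ge> 0" unfolding q_def by (rule sqmean_nonneg)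
  define A where "A = 1 + (norm (y i))\<^sup>2"
  have A: "A \<ge> 1" by (simp add: A_def)
  define B where "B = tamed n \<rho> \<sigma> t (y i) (empirical_measure N y)"
  define B0 where "B0 = tamed n \<rho> \<sigma>0 t (y i) (empirical_measure N y)"
  define \<beta> where "\<beta> = tamed n \<rho> b t (y i) (empirical_measure N y)"
  note bd = tamed_coefficient_bounds[OF t n empirical_measure_P2[OF N] sqmean_bound[OF N], of "y i" y]
  have b2: "(norm \<beta>)\<^sup>2 \<le> C * (real n * A + q)" using bd(2) by (simp add: \<beta>_def C_def A_def q_def)
  have S2: "(norm B)\<^sup>2 + (norm B0)\<^sup>2 \<le> C * (sqrt (real n) * A + q)" using bd(3) by (simp add: B_def B0_def C_def A_def q_def)
  define r where "r = sqrt (real n)"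
  have n0: "real n \<ge> 1" and r: "r \<ge> 1" using n by (auto simp: r_def)
  have hn: "h * real n \<le> 1" using h n0 by (simp add: le_divide_eq)
  have h1: "h \<le> 1" using mult_left_mono[OF n0 h(1)] hn by simp
  have d: "(norm (h *\<^sub>R \<beta>))\<^sup>2 \<le> C * (A + q)"
  proof -
    have "(norm (h *\<^sub>R \<beta>))\<^sup>2 = h\<^sup>2 * (norm \<beta>)\<^sup>2" by (simp add: power_mult_distrib)
    also have "\<dots> \<le> h\<^sup>2 * (C * (real n * A + q))" using b2 by (intro mult_left_mono) auto
    also have "\<dots> = C * ((h * (h * real n)) * A + h\<^sup>2 * q)" by (simp add: power2_eq_square algebra_simps)
    also have "\<dots> \<le> C * (1 * A + 1 * q)"
    proof (intro mult_left_mono add_mono mult_right_mono)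
      show "h * (h * real n) \<le> 1" by (rule mult_le_one[OF h1 _ hn]) (use h in simp)
      show "h\<^sup>2 \<le> 1" using h1 h by (intro power_le_one) auto
    qed (use C A q in auto)
    finally show ?thesis by simp
  qed
  have rS: "(norm B)\<^sup>2 \<le> C * (A + q) * r" "(norm B0)\<^sup>2 \<le> C * (A + q) * r"
  proof -
    have "r * A + q \<le> (A + q) * r" using mult_left_mono[OF r q] by (simp add: algebra_simps)
    then have "C * (r * A + q) \<le> C * ((A + q) * r)" using C by (rule mult_left_mono)
    then have "(norm B)\<^sup>2 + (norm B0)\<^sup>2 \<le> C * (A + q) * r" using S2 by (simp add: r_def mult.assoc)
    then show "(norm B)\<^sup>2 \<le> C * (A + q) * r" "(norm B0)\<^sup>2 \<le> C * (A + q) * r"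
      using zero_le_power2[of "norm B"] zero_le_power2[of "norm B0"] by linarith+
  qed
  have s: "(norm (B *v z))\<^sup>2 \<le> C * (A + q) * r * (norm z)\<^sup>2"
  proof -
    have "(norm (B *v z))\<^sup>2 \<le> (norm B * norm z)\<^sup>2" by (intro power_mono norm_matrix_vector_le) auto
    also have "\<dots> \<le> C * (A + q) * r * (norm z)\<^sup>2" unfolding power_mult_distrib by (intro mult_right_mono rS) auto
    finally show ?thesis .
  qed
  have s0: "(norm (B0 *v z0))\<^sup>2 \<le> C * (A + q) * r * (norm z0)\<^sup>2"
  proof -
    have "(norm (B0 *v z0))\<^sup>2 \<le> (norm B0 * norm z0)\<^sup>2" by (intro power_mono norm_matrix_vector_le) auto
    also have "\<dots> \<le> C * (A + q) * r * (norm z0)\<^sup>2" unfolding power_mult_distrib by (intro mult_right_mono rS) auto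
    finally show ?thesis .
  qed
  have four: "(norm (a + b + c + d))\<^sup>2 \<le> 4 * ((norm a)\<^sup>2 + (norm b)\<^sup>2 + (norm c)\<^sup>2 + (norm d)\<^sup>2)" for a b c d :: "real ^ 'd"
  proof -
    have sq2: "(u + v)\<^sup>2 \<le> 2 * (u\<^sup>2 + v\<^sup>2)" for u v :: real
      using sum_squares_bound[of u v] by (simp add: power2_sum)
    have tri: "(norm (u + v))\<^sup>2 \<le> 2 * ((norm u)\<^sup>2 + (norm v)\<^sup>2)" for u v :: "real ^ 'd"
      using power_mono[OF norm_triangle_ineq norm_ge_zero, of u v 2] sq2[of "norm u" "norm v"] by linarith
    have "(norm ((a + b) + (c + d)))\<^sup>2 \<le> 2 * ((norm (a + b))\<^sup>2 + (norm (c + d))\<^sup>2)" by (rule tri)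
    then show ?thesis using tri[of a b] tri[of c d] by (simp add: add.assoc)
  qed
  have e: "estep N n t y i h z z0 = y i + h *\<^sub>R \<beta> + B *v z + B0 *v z0"
    by (simp add: tamed_step_def B_def B0_def \<beta>_def)
  define E where "E = C * (A + q)"
  define Z where "Z = r * (norm z)\<^sup>2 + r * (norm z0)\<^sup>2"
  have Z: "Z \<ge> 0" using r by (simp add: Z_def)
  have AE: "A \<le> A + q" using q by simp
  have "1 + (norm (estep N n t y i h z z0))\<^sup>2 \<le> 1 + 4 * ((norm (y i))\<^sup>2 + (norm (h *\<^sub>R \<beta>))\<^sup>2 + (norm (B *v z))\<^sup>2 + (norm (B0 *v z0))\<^sup>2)"
    unfolding e by (intro add_left_mono four)
  also have "\<dots> \<le> 4 * (A + E + E * Z)"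
    using d s s0 by (simp add: A_def E_def Z_def algebra_simps)
  also have "\<dots> \<le> 4 * ((1 + C) * (A + q) * (1 + Z))"
  proof -
    have "0 \<le> (A + q) * Z" using A q Z by simp
    then have "A + E + E * Z \<le> (A + q) + E + (A + q) * Z + E * Z" using q by linarith
    also have "\<dots> = (1 + C) * (A + q) * (1 + Z)" by (simp add: E_def algebra_simps)
    finally show ?thesis by simp
  qed
  finally show ?thesis unfolding C_def A_def q_def Z_def r_def by (simp only: mult.assoc add.assoc)
qed

end

section \<open>The supremum over time inside the expectation\<close>

context tamed_particles
begin

lemma uniform_maximal_bound:
  assumes q: "q < p0"
  obtains K where "K > 0"
    "\<And>N n Y i. N \<ge> 1 \<Longrightarrow> n \<ge> 1 \<Longrightarrow> tamed_euler_scheme T M0 M1 \<rho> b \<sigma> \<sigma>0 W0 W \<xi> N n Y \<Longrightarrow> i \<in> {1..N} \<Longrightarrow>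
      (\<integral>\<^sup>+\<omega>. (\<Squnion>t\<in>{0..T}. ennreal ((1 + (norm (Y i t \<omega>))\<^sup>2) powr (q / 2))) \<partial>prod_space M0 M1) \<le> ennreal K"
proof -
  \<comment> \<open>The exponent is raised to at least 1 so that Jensen's inequality is available;
    this also covers small and negative q, as the base is at least 1. The intermediate a' leaves
    room both for Young's inequality, above a, and for the maximum on the grid, below p0 /
    2.\<close>
  define a where "a = max q 2 / 2"
  define a' where "a' = (a + p0 / 2) / 2"
  have a: "1 \<le> a" "q / 2 \<le> a" "a < a'" "a' < p0 / 2" using q p0 by (auto simp: a_def a'_def)
  define \<delta> where "\<delta> = a' / (p0 / 2)"
  have \<delta>: "0 < \<delta>" "\<delta> < 1" using a p0 by (auto simp: \<delta>_def)
  have V\<delta>: "V x powr \<delta> = (1 + (norm x)\<^sup>2) powr a'" for x using p0 by (simp add: powr_powr \<delta>_def)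
  \<comment> \<open>Large enough for the Young exponent of the noise, and at least 2 so that the sum
    over all cells stays bounded in n.\<close>
  define m where "m = max 2 (nat \<lceil>a * a' / (a' - a)\<rceil>)"
  have m: "m \<ge> 2" "a * a' / (a' - a) \<le> real m" unfolding m_def by (simp, linarith)
  obtain B where B: "B > 0" and mx: "\<And>N n k i. N \<ge> 1 \<Longrightarrow> n \<ge> 1 \<Longrightarrow> i \<in> {1..N} \<Longrightarrow> real k / real n \<le> T \<Longrightarrow>
      (\<integral>\<^sup>+\<omega>. ennreal (Max ((\<lambda>j. V (euler N n j \<omega> i)) ` {..k}) powr \<delta>) \<partial>Pr) \<le> ennreal B"
    using euler_maximum_moment[OF \<delta>] by blast
  obtain Cg where Cg: "Cg \<ge> 1" "\<And>h. h > 0 \<Longrightarrow> (\<integral>\<^sup>+z. ennreal (norm z ^ (2 * (2 * m))) \<partial>(gaussian h :: (real ^ 'm) measure)) \<le> ennreal (Cg * h ^ (2 * m))"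
    using gaussian_norm_moment_exists[of "2 * m"] by blast
  obtain Cg0 where Cg0: "Cg0 \<ge> 1" "\<And>h. h > 0 \<Longrightarrow> (\<integral>\<^sup>+z. ennreal (norm z ^ (2 * (2 * m))) \<partial>(gaussian h :: (real ^ 'm0) measure)) \<le> ennreal (Cg0 * h ^ (2 * m))"
    using gaussian_norm_moment_exists[of "2 * m"] by blast
  define D1 where "D1 = 1 + 2 * Cg * (2 powr (1/2) / (1 - 2 powr (1/2 - 1 :: real)))"
  define D0 where "D0 = 1 + 2 * Cg0 * (2 powr (1/2) / (1 - 2 powr (1/2 - 1 :: real)))"
  have "2 powr (1/2 - 1) < (1::real)" using powr_less_mono[of "1/2 - 1" 0 "2::real"] by simp
  then have D: "D1 \<ge> 0" "D0 \<ge> 0" unfolding D1_def D0_def using Cg Cg0 by (auto intro!: add_nonneg_nonneg mult_nonneg_nonneg divide_nonneg_nonneg)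
  define C where "C = 4 * (1 + (4 * growth_const\<^sup>2 + 5 * growth_const + 2 * L))"
  have C: "C > 0" unfolding C_def using growth_const_pos L by (intro mult_pos_pos add_pos_nonneg) auto
  define c1 where "c1 = C powr a * (3 powr a' + 3 ^ m)"
  have c1: "c1 > 0" using C by (auto simp: c1_def intro!: mult_pos_pos add_pos_pos)
  define K where "K = c1 * (2 * B + 1 + (T + 1) * (D1 + D0))"
  have K: "K > 0" unfolding K_def using c1 B D T by (intro mult_pos_pos add_pos_nonneg) auto
  show ?thesis
  proof (rule that[OF K])
    fix N n :: nat and Y and i :: nat
    assume N: "N \<ge> 1" and n: "n \<ge> 1" and Y: "tamed_euler_scheme T M0 M1 \<rho> b \<sigma> \<sigma>0 W0 W \<xi> N n Y" and i: "i \<in> {1..N}"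
    have i1: "i \<ge> 1" using i by simp
    have n0: "real n \<ge> 1" using n by simp
    define \<kappa> where "\<kappa> = nat \<lfloor>real n * T\<rfloor>"
    have \<kappa>T: "real \<kappa> / real n \<le> T" using grid_cell(1)[OF n, of T] T by (simp add: \<kappa>_def)
    have kT: "real k / real n \<le> T" if "k \<le> \<kappa>" for k
    proof -
      have "real k / real n \<le> real \<kappa> / real n" using that by (intro divide_right_mono) auto
      then show ?thesis using \<kappa>T by linarith
    qed
    define s where "s k = real k / real n" for k :: nat
    \<comment> \<open>The last cell may extend beyond T, where nothing is known about the Wiener
      processes, so it is cut off at T.\<close>
    define e where "e k = min T (real (Suc k) / real n)" for k :: nat
    have se: "0 \<le> s k" "s k \<le> e k" "e k \<le> T" "e k - s k \<le> 1 / real n" if "k \<le> \<kappa>" for k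
      using kT[OF that] by (auto simp: s_def e_def add_divide_distrib min_def)
    have ex1: "\<forall>k\<in>{..\<kappa>}. \<exists>R. R \<in> borel_measurable M1 \<and>
      (\<integral>\<^sup>+\<omega>. R \<omega> \<partial>M1) \<le> ennreal (D1 * (e k - s k) ^ m) \<and>
      (AE \<omega> in M1. \<forall>u\<in>{s k..e k}. ennreal (norm (W i u \<omega> - W i (s k) \<omega>) ^ (2 * m)) \<le> R \<omega>)"
    proof
      fix k assume "k \<in> {..\<kappa>}"
      then have k: "k \<le> \<kappa>" by simp
      show "\<exists>R. R \<in> borel_measurable M1 \<and>
        (\<integral>\<^sup>+\<omega>. R \<omega> \<partial>M1) \<le> ennreal (D1 * (e k - s k) ^ m) \<and>
        (AE \<omega> in M1. \<forall>u\<in>{s k..e k}. ennreal (norm (W i u \<omega> - W i (s k) \<omega>) ^ (2 * m)) \<le> R \<omega>)"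
        unfolding D1_def using m(1) Cg by (intro wiener_oscillation[OF M1 F1 W[OF i1] se(1-3)[OF k]]) auto
    qed
    then obtain R where R_all: "\<forall>k\<in>{..\<kappa>}. R k \<in> borel_measurable M1 \<and>
      (\<integral>\<^sup>+\<omega>. R k \<omega> \<partial>M1) \<le> ennreal (D1 * (e k - s k) ^ m) \<and>
      (AE \<omega> in M1. \<forall>u\<in>{s k..e k}. ennreal (norm (W i u \<omega> - W i (s k) \<omega>) ^ (2 * m)) \<le> R k \<omega>)"
      using bchoice[OF ex1] by blast
    note R_k = bspec[OF R_all, unfolded atMost_iff]
    note R = R_k[THEN conjunct1] R_k[THEN conjunct2, THEN conjunct1] R_k[THEN conjunct2, THEN conjunct2]
    have ex0: "\<forall>k\<in>{..\<kappa>}. \<exists>R. R \<in> borel_measurable M0 \<and>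
      (\<integral>\<^sup>+\<omega>. R \<omega> \<partial>M0) \<le> ennreal (D0 * (e k - s k) ^ m) \<and>
      (AE \<omega> in M0. \<forall>u\<in>{s k..e k}. ennreal (norm (W0 u \<omega> - W0 (s k) \<omega>) ^ (2 * m)) \<le> R \<omega>)"
    proof
      fix k assume "k \<in> {..\<kappa>}"
      then have k: "k \<le> \<kappa>" by simp
      show "\<exists>R. R \<in> borel_measurable M0 \<and>
        (\<integral>\<^sup>+\<omega>. R \<omega> \<partial>M0) \<le> ennreal (D0 * (e k - s k) ^ m) \<and>
        (AE \<omega> in M0. \<forall>u\<in>{s k..e k}. ennreal (norm (W0 u \<omega> - W0 (s k) \<omega>) ^ (2 * m)) \<le> R \<omega>)"
        unfolding D0_def using m(1) Cg0 by (intro wiener_oscillation[OF M0 F0 W0 se(1-3)[OF k]]) auto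
    qed
    then obtain R0 where R0_all: "\<forall>k\<in>{..\<kappa>}. R0 k \<in> borel_measurable M0 \<and>
      (\<integral>\<^sup>+\<omega>. R0 k \<omega> \<partial>M0) \<le> ennreal (D0 * (e k - s k) ^ m) \<and>
      (AE \<omega> in M0. \<forall>u\<in>{s k..e k}. ennreal (norm (W0 u \<omega> - W0 (s k) \<omega>) ^ (2 * m)) \<le> R0 k \<omega>)"
      using bchoice[OF ex0] by blast
    note R0_k = bspec[OF R0_all, unfolded atMost_iff]
    note R0 = R0_k[THEN conjunct1] R0_k[THEN conjunct2, THEN conjunct1] R0_k[THEN conjunct2, THEN conjunct2]
    define Mx where "Mx j \<omega> = Max ((\<lambda>k. V (euler N n k \<omega> j)) ` {..\<kappa>}) powr \<delta>" for j \<omega>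
    have Mm: "(\<lambda>\<omega>. ennreal (Mx j \<omega>)) \<in> borel_measurable Pr" for j
    proof -
      have "(\<lambda>\<omega>. V (euler N n k \<omega> j)) \<in> borel_measurable Pr" if "k \<le> \<kappa>" for k
      proof -
        note [measurable] = euler_measurable_Pr[OF N n kT[OF that]]
        show ?thesis by measurable
      qed
      then have [measurable]: "(\<lambda>\<omega>. Max ((\<lambda>k. V (euler N n k \<omega> j)) ` {..\<kappa>})) \<in> borel_measurable Pr"
        by (intro borel_measurable_Max) auto
      show ?thesis unfolding Mx_def by measurable
    qed
    have Mx_ge: "(1 + (norm (euler N n k \<omega> j))\<^sup>2) powr a' \<le> Mx j \<omega>" if "k \<le> \<kappa>" for k j \<omega>
    proof -
      have "V (euler N n k \<omega> j) \<le> Max ((\<lambda>k. V (euler N n k \<omega> j)) ` {..\<kappa>})" using that by (intro Max_ge) (auto simp del: euler.simps)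
      then have "V (euler N n k \<omega> j) powr \<delta> \<le> Mx j \<omega>" unfolding Mx_def using \<delta> by (intro powr_mono2) auto
      then show ?thesis by (simp only: V\<delta>)
    qed
    have Mx0: "Mx j \<omega> \<ge> 0" for j \<omega> unfolding Mx_def by (rule powr_ge_zero)
    define r where "r = sqrt (real n)"
    have r: "r \<ge> 1" "r\<^sup>2 = real n" using n by (auto simp: r_def)
    \<comment> \<open>A measurable majorant of the supremum. The largest oscillation over the cells
      is replaced by the sum over all of them; with r = sqrt n, the m-th power of the noise factor
      produces the weight r^m.\<close>
    define Dom where "Dom \<omega> = ennreal c1 * (ennreal (Mx i \<omega>) + ennreal (1 / real N) * (\<Sum>j=1..N. ennreal (Mx j \<omega>)) + 1
        + ennreal (r ^ m) * (\<Sum>k\<le>\<kappa>. R k (snd \<omega>) + R0 k (fst \<omega>)))" for \<omega>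
    have pointwise: "(1 + (norm (estep N n (s k) (euler N n k \<omega>) i h z z0))\<^sup>2) powr (q / 2)
        \<le> c1 * (Mx i \<omega> + (1 / real N) * (\<Sum>j=1..N. Mx j \<omega>) + 1 + r ^ m * (norm z ^ (2 * m) + norm z0 ^ (2 * m)))"
      if k: "k \<le> \<kappa>" and h: "0 \<le> h" "h \<le> 1 / real n" for k h z z0 \<omega>
    proof -
      define y where "y = euler N n k \<omega>"
      define A where "A = 1 + (norm (y i))\<^sup>2"
      define qq where "qq = sqmean N y"
      have qq: "qq \<ge> 0" unfolding qq_def by (rule sqmean_nonneg)
      have A: "A \<ge> 1" by (simp add: A_def)
      define v where "v = 1 + r * (norm z)\<^sup>2 + r * (norm z0)\<^sup>2"
      have v: "v \<ge> 1" using r by (simp add: v_def)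
      have sT: "s k \<in> {0..T}" using kT[OF k] by (simp add: s_def)
      have "1 + (norm (estep N n (s k) y i h z z0))\<^sup>2 \<le> C * ((A + qq) * v)"
        using estep_norm_bound[OF sT N n h, of y i z z0] by (simp only: C_def A_def qq_def v_def r_def)
      then have "(1 + (norm (estep N n (s k) y i h z z0))\<^sup>2) powr a \<le> (C * ((A + qq) * v)) powr a"
        using a by (intro powr_mono2) auto
      moreover have "(1 + (norm (estep N n (s k) y i h z z0))\<^sup>2) powr (q / 2) \<le> (1 + (norm (estep N n (s k) y i h z z0))\<^sup>2) powr a"
        using a by (intro powr_mono) auto
      ultimately have "(1 + (norm (estep N n (s k) y i h z z0))\<^sup>2) powr (q / 2) \<le> C powr a * ((A + qq) * v) powr a"
        by (simp add: powr_mult)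
      also have "\<dots> \<le> C powr a * ((A + qq) powr a' + v powr (a * a' / (a' - a)))"
        using A qq v a by (intro mult_left_mono powr_mult_young) auto
      also have "\<dots> \<le> C powr a * (3 powr a' * (Mx i \<omega> + (1 / real N) * (\<Sum>j=1..N. Mx j \<omega>)) + 3 ^ m * (1 + r ^ m * (norm z ^ (2 * m) + norm z0 ^ (2 * m))))"
      proof (intro mult_left_mono add_mono)
        have "(A + qq + 0) powr a' \<le> 3 powr a' * (A powr a' + qq powr a' + 0 powr a')"
          using A qq a by (intro powr_add3_le) auto
        then have "(A + qq) powr a' \<le> 3 powr a' * (A powr a' + qq powr a')" using a by simp
        also have "\<dots> \<le> 3 powr a' * (Mx i \<omega> + (1 / real N) * (\<Sum>j=1..N. Mx j \<omega>))"
        proof (intro mult_left_mono add_mono)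
          show "A powr a' \<le> Mx i \<omega>" unfolding A_def y_def by (rule Mx_ge[OF k])
          have "qq powr a' \<le> (\<Sum>j=1..N. (1 + (norm (y j))\<^sup>2) powr a') / real N"
            unfolding qq_def using a by (intro powr_mean_le[OF N]) simp
          also have "\<dots> \<le> (\<Sum>j=1..N. Mx j \<omega>) / real N"
            unfolding y_def by (intro divide_right_mono sum_mono Mx_ge[OF k]) simp
          finally show "qq powr a' \<le> (1 / real N) * (\<Sum>j=1..N. Mx j \<omega>)" by simp
        qed auto
        finally show "(A + qq) powr a' \<le> 3 powr a' * (Mx i \<omega> + (1 / real N) * (\<Sum>j=1..N. Mx j \<omega>))" .
        have "v powr (a * a' / (a' - a)) \<le> v powr real m" using v m by (intro powr_mono) auto
        also have "\<dots> = v ^ m" using v by (intro powr_realpow) auto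
        also have "\<dots> \<le> 3 ^ m * (1 ^ m + (r * (norm z)\<^sup>2) ^ m + (r * (norm z0)\<^sup>2) ^ m)"
          unfolding v_def using r by (intro power_add3_le) auto
        also have "\<dots> = 3 ^ m * (1 + r ^ m * (norm z ^ (2 * m) + norm z0 ^ (2 * m)))"
          by (simp add: power_mult_distrib distrib_left power_mult)
        finally show "v powr (a * a' / (a' - a)) \<le> 3 ^ m * (1 + r ^ m * (norm z ^ (2 * m) + norm z0 ^ (2 * m)))" .
      qed auto
      also have "\<dots> \<le> C powr a * ((3 powr a' + 3 ^ m) * (Mx i \<omega> + (1 / real N) * (\<Sum>j=1..N. Mx j \<omega>) + 1 + r ^ m * (norm z ^ (2 * m) + norm z0 ^ (2 * m))))"
      proof (intro mult_left_mono)
        define P where "P = Mx i \<omega> + (1 / real N) * (\<Sum>j=1..N. Mx j \<omega>)"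
        define S where "S = 1 + r ^ m * (norm z ^ (2 * m) + norm z0 ^ (2 * m))"
        have P: "P \<ge> 0" unfolding P_def by (intro add_nonneg_nonneg mult_nonneg_nonneg sum_nonneg Mx0) auto
        have S: "S \<ge> 0" unfolding S_def using r by (intro add_nonneg_nonneg mult_nonneg_nonneg) auto
        have "0 \<le> 3 powr a' * S" "0 \<le> 3 ^ m * P" using P S by auto
        then have "3 powr a' * P + 3 ^ m * S \<le> (3 powr a' + 3 ^ m) * (P + S)" by (simp add: algebra_simps)
        then show "3 powr a' * (Mx i \<omega> + (1 / real N) * (\<Sum>j=1..N. Mx j \<omega>)) + 3 ^ m * (1 + r ^ m * (norm z ^ (2 * m) + norm z0 ^ (2 * m)))
          \<le> (3 powr a' + 3 ^ m) * (Mx i \<omega> + (1 / real N) * (\<Sum>j=1..N. Mx j \<omega>) + 1 + r ^ m * (norm z ^ (2 * m) + norm z0 ^ (2 * m)))"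
          by (simp only: P_def S_def add.assoc)
      qed auto
      finally show ?thesis by (simp only: c1_def y_def mult.assoc)
    qed
    have dominated: "AE \<omega> in Pr. (\<Squnion>t\<in>{0..T}. ennreal ((1 + (norm (Y i t \<omega>))\<^sup>2) powr (q / 2))) \<le> Dom \<omega>"
    proof -
      have "AE \<omega> in Pr. \<forall>k\<in>{..\<kappa>}. \<forall>u\<in>{s k..e k}. ennreal (norm (W i u (snd \<omega>) - W i (s k) (snd \<omega>)) ^ (2 * m)) \<le> R k (snd \<omega>)"
        by (intro AE_ball_countable[THEN iffD2] ballI AE_Pr_snd R(3)) auto
      moreover have "AE \<omega> in Pr. \<forall>k\<in>{..\<kappa>}. \<forall>u\<in>{s k..e k}. ennreal (norm (W0 u (fst \<omega>) - W0 (s k) (fst \<omega>)) ^ (2 * m)) \<le> R0 k (fst \<omega>)"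
        by (intro AE_ball_countable[THEN iffD2] ballI AE_Pr_fst R0(3)) auto
      ultimately show ?thesis
        using scheme_eq_estep[OF N n Y]
      proof eventually_elim
        case (elim \<omega>)
        show "(\<Squnion>t\<in>{0..T}. ennreal ((1 + (norm (Y i t \<omega>))\<^sup>2) powr (q / 2))) \<le> Dom \<omega>"
        proof (rule SUP_least)
          fix t assume t: "t \<in> {0..T}"
          define k where "k = nat \<lfloor>real n * t\<rfloor>"
          have tk: "s k \<le> t" "t \<le> real (Suc k) / real n" using grid_cell[OF n, of t] t by (auto simp: k_def s_def)
          have k\<kappa>: "k \<le> \<kappa>" unfolding k_def \<kappa>_def using t by (intro nat_mono floor_mono mult_left_mono) auto
          have te: "t \<in> {s k..e k}" using tk t by (simp add: e_def)
          define z where "z = W i t (snd \<omega>) - W i (s k) (snd \<omega>)"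
          define z0 where "z0 = W0 t (fst \<omega>) - W0 (s k) (fst \<omega>)"
          have z: "ennreal (norm z ^ (2 * m)) \<le> R k (snd \<omega>)" "ennreal (norm z0 ^ (2 * m)) \<le> R0 k (fst \<omega>)"
            using elim(1,2) k\<kappa> te by (auto simp: z_def z0_def)
          have h: "0 \<le> t - s k" "t - s k \<le> 1 / real n" using tk by (auto simp: s_def add_divide_distrib)
          have "Y i t \<omega> = estep N n (s k) (euler N n k \<omega>) i (t - s k) z z0"
            using elim(3) i t tk unfolding s_def z_def z0_def by blast
          then have "ennreal ((1 + (norm (Y i t \<omega>))\<^sup>2) powr (q / 2))
            \<le> ennreal (c1 * (Mx i \<omega> + (1 / real N) * (\<Sum>j=1..N. Mx j \<omega>) + 1 + r ^ m * (norm z ^ (2 * m) + norm z0 ^ (2 * m))))"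
            using pointwise[OF k\<kappa> h, of \<omega> z z0] by (simp only: ennreal_leI)
          also have "\<dots> = ennreal c1 * (ennreal (Mx i \<omega>) + ennreal (1 / real N) * (\<Sum>j=1..N. ennreal (Mx j \<omega>)) + 1 + ennreal (r ^ m) * (ennreal (norm z ^ (2 * m)) + ennreal (norm z0 ^ (2 * m))))"
          proof -
            have s0: "(\<Sum>j=1..N. Mx j \<omega>) \<ge> 0" by (intro sum_nonneg Mx0)
            have r0: "r ^ m \<ge> 0" using r by simp
            have z0': "norm z ^ (2 * m) \<ge> 0" "norm z0 ^ (2 * m) \<ge> 0" by auto
            have "ennreal (c1 * (Mx i \<omega> + (1 / real N) * (\<Sum>j=1..N. Mx j \<omega>) + 1 + r ^ m * (norm z ^ (2 * m) + norm z0 ^ (2 * m))))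
              = ennreal c1 * (ennreal (Mx i \<omega>) + ennreal (1 / real N) * ennreal (\<Sum>j=1..N. Mx j \<omega>) + ennreal 1 + ennreal (r ^ m) * (ennreal (norm z ^ (2 * m)) + ennreal (norm z0 ^ (2 * m))))"
              using c1 Mx0[of i \<omega>] s0 r0 z0'
              by (simp only: ennreal_mult ennreal_plus add_nonneg_nonneg mult_nonneg_nonneg less_imp_le divide_nonneg_nonneg zero_le_one of_nat_0_le_iff)
            also have "ennreal (\<Sum>j=1..N. Mx j \<omega>) = (\<Sum>j=1..N. ennreal (Mx j \<omega>))"
              by (rule sum_ennreal[symmetric]) (rule Mx0)
            finally show ?thesis by simp
          qed
          also have "\<dots> \<le> Dom \<omega>"
            unfolding Dom_def
          proof (intro mult_left_mono add_left_mono)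
            have "ennreal (norm z ^ (2 * m)) + ennreal (norm z0 ^ (2 * m)) \<le> R k (snd \<omega>) + R0 k (fst \<omega>)"
              using z by (intro add_mono)
            also have "\<dots> \<le> (\<Sum>k\<le>\<kappa>. R k (snd \<omega>) + R0 k (fst \<omega>))"
              using k\<kappa> member_le_sum[of k "{..\<kappa>}" "\<lambda>k. R k (snd \<omega>) + R0 k (fst \<omega>)"] by simp
            finally show "ennreal (norm z ^ (2 * m)) + ennreal (norm z0 ^ (2 * m)) \<le> (\<Sum>k\<le>\<kappa>. R k (snd \<omega>) + R0 k (fst \<omega>))" .
          qed auto
          finally show "ennreal ((1 + (norm (Y i t \<omega>))\<^sup>2) powr (q / 2)) \<le> Dom \<omega>" .
        qed
      qed
    qed
    have Rm: "(\<lambda>\<omega>. R k (snd \<omega>)) \<in> borel_measurable Pr" "(\<lambda>\<omega>. R0 k (fst \<omega>)) \<in> borel_measurable Pr" if "k \<le> \<kappa>" for k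
      using measurable_compose[OF measurable_snd R(1)[OF that]] measurable_compose[OF measurable_fst R0(1)[OF that]] by auto
    have "(\<integral>\<^sup>+\<omega>. Dom \<omega> \<partial>Pr) = ennreal c1 * ((\<integral>\<^sup>+\<omega>. ennreal (Mx i \<omega>) \<partial>Pr) + ennreal (1 / real N) * (\<Sum>j=1..N. \<integral>\<^sup>+\<omega>. ennreal (Mx j \<omega>) \<partial>Pr) + 1
        + ennreal (r ^ m) * (\<Sum>k\<le>\<kappa>. (\<integral>\<^sup>+\<omega>. R k (snd \<omega>) \<partial>Pr) + (\<integral>\<^sup>+\<omega>. R0 k (fst \<omega>) \<partial>Pr)))"
    proof -
      note [measurable] = Mm
      have sm [measurable]: "(\<lambda>\<omega>. \<Sum>k\<le>\<kappa>. R k (snd \<omega>) + R0 k (fst \<omega>)) \<in> borel_measurable Pr"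
        using Rm by (intro borel_measurable_sum borel_measurable_add) auto
      have sumR: "(\<integral>\<^sup>+\<omega>. (\<Sum>k\<le>\<kappa>. R k (snd \<omega>) + R0 k (fst \<omega>)) \<partial>Pr) = (\<Sum>k\<le>\<kappa>. (\<integral>\<^sup>+\<omega>. R k (snd \<omega>) \<partial>Pr) + (\<integral>\<^sup>+\<omega>. R0 k (fst \<omega>) \<partial>Pr))"
      proof (subst nn_integral_sum)
        show "(\<Sum>k\<le>\<kappa>. \<integral>\<^sup>+\<omega>. R k (snd \<omega>) + R0 k (fst \<omega>) \<partial>Pr) = (\<Sum>k\<le>\<kappa>. (\<integral>\<^sup>+\<omega>. R k (snd \<omega>) \<partial>Pr) + (\<integral>\<^sup>+\<omega>. R0 k (fst \<omega>) \<partial>Pr))"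
          using Rm by (intro sum.cong nn_integral_add) auto
      qed (use Rm in \<open>auto intro!: borel_measurable_add\<close>)
      have sumM: "(\<integral>\<^sup>+\<omega>. (\<Sum>j=1..N. ennreal (Mx j \<omega>)) \<partial>Pr) = (\<Sum>j=1..N. \<integral>\<^sup>+\<omega>. ennreal (Mx j \<omega>) \<partial>Pr)"
        by (rule nn_integral_sum) (rule Mm)
      have [measurable]: "(\<lambda>\<omega>. \<Sum>j=1..N. ennreal (Mx j \<omega>)) \<in> borel_measurable Pr"
        by (intro borel_measurable_sum Mm)
      show ?thesis unfolding Dom_def
        by (simp add: nn_integral_cmult nn_integral_add sumR[simplified] sumM[simplified] PP.emeasure_space_1 del: sum_ennreal)
    qed
    also have "\<dots> \<le> ennreal c1 * (ennreal B + ennreal (1 / real N) * (\<Sum>j=1..N. ennreal B) + 1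
        + ennreal (r ^ m) * (\<Sum>k\<le>\<kappa>. ennreal (D1 / real n ^ m) + ennreal (D0 / real n ^ m)))"
    proof -
      have M: "(\<integral>\<^sup>+\<omega>. ennreal (Mx j \<omega>) \<partial>Pr) \<le> ennreal B" if "j \<in> {1..N}" for j
        unfolding Mx_def by (rule mx[OF N n that \<kappa>T])
      have pw: "x * (e k - s k) ^ m \<le> x / real n ^ m" if "k \<le> \<kappa>" "x \<ge> 0" for x k
      proof -
        have "(e k - s k) ^ m \<le> (1 / real n) ^ m" using se[OF that(1)] by (intro power_mono) auto
        then have "x * (e k - s k) ^ m \<le> x * (1 / real n) ^ m" using that(2) by (rule mult_left_mono)
        then show ?thesis by (simp add: power_divide)
      qed
      have R1: "(\<integral>\<^sup>+\<omega>. R k (snd \<omega>) \<partial>Pr) \<le> ennreal (D1 / real n ^ m)" if "k \<le> \<kappa>" for k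
        unfolding nn_integral_Pr_snd[OF R(1)[OF that]]
        using R(2)[OF that] pw[OF that D(1)] by (meson ennreal_leI order_trans)
      have R2: "(\<integral>\<^sup>+\<omega>. R0 k (fst \<omega>) \<partial>Pr) \<le> ennreal (D0 / real n ^ m)" if "k \<le> \<kappa>" for k
        unfolding nn_integral_Pr_fst[OF R0(1)[OF that]]
        using R0(2)[OF that] pw[OF that D(2)] by (meson ennreal_leI order_trans)
      show ?thesis
        using i by (intro mult_left_mono add_mono sum_mono M R1 R2) auto
    qed
    also have "\<dots> = ennreal (c1 * (B + 1 / real N * (real N * B) + 1 + r ^ m * (real (Suc \<kappa>) * (D1 / real n ^ m + D0 / real n ^ m))))"
    proof -
      have 1: "(\<Sum>j=1..N. ennreal B) = ennreal (real N * B)"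
        using B by (simp add: ennreal_of_nat_eq_real_of_nat ennreal_mult[symmetric])
      have 2: "(\<Sum>k\<le>\<kappa>. ennreal (D1 / real n ^ m) + ennreal (D0 / real n ^ m)) = ennreal (real (Suc \<kappa>) * (D1 / real n ^ m + D0 / real n ^ m))"
      proof -
        have "(\<Sum>k\<le>\<kappa>. ennreal (D1 / real n ^ m) + ennreal (D0 / real n ^ m)) = (\<Sum>k\<le>\<kappa>. ennreal (D1 / real n ^ m + D0 / real n ^ m))"
          using D by (intro sum.cong refl ennreal_plus[symmetric]) auto
        also have "\<dots> = ennreal (\<Sum>k\<le>\<kappa>. D1 / real n ^ m + D0 / real n ^ m)" using D by (intro sum_ennreal) auto
        finally show ?thesis by simp
      qed
      have nn: "0 \<le> D1 / real n ^ m + D0 / real n ^ m" "0 \<le> r ^ m" "0 \<le> B" "0 \<le> c1" "0 \<le> 1 / real N" "0 \<le> real N" "0 \<le> real (Suc \<kappa>)"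
        using D r B c1 by auto
      have "ennreal (c1 * (B + 1 / real N * (real N * B) + 1 + r ^ m * (real (Suc \<kappa>) * (D1 / real n ^ m + D0 / real n ^ m))))
        = ennreal c1 * (ennreal B + ennreal (1 / real N) * ennreal (real N * B) + ennreal 1 + ennreal (r ^ m) * ennreal (real (Suc \<kappa>) * (D1 / real n ^ m + D0 / real n ^ m)))"
        using nn mult_nonneg_nonneg[OF nn(6) nn(3)] mult_nonneg_nonneg[OF nn(7) nn(1)]
          mult_nonneg_nonneg[OF nn(5) mult_nonneg_nonneg[OF nn(6) nn(3)]] mult_nonneg_nonneg[OF nn(2) mult_nonneg_nonneg[OF nn(7) nn(1)]]
        by (simp only: ennreal_mult[of c1] ennreal_mult[of "r ^ m"] ennreal_mult[of "1 / real N"] ennreal_plus add_nonneg_nonneg zero_le_one)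
      then show ?thesis unfolding 1 2 by simp
    qed
    also have "\<dots> \<le> ennreal K"
      unfolding K_def
    proof (intro ennreal_leI mult_left_mono add_mono)
      have "B + 1 / real N * (real N * B) = 2 * B" using N by simp
      then show "B + 1 / real N * (real N * B) \<le> 2 * B" by simp
      \<comment> \<open>The price of summing over about n T cells: each contributes n^(m/2) n^(-m) =
        n^(-m/2), which is at most 1 / n because m >= 2.\<close>
      have rm: "r ^ m / real n ^ m \<le> 1 / real n"
      proof -
        have "r ^ m / real n ^ m = (1 / r) ^ m"
        proof -
          have "r ^ m / real n ^ m = (r / (r * r)) ^ m" using r(2) by (simp add: power_divide power2_eq_square)
          also have "r / (r * r) = 1 / r" using r by simp
          finally show ?thesis .
        qed
        also have "\<dots> \<le> (1 / r) ^ 2" using r m by (intro power_decreasing) auto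
        also have "\<dots> = 1 / real n" using r by (simp add: power_divide)
        finally show ?thesis .
      qed
      have sk: "real (Suc \<kappa>) / real n \<le> T + 1"
      proof -
        have "1 / real n \<le> 1" using n0 by simp
        then show ?thesis using \<kappa>T by (simp add: add_divide_distrib)
      qed
      have "r ^ m * (real (Suc \<kappa>) * (D1 / real n ^ m + D0 / real n ^ m)) = (r ^ m / real n ^ m) * (real (Suc \<kappa>) * (D1 + D0))"
        unfolding add_divide_distrib[symmetric] by (simp del: of_nat_Suc)
      also have "\<dots> \<le> (1 / real n) * (real (Suc \<kappa>) * (D1 + D0))"
        using rm D by (intro mult_right_mono) auto
      also have "\<dots> = (real (Suc \<kappa>) / real n) * (D1 + D0)" by simp
      also have "\<dots> \<le> (T + 1) * (D1 + D0)" using sk D by (intro mult_right_mono) auto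
      finally show "r ^ m * (real (Suc \<kappa>) * (D1 / real n ^ m + D0 / real n ^ m)) \<le> (T + 1) * (D1 + D0)" .
    qed (use c1 in auto)
    finally have "(\<integral>\<^sup>+\<omega>. Dom \<omega> \<partial>Pr) \<le> ennreal K" .
    moreover have "(\<integral>\<^sup>+\<omega>. (\<Squnion>t\<in>{0..T}. ennreal ((1 + (norm (Y i t \<omega>))\<^sup>2) powr (q / 2))) \<partial>prod_space M0 M1) \<le> (\<integral>\<^sup>+\<omega>. Dom \<omega> \<partial>Pr)"
      unfolding prod_space_def nn_integral_completion by (rule nn_integral_mono_AE[OF dominated])
    ultimately show "(\<integral>\<^sup>+\<omega>. (\<Squnion>t\<in>{0..T}. ennreal ((1 + (norm (Y i t \<omega>))\<^sup>2) powr (q / 2))) \<partial>prod_space M0 M1) \<le> ennreal K"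
      by (rule order_trans[rotated])
  qed
qed

end

theorem lemma3p2:
  fixes T \<rho> L p0 p1 :: real
    and M0 :: "'v measure" and F0 :: "real \<Rightarrow> 'v measure"
    and M1 :: "'w measure" and F1 :: "real \<Rightarrow> 'w measure"
    and W0 :: "real \<Rightarrow> 'v \<Rightarrow> real ^ 'm0"
    and W :: "nat \<Rightarrow> real \<Rightarrow> 'w \<Rightarrow> real ^ 'm"
    and X0 :: "'w \<Rightarrow> real ^ 'd" and \<xi> :: "nat \<Rightarrow> 'w \<Rightarrow> real ^ 'd"
    and b :: "real \<Rightarrow> real ^ 'd \<Rightarrow> (real ^ 'd) measure \<Rightarrow> real ^ 'd"
    and \<sigma> :: "real \<Rightarrow> real ^ 'd \<Rightarrow> (real ^ 'd) measure \<Rightarrow> real ^ 'm ^ 'd"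
    and \<sigma>0 :: "real \<Rightarrow> real ^ 'd \<Rightarrow> (real ^ 'd) measure \<Rightarrow> real ^ 'm0 ^ 'd"
    and X :: "nat \<Rightarrow> nat \<Rightarrow> nat \<Rightarrow> real \<Rightarrow> 'v \<times> 'w \<Rightarrow> real ^ 'd"
  assumes "T > 0"
    \<comment> \<open>the stochastic basis\<close>
    and "prob_space M0" "complete_measure M0" "usual_filtration T M0 F0"
    and "prob_space M1" "complete_measure M1" "usual_filtration T M1 F1"
    and "wiener_process T M0 F0 W0"
    and "\<And>i. i \<ge> 1 \<Longrightarrow> wiener_process T M1 F1 (W i)"
    and "indep_processes T M1 W {1..}"
    and "X0 \<in> borel_measurable M1"
    and "\<And>i. i \<ge> 1 \<Longrightarrow> \<xi> i \<in> borel_measurable (F1 0)"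
    and "\<And>i. i \<ge> 1 \<Longrightarrow> distr M1 borel (\<xi> i) = distr M1 borel X0"
    and "prob_space.indep_vars M1 (\<lambda>_. borel) \<xi> {1..}"
    \<comment> \<open>the coefficients\<close>
    and "measurable_coeff T b" "measurable_coeff T \<sigma>" "measurable_coeff T \<sigma>0"
    and "p0 > 2" "p1 > 2" "\<rho> > 0" "L > 0"
    and "integrable M1 (\<lambda>\<omega>. norm (X0 \<omega>) powr p0)"
    and "\<And>t x \<mu>. t \<in> {0..T} \<Longrightarrow> \<mu> \<in> P2 \<Longrightarrow>
      2 * (x \<bullet> b t x \<mu>) + (p0 - 1) * (norm (\<sigma> t x \<mu>))\<^sup>2 + (p0 - 1) * (norm (\<sigma>0 t x \<mu>))\<^sup>2
        \<le> L * ((1 + norm x)\<^sup>2 + (W2 \<mu> (return borel 0))\<^sup>2)"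
    and "\<And>t x y \<mu> \<nu>. t \<in> {0..T} \<Longrightarrow> \<mu> \<in> P2 \<Longrightarrow> \<nu> \<in> P2 \<Longrightarrow>
      2 * ((x - y) \<bullet> (b t x \<mu> - b t y \<nu>))
        + (p1 - 1) * (norm (\<sigma> t x \<mu> - \<sigma> t y \<nu>))\<^sup>2
        + (p1 - 1) * (norm (\<sigma>0 t x \<mu> - \<sigma>0 t y \<nu>))\<^sup>2
        \<le> L * ((norm (x - y))\<^sup>2 + (W2 \<mu> \<nu>)\<^sup>2)"
    and "\<And>t x y \<mu> \<nu>. t \<in> {0..T} \<Longrightarrow> \<mu> \<in> P2 \<Longrightarrow> \<nu> \<in> P2 \<Longrightarrow>
      norm (b t x \<mu> - b t y \<nu>)
        \<le> L * ((1 + norm x + norm y) powr (\<rho> / 2) * norm (x - y) + W2 \<mu> \<nu>)"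
    \<comment> \<open>\<open>X i N n\<close> is the \<open>i\<close>-th component of the scheme with \<open>N\<close> particles and step size \<open>1/n\<close>\<close>
    and "\<And>N n. N \<ge> 1 \<Longrightarrow> n \<ge> 1 \<Longrightarrow>
      tamed_euler_scheme T M0 M1 \<rho> b \<sigma> \<sigma>0 W0 W \<xi> N n (\<lambda>i. X i N n)"
  shows "(\<exists>K>0. \<forall>N\<ge>1. \<forall>n\<ge>1.
            (\<Squnion>i\<in>{1..N}. \<Squnion>t\<in>{0..T}.
               \<integral>\<^sup>+ \<omega>. ennreal ((1 + (norm (X i N n t \<omega>))\<^sup>2) powr (p0 / 2)) \<partial>prod_space M0 M1)
            \<le> ennreal K) \<and>
         (\<forall>q<p0. \<exists>K>0. \<forall>N\<ge>1. \<forall>n\<ge>1.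
            (\<Squnion>i\<in>{1..N}.
               \<integral>\<^sup>+ \<omega>. (\<Squnion>t\<in>{0..T}. ennreal ((1 + (norm (X i N n t \<omega>))\<^sup>2) powr (q / 2))) \<partial>prod_space M0 M1)
            \<le> ennreal K)"
proof -
  interpret tamed_particles T \<rho> L p0 p1 b \<sigma> \<sigma>0 M0 F0 M1 F1 W0 W X0 \<xi>
    by (intro tamed_particles.intro coefficients.intro tamed_particles_axioms.intro) (fact assms)+
  show ?thesis
  proof (intro conjI allI impI)
    show "\<exists>K>0. \<forall>N\<ge>1. \<forall>n\<ge>1. (\<Squnion>i\<in>{1..N}. \<Squnion>t\<in>{0..T}.
        \<integral>\<^sup>+ \<omega>. ennreal ((1 + (norm (X i N n t \<omega>))\<^sup>2) powr (p0 / 2)) \<partial>prod_space M0 M1) \<le> ennreal K"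
    proof (rule uniform_moment_bound, goal_cases)
      case (1 K)
      have "(\<integral>\<^sup>+ \<omega>. ennreal ((1 + (norm (X i N n t \<omega>))\<^sup>2) powr (p0 / 2)) \<partial>prod_space M0 M1) \<le> ennreal K"
        if "N \<ge> 1" "n \<ge> 1" "i \<in> {1..N}" "t \<in> {0..T}" for N n i t
        \<comment> \<open>\<open>assms(26)\<close> is the scheme equation; the family X is
          re-indexed so that the particle index comes first for fixed N and n.\<close>
        using 1(2)[of N n "\<lambda>i. X i N n" i t] assms(26) that by blast
      then show ?case using 1(1) by (intro exI[of _ K] conjI allI impI SUP_least)
    qed
    fix q assume "q < p0"
    then show "\<exists>K>0. \<forall>N\<ge>1. \<forall>n\<ge>1. (\<Squnion>i\<in>{1..N}.
        \<integral>\<^sup>+ \<omega>. (\<Squnion>t\<in>{0..T}. ennreal ((1 + (norm (X i N n t \<omega>))\<^sup>2) powr (q / 2))) \<partial>prod_space M0 M1) \<le> ennreal K"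
    proof (rule uniform_maximal_bound, goal_cases)
      case (1 K)
      have "(\<integral>\<^sup>+ \<omega>. (\<Squnion>t\<in>{0..T}. ennreal ((1 + (norm (X i N n t \<omega>))\<^sup>2) powr (q / 2))) \<partial>prod_space M0 M1) \<le> ennreal K"
        if "N \<ge> 1" "n \<ge> 1" "i \<in> {1..N}" for N n i
        using 1(2)[of N n "\<lambda>i. X i N n" i] assms(26) that by blast
      then show ?case using 1(1) by (intro exI[of _ K] conjI allI impI SUP_least)
    qed
  qed
qed

end
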